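(* Let $\mathcal{D}=(G,\chi,g,0)$ be a group datum of nilpotent type with $n\ge 2$ the order of $\chi(g)$, let $H=H_{\mathcal D}$, let $r(H)$ be its Green ring, and let $M[i,j]\in r(H)$ ($1\le i\le m$, $1\le j\le n$) and the permutation $\tau$ be as defined in the context. Let $1\le k,l\le n$. The following hold in $r(H)$: (1) If $k+l-1\le n$, then $$M[1,k]M[1,l]=\sum_{t=0}^{\min\{k,l\}-1}M[\tau^t(1),k+l-1-2t].$$ (2) If $k+l-1\ge n$, let $r=k+l-1-n$. Then $$M[1,k]M[1,l]=\sum_{t=0}^{r}M[\tau^t(1),n]+\sum_{t=r+1}^{\min\{k,l\}-1}M[\tau^t(1),k+l-1-2t].$$
   Context: $\mathbb{K}$ is an algebraically closed field of characteristic zero; modules are finite dimensional left modules; $\otimes=\otimes_{\mathbb K}$. Group datum: $G$ is a finite group, $g$ an element of the center of $G$, $\chi:G\to\mathbb{K}^\times$ a linear character, $q=\chi(g)$ has order $n\ge 2$. $H=H_{\mathcal D}$ is the $\mathbb K$-algebra generated by $y$ and the elements $h\in G$, containing $\mathbb{K}G$ as a subalgebra, with relations $y^n=0$ and $yh=\chi(h)hy$ for $h\in G$; it has basis $\{y^ih\mid h\in G,\ 0\le i\le n-1\}$. It is a Hopf algebra with $\Delta(y)=y\otimes g+1\otimes y$, $\varepsilon(y)=0$, $S(y)=-yg^{-1}$, and $\Delta(h)=h\otimes h$, $\varepsilon(h)=1$, $S(h)=h^{-1}$ for $h\in G$. $V_1,\dots,V_m$ is a complete set of non-isomorphic simple $\mathbb{K}G$-modules,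 with $V_1$ the trivial module; each is regarded as a simple $H$-module with $y$ acting by $0$. $V_{\chi^{t}}$ is the one-dimensional module with character $\chi^t$. $\tau$ is the permutation of $\{1,\dots,m\}$ with $V_{\chi^{-1}}\otimes V_i\cong V_i\otimes V_{\chi^{-1}}\cong V_{\tau(i)}$. For $1\le i\le m$, $1\le j\le n$, $M(i,j)=V_i\oplus xV_i\oplus\cdots\oplus x^{j-1}V_i$ (formal copies $x^kV_i$ of the vector space $V_i$), with $h(x^kv)=\chi^{-k}(h)\,x^k(hv)$ for $h\in G$, and $y(x^kv)=x^{k+1}v$ if $0\le k\le j-2$, $y(x^{j-1}v)=0$, for $v\in V_i$. The $M(i,j)$ form a complete set of non-isomorphic indecomposable $H$-modules. The Green ring $r(A)$ of a Hopf algebra $A$ is the free abelian group on isomorphism classes $[V]$ of finite dimensional $A$-modules modulo $[M\oplus N]=[M]+[N]$, with product $[M][N]=[M\otimes N]$. $M[i,j]$ denotes the class of $M(i,j)$ in $r(H)$. *)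

theory Defs
  imports "HOL-Algebra.QuotRing" "HOL-Algebra.Generated_Groups" "HOL-Algebra.Free_Abelian_Groups"
    "HOL-Computational_Algebra.Polynomial" "Jordan_Normal_Form.Matrix"
begin

section \<open>Hopf algebras on a finite basis\<close>

text \<open>
  All algebras here are finite dimensional over the field \<^typ>\<open>'k\<close> and come with a finite basis
  \<^term>\<open>B :: 'b set\<close>; an element is its coefficient function, vanishing off \<^term>\<open>B\<close>, and an
  element of the tensor square is a coefficient function on pairs of basis elements.
\<close>

definition free_space :: "'b set \<Rightarrow> ('b \<Rightarrow> 'k::zero) set" where
  "free_space B = {u. \<forall>b. b \<notin> B \<longrightarrow> u b = 0}"

definition basis_elt :: "'b \<Rightarrow> 'b \<Rightarrow> 'k::zero_neq_one" where
  "basis_elt b = (\<lambda>x. if x = b then 1 else 0)"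

definition lin_ext :: "'b set \<Rightarrow> ('b \<Rightarrow> 'c \<Rightarrow> 'k::comm_semiring_0) \<Rightarrow> ('b \<Rightarrow> 'k) \<Rightarrow> 'c \<Rightarrow> 'k" where
  "lin_ext B f u = (\<lambda>x. \<Sum>b\<in>B. u b * f b x)"

definition elt_tensor :: "('b \<Rightarrow> 'k) \<Rightarrow> ('c \<Rightarrow> 'k) \<Rightarrow> 'b \<times> 'c \<Rightarrow> 'k::times" where
  "elt_tensor u v = (\<lambda>(b, c). u b * v c)"

text \<open>The algebra with basis \<open>B\<close>, product \<open>b b' = p b b'\<close> of basis elements, and unit \<open>e\<close>.\<close>

definition based_algebra ::
    "'b set \<Rightarrow> ('b \<Rightarrow> 'b \<Rightarrow> 'b \<Rightarrow> 'k) \<Rightarrow> ('b \<Rightarrow> 'k) \<Rightarrow> ('k::comm_semiring_0, 'b \<Rightarrow> 'k) module" where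
  "based_algebra B p e =
    \<lparr>carrier = free_space B,
     monoid.mult = (\<lambda>u v. lin_ext B (\<lambda>b. lin_ext B (p b) v) u),
     monoid.one = e,
     ring.zero = (\<lambda>_. 0),
     ring.add = (\<lambda>u v x. u x + v x),
     module.smult = (\<lambda>c u x. c * u x)\<rparr>"

text \<open>The tensor square, with \<open>(b \<otimes> c) (b' \<otimes> c') = b b' \<otimes> c c'\<close>.\<close>

definition tensor_square ::
    "'b set \<Rightarrow> ('k::comm_semiring_1, 'b \<Rightarrow> 'k, 'x) module_scheme \<Rightarrow> ('k, 'b \<times> 'b \<Rightarrow> 'k) module" where
  "tensor_square B A = based_algebra (B \<times> B)
     (\<lambda>(b, c) (b', c'). elt_tensor (basis_elt b \<otimes>\<^bsub>A\<^esub> basis_elt b') (basis_elt c \<otimes>\<^bsub>A\<^esub> basis_elt c'))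
     (elt_tensor \<one>\<^bsub>A\<^esub> \<one>\<^bsub>A\<^esub>)"

record ('k, 'b) hopf = "('k, 'b \<Rightarrow> 'k) module" +
  hbasis :: "'b set"
  comult :: "('b \<Rightarrow> 'k) \<Rightarrow> 'b \<times> 'b \<Rightarrow> 'k"
  counit :: "('b \<Rightarrow> 'k) \<Rightarrow> 'k"
  antipode :: "('b \<Rightarrow> 'k) \<Rightarrow> 'b \<Rightarrow> 'k"

text \<open>The structure maps \<open>\<Delta>\<close>, \<open>\<epsilon>\<close>, \<open>S\<close> are given on the basis and extended linearly.\<close>

definition based_hopf ::
    "'b set \<Rightarrow> ('k, 'b \<Rightarrow> 'k) module \<Rightarrow> ('b \<Rightarrow> 'b \<times> 'b \<Rightarrow> 'k) \<Rightarrow> ('b \<Rightarrow> 'k) \<Rightarrow> ('b \<Rightarrow> 'b \<Rightarrow> 'k)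
      \<Rightarrow> ('k::comm_semiring_0, 'b) hopf" where
  "based_hopf B A D E S = module.extend A
    (hopf.fields B (lin_ext B D) (\<lambda>u. \<Sum>b\<in>B. u b * E b) (lin_ext B S))"

definition group_algebra :: "('g, 'x) monoid_scheme \<Rightarrow> ('k::comm_ring_1, 'g) hopf" where
  "group_algebra G = based_hopf (carrier G)
     (based_algebra (carrier G) (\<lambda>h k. basis_elt (h \<otimes>\<^bsub>G\<^esub> k)) (basis_elt \<one>\<^bsub>G\<^esub>))
     (\<lambda>h. basis_elt (h, h)) (\<lambda>_. 1) (\<lambda>h. basis_elt (inv\<^bsub>G\<^esub> h))"


section \<open>Group data of nilpotent type and their Hopf algebras\<close>

text \<open>The group datum \<open>(G, \<chi>, g, 0)\<close>, together with the order \<open>n \<ge> 2\<close> of \<open>\<chi>(g)\<close>.\<close>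

locale nilpotent_group_datum = group G for G :: "'g monoid" (structure) +
  fixes \<chi> :: "'g \<Rightarrow> 'k::field" and g :: 'g and n :: nat
  assumes finite_carrier: "finite (carrier G)"
    and g_closed: "g \<in> carrier G"
    and g_central: "h \<in> carrier G \<Longrightarrow> g \<otimes> h = h \<otimes> g"
    and character_nonzero: "h \<in> carrier G \<Longrightarrow> \<chi> h \<noteq> 0"
    and character_mult: "\<lbrakk>h \<in> carrier G; k \<in> carrier G\<rbrakk> \<Longrightarrow> \<chi> (h \<otimes> k) = \<chi> h * \<chi> k"
    and order_ge_2: "2 \<le> n"
    and order_power: "\<chi> g ^ n = 1"
    and order_minimal: "\<lbrakk>0 < i; i < n\<rbrakk> \<Longrightarrow> \<chi> g ^ i \<noteq> 1"

definition H_basis :: "('g, 'x) monoid_scheme \<Rightarrow> nat \<Rightarrow> (nat \<times> 'g) set" where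
  "H_basis G n = {..<n} \<times> carrier G"

text \<open>
  The pair \<open>(i, h)\<close> stands for \<open>y\<^sup>i h\<close>. The relation \<open>y h = \<chi>(h) h y\<close> gives
  \<open>h y\<^sup>j = \<chi>(h)\<^sup>-\<^sup>j y\<^sup>j h\<close>, whence \<open>(y\<^sup>i h) (y\<^sup>j k) = \<chi>(h)\<^sup>-\<^sup>j y\<^sup>i\<^sup>+\<^sup>j h k\<close>.
\<close>

definition H_algebra ::
    "('g, 'x) monoid_scheme \<Rightarrow> ('g \<Rightarrow> 'k::field) \<Rightarrow> nat \<Rightarrow> ('k, nat \<times> 'g \<Rightarrow> 'k) module" where
  "H_algebra G \<chi> n = based_algebra (H_basis G n)
     (\<lambda>(i, h) (j, k) x. if i + j < n
        then inverse (\<chi> h) ^ j * basis_elt (i + j, h \<otimes>\<^bsub>G\<^esub> k) x else 0)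
     (basis_elt (0, \<one>\<^bsub>G\<^esub>))"

definition H_grp :: "'g \<Rightarrow> nat \<times> 'g \<Rightarrow> 'k::field" where
  "H_grp h = basis_elt (0, h)"

definition H_y :: "('g, 'x) monoid_scheme \<Rightarrow> nat \<times> 'g \<Rightarrow> 'k::field" where
  "H_y G = basis_elt (1, \<one>\<^bsub>G\<^esub>)"

text \<open>
  \<open>\<Delta>\<close> is the algebra map with \<open>\<Delta>(y) = y \<otimes> g + 1 \<otimes> y\<close>, \<open>\<Delta>(h) = h \<otimes> h\<close>, and \<open>S\<close> the algebra
  anti-map with \<open>S(y) = - y g\<^sup>-\<^sup>1\<close>, \<open>S(h) = h\<^sup>-\<^sup>1\<close>; both are evaluated at \<open>y\<^sup>i h\<close>.
\<close>

definition H_hopf ::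
    "('g, 'x) monoid_scheme \<Rightarrow> ('g \<Rightarrow> 'k::field) \<Rightarrow> 'g \<Rightarrow> nat \<Rightarrow> ('k, nat \<times> 'g) hopf" where
  "H_hopf G \<chi> g n =
    (let B = H_basis G n; A = H_algebra G \<chi> n; T = tensor_square B A;
         \<Delta>y = elt_tensor (H_y G) (H_grp g) \<oplus>\<^bsub>T\<^esub> elt_tensor \<one>\<^bsub>A\<^esub> (H_y G);
         Sy = (- 1) \<odot>\<^bsub>A\<^esub> (H_y G \<otimes>\<^bsub>A\<^esub> H_grp (inv\<^bsub>G\<^esub> g))
     in based_hopf B A
          (\<lambda>(i, h). \<Delta>y [^]\<^bsub>T\<^esub> i \<otimes>\<^bsub>T\<^esub> elt_tensor (H_grp h) (H_grp h))
          (\<lambda>(i, h). if i = 0 then 1 else 0)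
          (\<lambda>(i, h). H_grp (inv\<^bsub>G\<^esub> h) \<otimes>\<^bsub>A\<^esub> Sy [^]\<^bsub>A\<^esub> i))"

lemma basis_elt_carrier: "b \<in> B \<Longrightarrow> basis_elt b \<in> free_space B"
  by (auto simp: basis_elt_def free_space_def)

lemma lin_ext_basis_elt:
  assumes "finite B" "b \<in> B"
  shows "lin_ext B f (basis_elt b) = (f b :: _ \<Rightarrow> 'k::comm_semiring_1)"
  using assms by (auto simp: lin_ext_def basis_elt_def if_distrib[of "\<lambda>x. x * _"] cong: if_cong)

text \<open>The defining relations of \<open>H\<close>.\<close>

context nilpotent_group_datum
begin

lemma finite_H_basis: "finite (H_basis G n)"
  using finite_carrier by (simp add: H_basis_def)

lemma H_mult_basis:
  assumes "(i, h) \<in> H_basis G n" "(j, k) \<in> H_basis G n"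
  shows "basis_elt (i, h) \<otimes>\<^bsub>H_algebra G \<chi> n\<^esub> basis_elt (j, k) =
    (\<lambda>x. if i + j < n then inverse (\<chi> h) ^ j * basis_elt (i + j, h \<otimes> k) x else 0)"
  using assms finite_H_basis by (simp add: H_algebra_def based_algebra_def lin_ext_basis_elt)

lemma character_one: "\<chi> \<one> = 1"
  using character_mult[of \<one> \<one>] character_nonzero[of \<one>] by simp

lemma H_grp_mult:
  assumes "h \<in> carrier G" "k \<in> carrier G"
  shows "H_grp h \<otimes>\<^bsub>H_algebra G \<chi> n\<^esub> H_grp k = H_grp (h \<otimes> k)"
  using assms order_ge_2 H_mult_basis[of 0 h 0 k] by (auto simp: H_grp_def H_basis_def)

lemma H_commutation:
  assumes "h \<in> carrier G"
  shows "H_y G \<otimes>\<^bsub>H_algebra G \<chi> n\<^esub> H_grp h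
    = \<chi> h \<odot>\<^bsub>H_algebra G \<chi> n\<^esub> (H_grp h \<otimes>\<^bsub>H_algebra G \<chi> n\<^esub> H_y G)"
  using assms order_ge_2 H_mult_basis[of 0 h 1 \<one>] H_mult_basis[of 1 \<one> 0 h] character_nonzero[of h]
  by (auto simp: H_grp_def H_y_def H_basis_def H_algebra_def based_algebra_def fun_eq_iff)

lemma H_y_power:
  "H_y G [^]\<^bsub>H_algebra G \<chi> n\<^esub> i = (if i < n then basis_elt (i, \<one>) else (\<lambda>_. 0))"
proof (induction i)
  case 0
  then show ?case using order_ge_2 by (simp add: H_algebra_def based_algebra_def nat_pow_def)
next
  case (Suc i)
  have 1: "(1, \<one>) \<in> H_basis G n" using order_ge_2 by (simp add: H_basis_def)
  show ?case
  proof (cases "i < n")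
    case True
    then have "(i, \<one>) \<in> H_basis G n" by (simp add: H_basis_def)
    from H_mult_basis[OF this 1] show ?thesis
      using True Suc by (auto simp: nat_pow_def H_y_def character_one)
  next
    case False
    have "(\<lambda>_. 0) \<otimes>\<^bsub>H_algebra G \<chi> n\<^esub> v = (\<lambda>_. 0)" for v
      by (simp add: H_algebra_def based_algebra_def lin_ext_def)
    then show ?thesis using False Suc by (simp add: nat_pow_def)
  qed
qed

lemma H_nilpotent: "H_y G [^]\<^bsub>H_algebra G \<chi> n\<^esub> n = \<zero>\<^bsub>H_algebra G \<chi> n\<^esub>"
  by (subst H_y_power) (simp add: H_algebra_def based_algebra_def)

lemma H_basis_expression:
  assumes "i < n" "h \<in> carrier G"
  shows "H_y G [^]\<^bsub>H_algebra G \<chi> n\<^esub> i \<otimes>\<^bsub>H_algebra G \<chi> n\<^esub> H_grp h = basis_elt (i, h)"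
  using assms H_mult_basis[of i \<one> 0 h] by (simp add: H_y_power H_grp_def H_basis_def)

end


section \<open>Finite dimensional modules\<close>

text \<open>
  Every finite dimensional left module is isomorphic to one with underlying space \<open>K\<^sup>d\<close>, and the
  latter form a set. So a module is a dimension \<open>d\<close> together with, for each element \<open>a\<close> of the
  algebra, the matrix by which \<open>a\<close> acts on column vectors.
\<close>

record ('b, 'k) fd_module =
  vdim :: nat
  act :: "('b \<Rightarrow> 'k) \<Rightarrow> 'k mat"

definition left_module :: "('k::field, 'b) hopf \<Rightarrow> ('b, 'k) fd_module \<Rightarrow> bool" where
  "left_module A M \<longleftrightarrow>
    (\<forall>a\<in>carrier A. act M a \<in> carrier_mat (vdim M) (vdim M)) \<and>
    (\<forall>a\<in>carrier A. \<forall>b\<in>carrier A. act M (a \<oplus>\<^bsub>A\<^esub> b) = act M a + act M b) \<and>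
    (\<forall>c. \<forall>a\<in>carrier A. act M (c \<odot>\<^bsub>A\<^esub> a) = c \<cdot>\<^sub>m act M a) \<and>
    (\<forall>a\<in>carrier A. \<forall>b\<in>carrier A. act M (a \<otimes>\<^bsub>A\<^esub> b) = act M a * act M b) \<and>
    act M \<one>\<^bsub>A\<^esub> = 1\<^sub>m (vdim M)"

definition module_iso ::
    "('k::field, 'b) hopf \<Rightarrow> ('b, 'k) fd_module \<Rightarrow> ('b, 'k) fd_module \<Rightarrow> bool" where
  "module_iso A M N \<longleftrightarrow> vdim M = vdim N \<and>
    (\<exists>P \<in> carrier_mat (vdim N) (vdim M). invertible_mat P \<and>
       (\<forall>a\<in>carrier A. P * act M a = act N a * P))"

definition submodule_set :: "('k::field, 'b) hopf \<Rightarrow> ('b, 'k) fd_module \<Rightarrow> 'k vec set \<Rightarrow> bool" where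
  "submodule_set A M W \<longleftrightarrow>
    W \<subseteq> carrier_vec (vdim M) \<and> 0\<^sub>v (vdim M) \<in> W \<and>
    (\<forall>v\<in>W. \<forall>w\<in>W. v + w \<in> W) \<and> (\<forall>c. \<forall>v\<in>W. c \<cdot>\<^sub>v v \<in> W) \<and>
    (\<forall>a\<in>carrier A. \<forall>v\<in>W. act M a *\<^sub>v v \<in> W)"

definition simple_module :: "('k::field, 'b) hopf \<Rightarrow> ('b, 'k) fd_module \<Rightarrow> bool" where
  "simple_module A M \<longleftrightarrow> left_module A M \<and> vdim M \<noteq> 0 \<and>
    (\<forall>W. submodule_set A M W \<longrightarrow> W = {0\<^sub>v (vdim M)} \<or> W = carrier_vec (vdim M))"

definition complete_simples ::
    "('k::field, 'b) hopf \<Rightarrow> nat \<Rightarrow> (nat \<Rightarrow> ('b, 'k) fd_module) \<Rightarrow> bool" where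
  "complete_simples A m V \<longleftrightarrow>
    (\<forall>i\<in>{1..m}. simple_module A (V i)) \<and>
    (\<forall>i\<in>{1..m}. \<forall>j\<in>{1..m}. module_iso A (V i) (V j) \<longrightarrow> i = j) \<and>
    (\<forall>M. simple_module A M \<longrightarrow> (\<exists>i\<in>{1..m}. module_iso A M (V i)))"

definition trivial_module :: "('k::field, 'b) hopf \<Rightarrow> ('b, 'k) fd_module" where
  "trivial_module A = \<lparr>vdim = 1, act = (\<lambda>a. counit A a \<cdot>\<^sub>m 1\<^sub>m 1)\<rparr>"

definition direct_sum :: "('b, 'k::field) fd_module \<Rightarrow> ('b, 'k) fd_module \<Rightarrow> ('b, 'k) fd_module" where
  "direct_sum M N = \<lparr>vdim = vdim M + vdim N,
     act = (\<lambda>a. four_block_mat (act M a) (0\<^sub>m (vdim M) (vdim N)) (0\<^sub>m (vdim N) (vdim M)) (act N a))\<rparr>"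

text \<open>
  In \<open>K\<^sup>d \<otimes> K\<^sup>e = K\<^sup>d\<^sup>e\<close> the basis vector \<open>e\<^sub>r \<otimes> e\<^sub>s\<close> has index \<open>r e + s\<close>, so that \<open>X \<otimes> Y\<close> becomes
  the Kronecker product.
\<close>

definition kron_mat :: "'k::semiring_0 mat \<Rightarrow> 'k mat \<Rightarrow> 'k mat" where
  "kron_mat X Y = mat (dim_row X * dim_row Y) (dim_col X * dim_col Y)
     (\<lambda>(r, s). X $$ (r div dim_row Y, s div dim_col Y) * Y $$ (r mod dim_row Y, s mod dim_col Y))"

definition sum_mat :: "nat \<Rightarrow> 'i set \<Rightarrow> ('i \<Rightarrow> 'k::comm_monoid_add mat) \<Rightarrow> 'k mat" where
  "sum_mat d I X = mat d d (\<lambda>rs. \<Sum>i\<in>I. X i $$ rs)"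

text \<open>\<open>a (v \<otimes> w) = \<Sum> a\<^sub>1 v \<otimes> a\<^sub>2 w\<close>, where \<open>\<Delta>(a) = \<Sum> a\<^sub>1 \<otimes> a\<^sub>2\<close>.\<close>

definition tensor_module ::
    "('k::field, 'b) hopf \<Rightarrow> ('b, 'k) fd_module \<Rightarrow> ('b, 'k) fd_module \<Rightarrow> ('b, 'k) fd_module" where
  "tensor_module A M N = \<lparr>vdim = vdim M * vdim N,
     act = (\<lambda>a. sum_mat (vdim M * vdim N) (hbasis A \<times> hbasis A)
       (\<lambda>(b, c). comult A a (b, c) \<cdot>\<^sub>m kron_mat (act M (basis_elt b)) (act N (basis_elt c))))\<rparr>"


section \<open>The Green ring\<close>

definition iso_class ::
    "('k::field, 'b) hopf \<Rightarrow> ('b, 'k) fd_module \<Rightarrow> ('b, 'k) fd_module set" where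
  "iso_class A M = {N. left_module A N \<and> module_iso A M N}"

definition iso_classes :: "('k::field, 'b) hopf \<Rightarrow> ('b, 'k) fd_module set set" where
  "iso_classes A = iso_class A ` {M. left_module A M}"

definition tensor_class ::
    "('k::field, 'b) hopf \<Rightarrow> ('b, 'k) fd_module set \<Rightarrow> ('b, 'k) fd_module set \<Rightarrow> ('b, 'k) fd_module set" where
  "tensor_class A X Y = (\<Union>M\<in>X. \<Union>N\<in>Y. iso_class A (tensor_module A M N))"

text \<open>The free abelian group on the isomorphism classes, with the biadditive extension of \<open>\<otimes>\<close>.\<close>

definition free_green :: "('k::field, 'b) hopf \<Rightarrow> (('b, 'k) fd_module set \<Rightarrow>\<^sub>0 int) ring" where
  "free_green A =
    \<lparr>carrier = carrier (free_Abelian_group (iso_classes A)),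
     monoid.mult = (\<lambda>x y. frag_extend (\<lambda>X. frag_extend (\<lambda>Y. frag_of (tensor_class A X Y)) y) x),
     monoid.one = frag_of (iso_class A (trivial_module A)),
     ring.zero = 0,
     ring.add = (+)\<rparr>"

definition green_relations :: "('k::field, 'b) hopf \<Rightarrow> (('b, 'k) fd_module set \<Rightarrow>\<^sub>0 int) set" where
  "green_relations A = generate (free_Abelian_group (iso_classes A))
    {frag_of (iso_class A (direct_sum M N)) - (frag_of (iso_class A M) + frag_of (iso_class A N)) | M N.
      left_module A M \<and> left_module A N}"

definition green_ring :: "('k::field, 'b) hopf \<Rightarrow> (('b, 'k) fd_module set \<Rightarrow>\<^sub>0 int) set ring" where
  "green_ring A = free_green A Quot green_relations A"

definition green_class ::
    "('k::field, 'b) hopf \<Rightarrow> ('b, 'k) fd_module \<Rightarrow> (('b, 'k) fd_module set \<Rightarrow>\<^sub>0 int) set" where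
  "green_class A M = green_relations A +>\<^bsub>free_green A\<^esub> frag_of (iso_class A M)"


section \<open>One-dimensional and indecomposable modules\<close>

text \<open>The one-dimensional \<open>KG\<close>-module with character \<open>\<psi>\<close>.\<close>

definition character_module ::
    "('g, 'x) monoid_scheme \<Rightarrow> ('g \<Rightarrow> 'k::field) \<Rightarrow> ('g, 'k) fd_module" where
  "character_module G \<psi> = \<lparr>vdim = 1, act = (\<lambda>u. (\<Sum>h\<in>carrier G. u h * \<psi> h) \<cdot>\<^sub>m 1\<^sub>m 1)\<rparr>"

definition is_tau ::
    "('g, 'x) monoid_scheme \<Rightarrow> ('g \<Rightarrow> 'k::field) \<Rightarrow> nat \<Rightarrow> (nat \<Rightarrow> ('g, 'k) fd_module) \<Rightarrow> (nat \<Rightarrow> nat) \<Rightarrow> bool" where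
  "is_tau G \<chi> m V \<tau> \<longleftrightarrow> bij_betw \<tau> {1..m} {1..m} \<and>
    (let KG = group_algebra G; L = character_module G (\<lambda>h. inverse (\<chi> h))
     in \<forall>i\<in>{1..m}. module_iso KG (tensor_module KG L (V i)) (V (\<tau> i)) \<and>
                    module_iso KG (tensor_module KG (V i) L) (V (\<tau> i)))"

text \<open>
  \<open>V \<oplus> xV \<oplus> \<dots> \<oplus> x\<^sup>j\<^sup>-\<^sup>1V\<close> is \<open>K\<^sup>j \<otimes> V\<close>, the vector \<open>x\<^sup>k e\<^sub>r\<close> having index \<open>k d + r\<close> where
  \<open>d = dim V\<close>; \<open>y\<close> shifts the exponent of \<open>x\<close>, and \<open>h\<close> acts on \<open>x\<^sup>kV\<close> by \<open>\<chi>(h)\<^sup>-\<^sup>k\<close> times its action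
  on \<open>V\<close>. An element \<open>u = \<Sum> u\<^sub>a\<^sub>h y\<^sup>a h\<close> of \<open>H\<close> acts by the corresponding combination.
\<close>

definition indec_y :: "nat \<Rightarrow> nat \<Rightarrow> 'k::field mat" where
  "indec_y j d = kron_mat (mat j j (\<lambda>(r, s). if r = Suc s then 1 else 0)) (1\<^sub>m d)"

definition indec_grp ::
    "('g \<Rightarrow> 'k::field) \<Rightarrow> ('g, 'k) fd_module \<Rightarrow> nat \<Rightarrow> 'g \<Rightarrow> 'k mat" where
  "indec_grp \<chi> V j h = kron_mat
     (mat j j (\<lambda>(r, s). if r = s then inverse (\<chi> h) ^ r else 0)) (act V (basis_elt h))"

definition indec_module ::
    "('g, 'x) monoid_scheme \<Rightarrow> ('g \<Rightarrow> 'k::field) \<Rightarrow> nat \<Rightarrow> ('g, 'k) fd_module \<Rightarrow> nat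
      \<Rightarrow> (nat \<times> 'g, 'k) fd_module" where
  "indec_module G \<chi> n V j = \<lparr>vdim = j * vdim V,
     act = (\<lambda>u. sum_mat (j * vdim V) (H_basis G n)
       (\<lambda>(a, h). u (a, h) \<cdot>\<^sub>m (indec_y j (vdim V) ^\<^sub>m a * indec_grp \<chi> V j h)))\<rparr>"

end

theory Submission
  imports Defs "Jordan_Normal_Form.Determinant"
begin

text \<open>
  Fix \<open>t\<close> and \<open>j\<close>. If \<open>V\<close> is the one-dimensional module with character \<open>\<chi>\<^sup>-\<^sup>t\<close>, the module built
  from \<open>V\<close> and \<open>j\<close> has a basis \<open>e\<^sub>0, \<dots>, e\<^sub>j\<^sub>-\<^sub>1\<close> which \<open>y\<close> shifts and on which \<open>h\<close> acts by
  \<open>h e\<^sub>r = \<chi>(h)\<^sup>-\<^sup>t\<^sup>-\<^sup>r e\<^sub>r\<close>; it is called \<open>chain t j\<close> below. Since \<open>V\<^sub>1\<close> is trivial and \<open>\<tau>\<close> twists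
  by \<open>\<chi>\<^sup>-\<^sup>1\<close>, it represents \<open>M[\<tau>\<^sup>t(1), j]\<close> (\<open>tau_orbit\<close>, \<open>indec_module_chain\<close>).

  In the Green ring put \<open>z = [chain 0 2]\<close>, \<open>a = [chain 1 1]\<close> and \<open>U\<^sub>j = [chain 0 j]\<close>, with
  \<open>U\<^sub>0 = 0\<close>. Tensoring with \<open>chain 1 1\<close> raises \<open>t\<close> by one, so \<open>[chain t j] = a\<^sup>t U\<^sub>j\<close>. Only the
  products with the two-dimensional module are decomposed explicitly (\<open>two_tensor_chain\<close>,
  \<open>two_tensor_chain_n\<close>):
  \<open>z U\<^sub>k = U\<^sub>k\<^sub>+\<^sub>1 + a U\<^sub>k\<^sub>-\<^sub>1\<close> for \<open>1 \<le> k < n\<close>, and \<open>z U\<^sub>n = U\<^sub>n + a U\<^sub>n\<close>.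
  The reason for the two cases is that
  \<open>y\<^sup>b (e\<^sub>0 \<otimes> e\<^sub>0) = e\<^sub>0 \<otimes> e\<^sub>b + c\<^sub>b (e\<^sub>1 \<otimes> e\<^sub>b\<^sub>-\<^sub>1)\<close> with
  \<open>c\<^sub>b = 1 + q\<^sup>-\<^sup>1 + \<dots> + q\<^sup>-\<^sup>b\<^sup>+\<^sup>1\<close>, where the term \<open>e\<^sub>0 \<otimes> e\<^sub>b\<close> is absent for \<open>b = k\<close>:
  as \<open>c\<^sub>k\<close> is non-zero for \<open>0 < k < n\<close>, the vector \<open>e\<^sub>0 \<otimes> e\<^sub>0\<close> generates a chain of length \<open>k + 1\<close>,
  but \<open>c\<^sub>n = 0\<close>, so for \<open>k = n\<close> that chain has only length \<open>n\<close>.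

  These relations are the recursion of the Chebyshev polynomials of the second kind, cut off at
  \<open>n\<close>. Both product formulas follow from it by induction on the smaller of \<open>k\<close> and \<open>l\<close>,
  by a computation in a ring (\<open>U_mult_le\<close>): multiplying a sum of terms \<open>a\<^sup>t U\<close> by \<open>z\<close> splits each
  term in two, and after a shift of the index the parts regroup into the next two products.

  The computation presupposes that the Green ring is a ring, that is, that tensor products of
  modules are modules again, respect isomorphism, and are associative, unital and distributive.
  As \<open>H\<close> has the basis of all \<open>y\<^sup>i h\<close>, modules can be handled through the matrices of \<open>y\<close> and of
  the \<open>h\<close> in \<open>G\<close>. The delicate relation for a tensor product is
  \<open>(y \<otimes> g + 1 \<otimes> y)\<^sup>n = 0\<close>; it follows from the quantum binomial formula, all of whose inner
  coefficients vanish because \<open>q\<close> has order \<open>n\<close> (\<open>q_commuting_nilpotent\<close>). Coassociativity of the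
  comultiplication and associativity of the Kronecker product make tensor products of matrix
  modules associative on the nose; distributivity on the right costs a permutation of the basis.
\<close>

section \<open>Matrix combinations and Kronecker products\<close>

lemma sum_mat_carrier [simp]: "sum_mat d I X \<in> carrier_mat d d"
  by (simp add: sum_mat_def)

lemma sum_mat_dim [simp]: "dim_row (sum_mat d I X) = d" "dim_col (sum_mat d I X) = d"
  by (simp_all add: sum_mat_def)

lemma sum_mat_index [simp]:
  "r < d \<Longrightarrow> s < d \<Longrightarrow> sum_mat d I X $$ (r, s) = (\<Sum>i\<in>I. X i $$ (r, s))"
  by (simp add: sum_mat_def)

lemma sum_mat_cong:
  "I = J \<Longrightarrow> (\<And>i. i \<in> J \<Longrightarrow> X i = Y i) \<Longrightarrow> sum_mat d I X = sum_mat d J Y"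
  by (simp add: sum_mat_def)

lemma mult_mat_index:
  assumes "A \<in> carrier_mat a b" "B \<in> carrier_mat b c" "r < a" "s < c"
  shows "(A * B) $$ (r, s) = (\<Sum>x<b. A $$ (r, x) * B $$ (x, s))"
  using assms by (auto simp: scalar_prod_def lessThan_atLeast0)

lemma mult_sum_mat:
  fixes A :: "'k::comm_semiring_0 mat"
  assumes A: "A \<in> carrier_mat d d" and X: "\<And>i. i \<in> I \<Longrightarrow> X i \<in> carrier_mat d d"
  shows "A * sum_mat d I X = sum_mat d I (\<lambda>i. A * X i)"
proof (rule eq_matI)
  fix r s assume "r < dim_row (sum_mat d I (\<lambda>i. A * X i))" "s < dim_col (sum_mat d I (\<lambda>i. A * X i))"
  then have rs: "r < d" "s < d" by simp_all
  have "(A * sum_mat d I X) $$ (r, s) = (\<Sum>x<d. A $$ (r, x) * (\<Sum>i\<in>I. X i $$ (x, s)))"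
    using rs by (subst mult_mat_index[OF A sum_mat_carrier]) simp_all
  also have "\<dots> = (\<Sum>i\<in>I. \<Sum>x<d. A $$ (r, x) * X i $$ (x, s))"
    by (simp add: sum_distrib_left) (rule sum.swap)
  also have "\<dots> = (\<Sum>i\<in>I. (A * X i) $$ (r, s))"
    using rs by (intro sum.cong refl mult_mat_index[OF A X, symmetric])
  finally show "(A * sum_mat d I X) $$ (r, s) = sum_mat d I (\<lambda>i. A * X i) $$ (r, s)"
    using rs by simp
qed (use A in auto)

lemma sum_mat_mult:
  fixes A :: "'k::comm_semiring_0 mat"
  assumes A: "A \<in> carrier_mat d d" and X: "\<And>i. i \<in> I \<Longrightarrow> X i \<in> carrier_mat d d"
  shows "sum_mat d I X * A = sum_mat d I (\<lambda>i. X i * A)"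
proof (rule eq_matI)
  fix r s assume "r < dim_row (sum_mat d I (\<lambda>i. X i * A))" "s < dim_col (sum_mat d I (\<lambda>i. X i * A))"
  then have rs: "r < d" "s < d" by simp_all
  have "(sum_mat d I X * A) $$ (r, s) = (\<Sum>x<d. (\<Sum>i\<in>I. X i $$ (r, x)) * A $$ (x, s))"
    using rs by (subst mult_mat_index[OF sum_mat_carrier A]) simp_all
  also have "\<dots> = (\<Sum>i\<in>I. \<Sum>x<d. X i $$ (r, x) * A $$ (x, s))"
    by (simp add: sum_distrib_right) (rule sum.swap)
  also have "\<dots> = (\<Sum>i\<in>I. (X i * A) $$ (r, s))"
    using rs by (intro sum.cong refl mult_mat_index[OF X A, symmetric])
  finally show "(sum_mat d I X * A) $$ (r, s) = sum_mat d I (\<lambda>i. X i * A) $$ (r, s)"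
    using rs by simp
qed (use A in auto)

text \<open>
  If the basis element \<open>b\<close> of an algebra acts by the matrix \<open>K b\<close>, this is the matrix by which the
  element with coefficients \<open>u\<close> acts.
\<close>

definition lin_comb :: "nat \<Rightarrow> 'b set \<Rightarrow> ('b \<Rightarrow> 'k::comm_semiring_0 mat) \<Rightarrow> ('b \<Rightarrow> 'k) \<Rightarrow> 'k mat" where
  "lin_comb d B K u = sum_mat d B (\<lambda>b. u b \<cdot>\<^sub>m K b)"

lemma lin_comb_carrier [simp]: "lin_comb d B K u \<in> carrier_mat d d"
  by (simp add: lin_comb_def)

lemma lin_comb_dim [simp]: "dim_row (lin_comb d B K u) = d" "dim_col (lin_comb d B K u) = d"
  by (simp_all add: lin_comb_def)

lemma lin_comb_cong:
  "(\<And>b. b \<in> B \<Longrightarrow> K b = L b) \<Longrightarrow> (\<And>b. b \<in> B \<Longrightarrow> u b = v b) \<Longrightarrow> lin_comb d B K u = lin_comb d B L v"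
  by (simp add: lin_comb_def cong: sum_mat_cong)

lemma lin_comb_index:
  assumes "\<And>b. b \<in> B \<Longrightarrow> K b \<in> carrier_mat d d" "r < d" "s < d"
  shows "lin_comb d B K u $$ (r, s) = (\<Sum>b\<in>B. u b * K b $$ (r, s))"
proof -
  have "(u b \<cdot>\<^sub>m K b) $$ (r, s) = u b * K b $$ (r, s)" if "b \<in> B" for b
    using assms(1)[OF that] assms(2,3) by auto
  then show ?thesis using assms(2,3) by (simp add: lin_comb_def)
qed

lemma lin_comb_basis_elt:
  fixes K :: "'b \<Rightarrow> 'k::comm_semiring_1 mat"
  assumes "finite B" "b \<in> B" "\<And>b. b \<in> B \<Longrightarrow> K b \<in> carrier_mat d d"
  shows "lin_comb d B K (basis_elt b) = K b"
proof (rule eq_matI)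
  show "dim_row (lin_comb d B K (basis_elt b)) = dim_row (K b)"
    "dim_col (lin_comb d B K (basis_elt b)) = dim_col (K b)" using assms by auto
  fix r s assume "r < dim_row (K b)" "s < dim_col (K b)"
  then have "r < d" "s < d" using assms(2,3) by (metis carrier_matD)+
  then show "lin_comb d B K (basis_elt b) $$ (r, s) = K b $$ (r, s)"
    using assms by (simp add: lin_comb_index basis_elt_def if_distrib[of "\<lambda>x. x * _"] cong: if_cong)
qed

lemma lin_comb_lin_ext:
  fixes K :: "'b \<Rightarrow> 'k::comm_semiring_0 mat"
  assumes K: "\<And>b. b \<in> B \<Longrightarrow> K b \<in> carrier_mat d d"
  shows "lin_comb d B K (lin_ext C f u) = lin_comb d C (\<lambda>c. lin_comb d B K (f c)) u"
proof (rule eq_matI)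
  fix r s
  assume "r < dim_row (lin_comb d C (\<lambda>c. lin_comb d B K (f c)) u)"
    "s < dim_col (lin_comb d C (\<lambda>c. lin_comb d B K (f c)) u)"
  then have rs: "r < d" "s < d" by simp_all
  have "(\<Sum>b\<in>B. (\<Sum>c\<in>C. u c * f c b) * K b $$ (r, s)) =
      (\<Sum>c\<in>C. u c * (\<Sum>b\<in>B. f c b * K b $$ (r, s)))"
    unfolding sum_distrib_right sum_distrib_left mult.assoc by (rule sum.swap)
  then show "lin_comb d B K (lin_ext C f u) $$ (r, s) = lin_comb d C (\<lambda>c. lin_comb d B K (f c)) u $$ (r, s)"
    using rs K by (simp add: lin_comb_index lin_ext_def)
qed simp_all

lemma lin_comb_mult:
  fixes K L :: "'b \<Rightarrow> 'k::comm_semiring_0 mat"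
  assumes K: "\<And>b. b \<in> B \<Longrightarrow> K b \<in> carrier_mat d d" and L: "\<And>c. c \<in> C \<Longrightarrow> L c \<in> carrier_mat d d"
  shows "lin_comb d B K u * lin_comb d C L v = lin_comb d B (\<lambda>b. lin_comb d C (\<lambda>c. K b * L c) v) u"
proof -
  have "lin_comb d B K u * lin_comb d C L v = sum_mat d B (\<lambda>b. u b \<cdot>\<^sub>m K b * lin_comb d C L v)"
    unfolding lin_comb_def[of d B K] by (rule sum_mat_mult) (use K in auto)
  also have "\<dots> = lin_comb d B (\<lambda>b. K b * lin_comb d C L v) u"
    unfolding lin_comb_def[of d B]
    by (intro sum_mat_cong refl mult_smult_assoc_mat[OF K lin_comb_carrier])
  also have "\<dots> = lin_comb d B (\<lambda>b. lin_comb d C (\<lambda>c. K b * L c) v) u"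
  proof (intro lin_comb_cong refl)
    fix b assume b: "b \<in> B"
    have "K b * lin_comb d C L v = sum_mat d C (\<lambda>c. K b * (v c \<cdot>\<^sub>m L c))"
      unfolding lin_comb_def by (rule mult_sum_mat) (use K[OF b] L in auto)
    also have "\<dots> = lin_comb d C (\<lambda>c. K b * L c) v"
      unfolding lin_comb_def by (intro sum_mat_cong refl mult_smult_distrib[OF K[OF b] L])
    finally show "K b * lin_comb d C L v = lin_comb d C (\<lambda>c. K b * L c) v" .
  qed
  finally show ?thesis .
qed

text \<open>
  By bilinearity an action respects all products as soon as it respects those of basis elements.
  This is used for \<open>H\<close> and, since a tensor square is again given by structure constants, for the
  algebra in which the comultiplication takes its values.
\<close>

lemma based_mult_lin_comb:
  fixes K :: "'b \<Rightarrow> 'k::comm_semiring_0 mat"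
  assumes K: "\<And>b. b \<in> B \<Longrightarrow> K b \<in> carrier_mat d d"
    and p: "\<And>b c. b \<in> B \<Longrightarrow> c \<in> B \<Longrightarrow> lin_comb d B K (p b c) = K b * K c"
  shows "lin_comb d B K (u \<otimes>\<^bsub>based_algebra B p e\<^esub> v) = lin_comb d B K u * lin_comb d B K v"
proof -
  have "lin_comb d B K (u \<otimes>\<^bsub>based_algebra B p e\<^esub> v) =
      lin_comb d B (\<lambda>b. lin_comb d B (\<lambda>c. lin_comb d B K (p b c)) v) u"
    using K by (simp add: based_algebra_def lin_comb_lin_ext)
  also have "\<dots> = lin_comb d B (\<lambda>b. lin_comb d B (\<lambda>c. K b * K c) v) u"
    by (intro lin_comb_cong refl p)
  finally show ?thesis using K by (simp add: lin_comb_mult)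
qed

lemma kron_carrier [simp, intro]:
  "A \<in> carrier_mat a b \<Longrightarrow> B \<in> carrier_mat c d \<Longrightarrow> kron_mat A B \<in> carrier_mat (a * c) (b * d)"
  by (auto simp: kron_mat_def)

lemma kron_dim [simp]:
  "dim_row (kron_mat A B) = dim_row A * dim_row B" "dim_col (kron_mat A B) = dim_col A * dim_col B"
  by (simp_all add: kron_mat_def)

lemma kron_index:
  "r < dim_row A * dim_row B \<Longrightarrow> s < dim_col A * dim_col B \<Longrightarrow> kron_mat A B $$ (r, s) =
    A $$ (r div dim_row B, s div dim_col B) * B $$ (r mod dim_row B, s mod dim_col B)"
  by (simp add: kron_mat_def)

lemma div_mod_bounds:
  assumes "r < a * (b::nat)"
  shows "r div b < a" "r mod b < b"
  using assms by (auto simp: less_mult_imp_div_less intro!: mod_less_divisor) (cases b, auto)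

lemma sum_lessThan_times:
  fixes f :: "nat \<Rightarrow> nat \<Rightarrow> 'a::comm_monoid_add"
  shows "(\<Sum>x<b * d. f (x div d) (x mod d)) = (\<Sum>i<b. \<Sum>j<d. f i j)"
proof -
  have "(\<Sum>i<b. \<Sum>j<d. f i j) = (\<Sum>(i, j)\<in>{..<b} \<times> {..<d}. f i j)"
    by (simp add: sum.cartesian_product)
  also have "\<dots> = (\<Sum>x<b * d. f (x div d) (x mod d))"
  proof (rule sum.reindex_bij_witness[where i = "\<lambda>x. (x div d, x mod d)" and j = "\<lambda>(i, j). i * d + j"])
    fix p assume "p \<in> {..<b} \<times> {..<d}"
    then obtain i j where p: "p = (i, j)" "i < b" "j < d" by auto
    have "i * d + j < Suc i * d" using p by simp
    also have "\<dots> \<le> b * d" using p by (intro mult_right_mono) auto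
    finally show "(case p of (i, j) \<Rightarrow> i * d + j) \<in> {..<b * d}" using p by simp
  qed (auto dest: div_mod_bounds)
  finally show ?thesis by simp
qed

lemma kron_mult:
  fixes A :: "'k::comm_semiring_0 mat"
  assumes A: "A \<in> carrier_mat a b" and C: "C \<in> carrier_mat b c"
    and B: "B \<in> carrier_mat a' b'" and D: "D \<in> carrier_mat b' c'"
  shows "kron_mat A B * kron_mat C D = kron_mat (A * C) (B * D)"
proof (rule eq_matI)
  fix r s assume "r < dim_row (kron_mat (A * C) (B * D))" "s < dim_col (kron_mat (A * C) (B * D))"
  then have rs: "r < a * a'" "s < c * c'" using assms by auto
  note bd = div_mod_bounds[OF rs(1)] div_mod_bounds[OF rs(2)]
  have "(kron_mat A B * kron_mat C D) $$ (r, s) =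
      (\<Sum>x<b * b'. kron_mat A B $$ (r, x) * kron_mat C D $$ (x, s))"
    using rs by (intro mult_mat_index[OF kron_carrier[OF A B] kron_carrier[OF C D]])
  also have "\<dots> = (\<Sum>x<b * b'. (A $$ (r div a', x div b') * C $$ (x div b', s div c')) *
      (B $$ (r mod a', x mod b') * D $$ (x mod b', s mod c')))"
    using rs A B C D by (intro sum.cong refl) (auto simp: kron_index ac_simps)
  also have "\<dots> = (\<Sum>i<b. \<Sum>j<b'. (A $$ (r div a', i) * C $$ (i, s div c')) *
      (B $$ (r mod a', j) * D $$ (j, s mod c')))"
    by (rule sum_lessThan_times)
  also have "\<dots> = (A * C) $$ (r div a', s div c') * (B * D) $$ (r mod a', s mod c')"
    using bd by (simp add: mult_mat_index[OF A C] mult_mat_index[OF B D] sum_product)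
  also have "\<dots> = kron_mat (A * C) (B * D) $$ (r, s)"
    using rs A B C D by (auto simp: kron_index)
  finally show "(kron_mat A B * kron_mat C D) $$ (r, s) = kron_mat (A * C) (B * D) $$ (r, s)" .
qed (use assms in auto)

lemma kron_one: "kron_mat (1\<^sub>m a) (1\<^sub>m b) = (1\<^sub>m (a * b) :: 'k::comm_semiring_1 mat)"
proof (rule eq_matI)
  fix r s assume "r < dim_row (1\<^sub>m (a * b) :: 'k mat)" "s < dim_col (1\<^sub>m (a * b) :: 'k mat)"
  then have rs: "r < a * b" "s < a * b" by auto
  have "r = s" if "r div b = s div b" "r mod b = s mod b" using that by (metis mult_div_mod_eq)
  then show "kron_mat (1\<^sub>m a) (1\<^sub>m b) $$ (r, s) = (1\<^sub>m (a * b) :: 'k mat) $$ (r, s)"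
    using rs div_mod_bounds[OF rs(1)] div_mod_bounds[OF rs(2)] by (auto simp: kron_index)
qed auto

lemma kron_pow:
  fixes A :: "'k::comm_semiring_1 mat"
  assumes "A \<in> carrier_mat a a" "B \<in> carrier_mat b b"
  shows "kron_mat A B ^\<^sub>m i = kron_mat (A ^\<^sub>m i) (B ^\<^sub>m i)"
  using assms by (induction i)
    (simp_all add: kron_one kron_mult[OF pow_carrier_mat _ pow_carrier_mat])

text \<open>
  Both sides read an index as the three digits of a number in mixed radix, so they agree without
  any identification of the underlying spaces.
\<close>

lemma kron_assoc:
  fixes A B C :: "'k::comm_semiring_0 mat"
  shows "kron_mat (kron_mat A B) C = kron_mat A (kron_mat B C)"
proof (rule eq_matI)
  fix r s
  assume "r < dim_row (kron_mat A (kron_mat B C))" "s < dim_col (kron_mat A (kron_mat B C))"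
  then have rs: "r < dim_row A * (dim_row B * dim_row C)" "s < dim_col A * (dim_col B * dim_col C)"
    by simp_all
  have rs': "r < (dim_row A * dim_row B) * dim_row C" "s < (dim_col A * dim_col B) * dim_col C"
    using rs by (simp_all add: ac_simps)
  have *: "x mod (e * c) div c = x div c mod e" "x mod (e * c) mod c = x mod c" "x div (e * c) = x div c div e"
    if "x < a * (e * c)" for x a e c :: nat
  proof -
    have "0 < c" using that by (cases c) auto
    show "x mod (e * c) mod c = x mod c" by (simp add: mod_mod_cancel)
    show "x mod (e * c) div c = x div c mod e"
      using \<open>0 < c\<close> by (simp add: mod_mult2_eq[of x c e] mult.commute[of e])
    show "x div (e * c) = x div c div e" by (simp add: div_mult2_eq[of x c e] mult.commute[of e])
  qed
  show "kron_mat (kron_mat A B) C $$ (r, s) = kron_mat A (kron_mat B C) $$ (r, s)"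
    using rs div_mod_bounds[OF rs(1)] div_mod_bounds[OF rs(2)] rs'
      div_mod_bounds[OF rs'(1)] div_mod_bounds[OF rs'(2)]
    by (simp add: kron_index *[OF rs(1)] *[OF rs(2)] ac_simps)
qed (auto simp: ac_simps)

lemma kron_add_left:
  fixes A :: "'k::comm_semiring_0 mat"
  assumes "A \<in> carrier_mat a b" "B \<in> carrier_mat a b" "C \<in> carrier_mat c d"
  shows "kron_mat (A + B) C = kron_mat A C + kron_mat B C"
  by (rule eq_matI) (use assms in \<open>auto simp: kron_index distrib_right div_mod_bounds less_mult_imp_div_less\<close>)

lemma kron_add_right:
  fixes A :: "'k::comm_semiring_0 mat"
  assumes "A \<in> carrier_mat a b" "B \<in> carrier_mat a b" "C \<in> carrier_mat c d"
  shows "kron_mat C (A + B) = kron_mat C A + kron_mat C B"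
  by (rule eq_matI) (use assms in \<open>auto simp: kron_index distrib_left div_mod_bounds less_mult_imp_div_less\<close>)

lemma kron_smult_left:
  fixes A :: "'k::comm_semiring_0 mat"
  shows "kron_mat (c \<cdot>\<^sub>m A) B = c \<cdot>\<^sub>m kron_mat A B"
  by (rule eq_matI) (auto simp: kron_index less_mult_imp_div_less ac_simps)

lemma kron_smult_right:
  fixes A :: "'k::comm_semiring_0 mat"
  shows "kron_mat A (c \<cdot>\<^sub>m B) = c \<cdot>\<^sub>m kron_mat A B"
  by (rule eq_matI) (auto simp: kron_index div_mod_bounds ac_simps)

lemma kron_zero_left: "B \<in> carrier_mat c d \<Longrightarrow> kron_mat (0\<^sub>m a b) B = (0\<^sub>m (a * c) (b * d) :: 'k::comm_semiring_0 mat)"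
  by (rule eq_matI) (auto simp: kron_index less_mult_imp_div_less)

lemma kron_zero_right: "B \<in> carrier_mat c d \<Longrightarrow> kron_mat B (0\<^sub>m a b) = (0\<^sub>m (c * a) (d * b) :: 'k::comm_semiring_0 mat)"
  by (rule eq_matI) (auto simp: kron_index div_mod_bounds)

text \<open>
  This computes the action of an elementary tensor on a tensor product of two modules.
\<close>

lemma kron_lin_comb:
  fixes K :: "'b \<Rightarrow> 'k::comm_semiring_1 mat"
  assumes K: "\<And>b. b \<in> B \<Longrightarrow> K b \<in> carrier_mat d d" and L: "\<And>c. c \<in> C \<Longrightarrow> L c \<in> carrier_mat e e"
  shows "lin_comb (d * e) (B \<times> C) (\<lambda>(b, c). kron_mat (K b) (L c)) (elt_tensor u v) =
    kron_mat (lin_comb d B K u) (lin_comb e C L v)"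
proof (rule eq_matI)
  have KL: "(case p of (b, c) \<Rightarrow> kron_mat (K b) (L c)) \<in> carrier_mat (d * e) (d * e)"
    if "p \<in> B \<times> C" for p
    using that K L by auto
  fix r s
  assume "r < dim_row (kron_mat (lin_comb d B K u) (lin_comb e C L v))"
    "s < dim_col (kron_mat (lin_comb d B K u) (lin_comb e C L v))"
  then have rs: "r < d * e" "s < d * e" by simp_all
  note bd = div_mod_bounds[OF rs(1)] div_mod_bounds[OF rs(2)]
  have "lin_comb (d * e) (B \<times> C) (\<lambda>(b, c). kron_mat (K b) (L c)) (elt_tensor u v) $$ (r, s) =
    (\<Sum>(b, c)\<in>B \<times> C. (u b * K b $$ (r div e, s div e)) * (v c * L c $$ (r mod e, s mod e)))"
    using rs by (subst lin_comb_index[OF KL])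
      (auto intro!: sum.cong simp: elt_tensor_def kron_index carrier_matD[OF K] carrier_matD[OF L] ac_simps)
  also have "\<dots> = lin_comb d B K u $$ (r div e, s div e) * lin_comb e C L v $$ (r mod e, s mod e)"
    using bd by (simp add: lin_comb_index K L sum_product sum.cartesian_product)
  also have "\<dots> = kron_mat (lin_comb d B K u) (lin_comb e C L v) $$ (r, s)"
    using rs by (simp add: kron_index)
  finally show "lin_comb (d * e) (B \<times> C) (\<lambda>(b, c). kron_mat (K b) (L c)) (elt_tensor u v) $$ (r, s) =
    kron_mat (lin_comb d B K u) (lin_comb e C L v) $$ (r, s)" .
qed simp_all


section \<open>The quantum binomial formula\<close>

text \<open>
  The Gaussian binomial coefficients, in the form of the Pascal rule that belongs to products
  \<open>A\<^sup>i B\<^sup>j\<close> with the powers of \<open>A\<close> on the left.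
\<close>

fun qbinom :: "'k::comm_ring_1 \<Rightarrow> nat \<Rightarrow> nat \<Rightarrow> 'k" where
  "qbinom q m 0 = 1"
| "qbinom q 0 (Suc i) = 0"
| "qbinom q (Suc m) (Suc i) = qbinom q m (Suc i) + q ^ (m - i) * qbinom q m i"

lemma qbinom_eq_0: "m < i \<Longrightarrow> qbinom q m i = 0"
  by (induction q m i rule: qbinom.induct) auto

text \<open>
  The \<open>q\<close>-analogue of \<open>(i + 1) \<cdot> C(m + 1, i + 1) = (m + 1) \<cdot> C(m, i)\<close>, \<open>C\<close> being the binomial
  coefficient. When \<open>q\<^sup>m\<^sup>+\<^sup>1 = 1\<close>, the right-hand side vanishes, and so does the coefficient on the
  left whenever \<open>q\<^sup>i\<^sup>+\<^sup>1 \<noteq> 1\<close>.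
\<close>

lemma qbinom_absorption:
  "i \<le> m \<Longrightarrow> (1 - q ^ Suc i) * qbinom q (Suc m) (Suc i) = (1 - q ^ Suc m) * qbinom q m i"
proof (induction m arbitrary: i)
  case 0
  then show ?case by simp
next
  case (Suc m)
  show ?case
  proof (cases "i = Suc m")
    case True
    then show ?thesis by (simp add: qbinom_eq_0)
  next
    case False
    then have im: "i \<le> m" using Suc.prems by simp
    have IH: "(1 - q ^ Suc i) * qbinom q (Suc m) (Suc i) = (1 - q ^ Suc m) * qbinom q m i"
      by (rule Suc.IH[OF im])
    have key: "(1 - q ^ Suc m) * qbinom q m i =
        (1 - q ^ Suc m - q ^ (Suc m - i) + q ^ Suc m) * qbinom q (Suc m) i"
    proof (cases i)
      case (Suc j)
      have "(1 - q ^ i) * qbinom q (Suc m) i = (1 - q ^ Suc m) * qbinom q m j"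
        using Suc.IH[of j] im Suc by simp
      then have a: "q ^ (Suc m - i) * (1 - q ^ i) * qbinom q (Suc m) i =
          (1 - q ^ Suc m) * (q ^ (Suc m - i) * qbinom q m j)"
        proof -
        assume *: "(1 - q ^ i) * qbinom q (Suc m) i = (1 - q ^ Suc m) * qbinom q m j"
        have "q ^ (Suc m - i) * (1 - q ^ i) * qbinom q (Suc m) i =
            q ^ (Suc m - i) * ((1 - q ^ i) * qbinom q (Suc m) i)" by (rule mult.assoc)
        then show ?thesis unfolding * by (simp only: mult.left_commute)
      qed
      have "q ^ (Suc m - i) * q ^ i = q ^ Suc m"
        using im by (simp flip: power_add)
      then have b: "q ^ (Suc m - i) * (1 - q ^ i) = q ^ (Suc m - i) - q ^ Suc m"
        by (simp only: right_diff_distrib mult_1_right)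
      have c: "qbinom q (Suc m) i = qbinom q m i + q ^ (Suc m - i) * qbinom q m j"
        using Suc by simp
      have "(1 - P) * u = (1 - P - w + P) * v" if "v = u + z" "(w - P) * v = (1 - P) * z"
        for P u v w z :: 'a
      proof -
        have "(1 - P - w + P) * v = (1 - P) * v - (w - P) * v" by (simp add: algebra_simps)
        also have "\<dots> = (1 - P) * (u + z) - (1 - P) * z"
          unfolding that(2) by (simp only: that(1))
        finally show ?thesis by (simp add: algebra_simps)
      qed
      from this[OF c] show ?thesis using a b by (simp only:)
    qed simp
    have pow: "q ^ (Suc m - i) * q ^ Suc i = q ^ Suc (Suc m)"
      using im by (simp only: power_add[symmetric]) simp
    have "(1 - q ^ Suc i) * qbinom q (Suc (Suc m)) (Suc i) =
        (1 - q ^ Suc i) * qbinom q (Suc m) (Suc i) +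
        (q ^ (Suc m - i) - q ^ (Suc m - i) * q ^ Suc i) * qbinom q (Suc m) i"
      unfolding qbinom.simps(3)[of q "Suc m"]
      by (simp only: algebra_simps mult_1_left mult_1_right)
    also have "\<dots> = (1 - q ^ Suc (Suc m)) * qbinom q (Suc m) i"
      unfolding IH key pow by (simp only: algebra_simps)
    finally show ?thesis .
  qed
qed

lemma smult_smult_mat: "a \<cdot>\<^sub>m (b \<cdot>\<^sub>m A) = (a * b) \<cdot>\<^sub>m (A :: 'k::semigroup_mult mat)"
  by (intro eq_matI) (auto simp: mult.assoc)

lemma q_commute_pow:
  fixes A B :: "'k::comm_ring_1 mat"
  assumes A: "A \<in> carrier_mat d d" and B: "B \<in> carrier_mat d d" and BA: "B * A = q \<cdot>\<^sub>m (A * B)"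
  shows "B ^\<^sub>m j * A = q ^ j \<cdot>\<^sub>m (A * B ^\<^sub>m j)"
proof (induction j)
  case 0
  then show ?case using A B by auto
next
  case (Suc j)
  have Bj: "B ^\<^sub>m j \<in> carrier_mat d d" using B by simp
  have "B ^\<^sub>m Suc j * A = B ^\<^sub>m j * (B * A)" using A B Bj by (simp add: assoc_mult_mat[OF Bj B A])
  also have "\<dots> = q \<cdot>\<^sub>m (B ^\<^sub>m j * A * B)"
    using A B Bj
    by (simp add: BA mult_smult_distrib[OF Bj mult_carrier_mat[OF A B]] assoc_mult_mat[OF Bj A B])
  also have "\<dots> = q ^ Suc j \<cdot>\<^sub>m (A * B ^\<^sub>m Suc j)"
    using A B Bj by (simp add: Suc.IH mult_smult_assoc_mat[OF mult_carrier_mat[OF A Bj] B] smult_smult_mat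
        assoc_mult_mat[OF A Bj B])
  finally show ?case .
qed

lemma q_binomial:
  fixes A B :: "'k::comm_ring_1 mat"
  assumes A: "A \<in> carrier_mat d d" and B: "B \<in> carrier_mat d d" and BA: "B * A = q \<cdot>\<^sub>m (A * B)"
  shows "(A + B) ^\<^sub>m m = sum_mat d {..m} (\<lambda>i. qbinom q m i \<cdot>\<^sub>m (A ^\<^sub>m i * B ^\<^sub>m (m - i)))"
proof (induction m)
  case 0
  have "(A + B) ^\<^sub>m 0 = 1\<^sub>m d" using A B by simp
  also have "\<dots> = sum_mat d {..0} (\<lambda>i. qbinom q 0 i \<cdot>\<^sub>m (A ^\<^sub>m i * B ^\<^sub>m (0 - i)))"
    using A B by (intro eq_matI) auto
  finally show ?case .
next
  case (Suc m)
  define E where "E i j = A ^\<^sub>m i * B ^\<^sub>m j" for i j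
  have E: "E i j \<in> carrier_mat d d" for i j
    using A B by (auto simp: E_def)
  have EA: "E i j * A = q ^ j \<cdot>\<^sub>m E (Suc i) j" for i j
  proof -
    have Ai: "A ^\<^sub>m i \<in> carrier_mat d d" and Bj: "B ^\<^sub>m j \<in> carrier_mat d d" using A B by auto
    have "E i j * A = A ^\<^sub>m i * (q ^ j \<cdot>\<^sub>m (A * B ^\<^sub>m j))"
      by (simp add: E_def assoc_mult_mat[OF Ai Bj A] q_commute_pow[OF A B BA])
    then show ?thesis
      using A Ai Bj
      by (simp add: E_def mult_smult_distrib[OF Ai mult_carrier_mat[OF A Bj]]
          assoc_mult_mat[OF Ai Bj A] assoc_mult_mat[OF Ai A Bj])
  qed
  have EB: "E i j * B = E i (Suc j)" for i j
    using A B by (simp add: E_def assoc_mult_mat[OF pow_carrier_mat[OF A] pow_carrier_mat[OF B] B])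
  let ?S = "sum_mat d {..m} (\<lambda>i. qbinom q m i \<cdot>\<^sub>m E i (m - i))"
  have "(A + B) ^\<^sub>m Suc m = ?S * A + ?S * B"
    using Suc A B by (simp add: E_def mult_add_distrib_mat[OF sum_mat_carrier A B])
  also have "?S * A = sum_mat d {..m} (\<lambda>i. (qbinom q m i * q ^ (m - i)) \<cdot>\<^sub>m E (Suc i) (m - i))"
    using E A by (subst sum_mat_mult[OF A])
      (auto intro!: sum_mat_cong simp: mult_smult_assoc_mat[OF E A] EA smult_smult_mat)
  also have "?S * B = sum_mat d {..m} (\<lambda>i. qbinom q m i \<cdot>\<^sub>m E i (Suc m - i))"
    using E B by (subst sum_mat_mult[OF B])
      (auto intro!: sum_mat_cong simp: mult_smult_assoc_mat[OF E B] EB Suc_diff_le)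
  also have "sum_mat d {..m} (\<lambda>i. (qbinom q m i * q ^ (m - i)) \<cdot>\<^sub>m E (Suc i) (m - i)) +
      sum_mat d {..m} (\<lambda>i. qbinom q m i \<cdot>\<^sub>m E i (Suc m - i)) =
      sum_mat d {..Suc m} (\<lambda>i. qbinom q (Suc m) i \<cdot>\<^sub>m E i (Suc m - i))" (is "?L = ?R")
  proof (rule eq_matI)
    fix r s assume "r < dim_row ?R" "s < dim_col ?R"
    then have rs: "r < d" "s < d" by simp_all
    define e where "e i j = E i j $$ (r, s)" for i j
    have sm: "(c \<cdot>\<^sub>m E i j) $$ (r, s) = c * e i j" for c i j
      using E[of i j] rs by (auto simp: e_def)
    have "(\<Sum>i\<le>m. qbinom q m i * e i (Suc m - i)) = (\<Sum>i\<le>Suc m. qbinom q m i * e i (Suc m - i))"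
      by (simp add: qbinom_eq_0)
    also have "\<dots> = e 0 (Suc m) + (\<Sum>i\<le>m. qbinom q m (Suc i) * e (Suc i) (m - i))"
      by (subst sum.atMost_Suc_shift) simp
    finally have e: "(\<Sum>i\<le>m. qbinom q m i * e i (Suc m - i)) = \<dots>" .
    have "(\<Sum>i\<le>m. qbinom q m i * q ^ (m - i) * e (Suc i) (m - i)) +
        (\<Sum>i\<le>m. qbinom q m i * e i (Suc m - i)) =
        (\<Sum>i\<le>Suc m. qbinom q (Suc m) i * e i (Suc m - i))"
      unfolding e sum.atMost_Suc_shift by (simp add: sum.distrib algebra_simps)
    then show "?L $$ (r, s) = ?R $$ (r, s)"
      using rs by (simp add: sm)
  qed simp_all
  finally show ?case by (simp add: E_def)
qed

text \<open>
  In the quantum binomial formula the two outer terms vanish because \<open>A\<close> and \<open>B\<close> are nilpotent,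
  and the inner ones because their coefficients do when \<open>q\<close> has order \<open>n\<close>.
\<close>

lemma q_commuting_nilpotent:
  fixes A B :: "'k::field mat"
  assumes A: "A \<in> carrier_mat d d" and B: "B \<in> carrier_mat d d" and BA: "B * A = q \<cdot>\<^sub>m (A * B)"
    and q: "q ^ n = 1" "\<And>i. 0 < i \<Longrightarrow> i < n \<Longrightarrow> q ^ i \<noteq> 1"
    and nil: "A ^\<^sub>m n = 0\<^sub>m d d" "B ^\<^sub>m n = 0\<^sub>m d d" and n: "0 < n"
  shows "(A + B) ^\<^sub>m n = 0\<^sub>m d d"
proof -
  have "qbinom q n i \<cdot>\<^sub>m (A ^\<^sub>m i * B ^\<^sub>m (n - i)) = 0\<^sub>m d d" if i: "i \<le> n" for i
  proof (cases "i = 0 \<or> i = n")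
    case True
    then show ?thesis using A B nil by auto
  next
    case False
    then obtain j where j: "i = Suc j" by (cases i) auto
    have "qbinom q n i = 0"
      using qbinom_absorption[of j "n - 1" q] q(1) q(2)[of i] False i j n by auto
    moreover have "A ^\<^sub>m i * B ^\<^sub>m (n - i) \<in> carrier_mat d d"
      by (rule mult_carrier_mat[OF pow_carrier_mat[OF A] pow_carrier_mat[OF B]])
    ultimately show ?thesis by (intro eq_matI) (auto simp del: index_mult_mat)
  qed
  then have "(A + B) ^\<^sub>m n = sum_mat d {..n} (\<lambda>i. 0\<^sub>m d d)"
    unfolding q_binomial[OF A B BA] by (intro sum_mat_cong) auto
  also have "\<dots> = 0\<^sub>m d d" by (intro eq_matI) auto
  finally show ?thesis .
qed


section \<open>Modules given by generators\<close>

text \<open>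
  The elements \<open>y\<^sup>i h\<close> form a basis of \<open>H\<close>, so a module is determined by the matrix \<open>Y\<close> of \<open>y\<close> and
  the matrices \<open>P h\<close> of the group elements.
\<close>

definition generated_module ::
    "('g, 'x) monoid_scheme \<Rightarrow> nat \<Rightarrow> nat \<Rightarrow> 'k::field mat \<Rightarrow> ('g \<Rightarrow> 'k mat) \<Rightarrow> (nat \<times> 'g, 'k) fd_module" where
  "generated_module G n d Y P =
    \<lparr>vdim = d, act = lin_comb d (H_basis G n) (\<lambda>(i, h). Y ^\<^sub>m i * P h)\<rparr>"

lemma generated_module_cong:
  assumes "d = d'" "Y = Y'" "\<And>h. h \<in> carrier G \<Longrightarrow> P h = P' h"
  shows "generated_module G n d Y P = generated_module G n d' Y' P'"
  using assms by (auto simp: generated_module_def H_basis_def fun_eq_iff intro!: lin_comb_cong)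

lemma vdim_generated_module [simp]: "vdim (generated_module G n d Y P) = d"
  by (simp add: generated_module_def)

context nilpotent_group_datum
begin

abbreviation H :: "('k, nat \<times> 'g) hopf" where "H \<equiv> H_hopf G \<chi> g n"
abbreviation B :: "(nat \<times> 'g) set" where "B \<equiv> H_basis G n"

lemma H_simps:
  "carrier H = free_space B" "\<one>\<^bsub>H\<^esub> = H_grp \<one>" "u \<oplus>\<^bsub>H\<^esub> v = (\<lambda>x. u x + v x)"
  "c \<odot>\<^bsub>H\<^esub> u = (\<lambda>x. c * u x)" "u \<otimes>\<^bsub>H\<^esub> v = u \<otimes>\<^bsub>H_algebra G \<chi> n\<^esub> v" "hbasis H = B"
  by (simp_all add: H_hopf_def Let_def based_hopf_def module.defs hopf.defs H_algebra_def
      based_algebra_def H_grp_def)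

text \<open>
  Modules are required to be additive in two elements at a time only; the expansion in the whole
  basis comes by adding the basis elements one by one.
\<close>

lemma act_lin_comb:
  assumes M: "left_module H M" and u: "u \<in> free_space B"
  shows "act M u = lin_comb (vdim M) B (\<lambda>b. act M (basis_elt b)) u"
proof -
  have carr: "act M a \<in> carrier_mat (vdim M) (vdim M)" if "a \<in> free_space B" for a
    using M that by (auto simp: left_module_def H_simps)
  have add: "act M (\<lambda>x. a x + b x) = act M a + act M b" if "a \<in> free_space B" "b \<in> free_space B" for a b
    using M that by (auto simp: left_module_def H_simps)
  have smult: "act M (\<lambda>x. c * a x) = c \<cdot>\<^sub>m act M a" if "a \<in> free_space B" for a c
    using M that by (auto simp: left_module_def H_simps)
  have "act M (\<lambda>x. if x \<in> C then u x else 0) = lin_comb (vdim M) C (\<lambda>b. act M (basis_elt b)) u"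
    if "finite C" "C \<subseteq> B" for C
    using that
  proof (induction C)
    case empty
    have "act M (\<lambda>_. 0) = 0 \<cdot>\<^sub>m act M u" using smult[OF u, of 0] by simp
    also have "\<dots> = lin_comb (vdim M) {} (\<lambda>b. act M (basis_elt b)) u"
      using carr[OF u] by (intro eq_matI) (auto simp: lin_comb_def)
    finally show ?case by simp
  next
    case (insert c C)
    have c: "basis_elt c \<in> free_space B" using insert by (intro basis_elt_carrier) auto
    have uc: "(\<lambda>x. u c * basis_elt c x) \<in> free_space B"
      using insert by (auto simp: free_space_def basis_elt_def)
    have uC: "(\<lambda>x. if x \<in> C then u x else 0) \<in> free_space B"
      using insert by (auto simp: free_space_def)
    have K: "act M (basis_elt b) \<in> carrier_mat (vdim M) (vdim M)" if "b \<in> insert c C" for b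
      using that insert.prems by (intro carr basis_elt_carrier) auto
    have "(\<lambda>x. if x \<in> insert c C then u x else 0) =
        (\<lambda>x. u c * basis_elt c x + (if x \<in> C then u x else 0))"
      using insert.hyps by (auto simp: basis_elt_def)
    then have "act M (\<lambda>x. if x \<in> insert c C then u x else 0) =
        u c \<cdot>\<^sub>m act M (basis_elt c) + lin_comb (vdim M) C (\<lambda>b. act M (basis_elt b)) u"
      using insert by (simp only: add[OF uc uC] smult[OF c]) simp
    also have "\<dots> = lin_comb (vdim M) (insert c C) (\<lambda>b. act M (basis_elt b)) u"
    proof (rule eq_matI)
      fix r s
      assume "r < dim_row (lin_comb (vdim M) (insert c C) (\<lambda>b. act M (basis_elt b)) u)"
        "s < dim_col (lin_comb (vdim M) (insert c C) (\<lambda>b. act M (basis_elt b)) u)"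
      then have rs: "r < vdim M" "s < vdim M" by simp_all
      have "lin_comb (vdim M) C (\<lambda>b. act M (basis_elt b)) u $$ (r, s) =
          (\<Sum>b\<in>C. u b * act M (basis_elt b) $$ (r, s))"
        by (rule lin_comb_index[OF _ rs]) (use K in blast)
      moreover have "lin_comb (vdim M) (insert c C) (\<lambda>b. act M (basis_elt b)) u $$ (r, s) =
          (\<Sum>b\<in>insert c C. u b * act M (basis_elt b) $$ (r, s))"
        by (rule lin_comb_index[OF K rs])
      ultimately show "(u c \<cdot>\<^sub>m act M (basis_elt c) + lin_comb (vdim M) C (\<lambda>b. act M (basis_elt b)) u) $$ (r, s) =
          lin_comb (vdim M) (insert c C) (\<lambda>b. act M (basis_elt b)) u $$ (r, s)"
        using rs insert.hyps carrier_matD[OF carr[OF c]] by simp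
    qed (use carr[OF c] in auto)
    finally show ?case .
  qed
  from this[OF finite_H_basis order_refl] have
    "act M (\<lambda>x. if x \<in> B then u x else 0) = lin_comb (vdim M) B (\<lambda>b. act M (basis_elt b)) u" .
  moreover have "(\<lambda>x. if x \<in> B then u x else 0) = u" using u by (auto simp: free_space_def)
  ultimately show ?thesis by simp
qed

lemma H_grp_carrier: "h \<in> carrier G \<Longrightarrow> H_grp h \<in> free_space B"
  using order_ge_2 by (auto simp: H_grp_def H_basis_def intro!: basis_elt_carrier)

lemma H_y_carrier: "H_y G \<in> free_space B"
  using order_ge_2 by (auto simp: H_y_def H_basis_def intro!: basis_elt_carrier)

definition satisfies_relations :: "nat \<Rightarrow> 'k mat \<Rightarrow> ('g \<Rightarrow> 'k mat) \<Rightarrow> bool" where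
  "satisfies_relations d Y P \<longleftrightarrow> Y \<in> carrier_mat d d \<and> (\<forall>h\<in>carrier G. P h \<in> carrier_mat d d) \<and>
    Y ^\<^sub>m n = 0\<^sub>m d d \<and> P \<one> = 1\<^sub>m d \<and>
    (\<forall>h\<in>carrier G. \<forall>k\<in>carrier G. P (h \<otimes> k) = P h * P k) \<and>
    (\<forall>h\<in>carrier G. Y * P h = \<chi> h \<cdot>\<^sub>m (P h * Y))"

lemma satisfies_relationsD:
  assumes "satisfies_relations d Y P"
  shows "Y \<in> carrier_mat d d" "\<And>h. h \<in> carrier G \<Longrightarrow> P h \<in> carrier_mat d d"
    "Y ^\<^sub>m n = 0\<^sub>m d d" "P \<one> = 1\<^sub>m d"
    "\<And>h k. h \<in> carrier G \<Longrightarrow> k \<in> carrier G \<Longrightarrow> P (h \<otimes> k) = P h * P k"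
    "\<And>h. h \<in> carrier G \<Longrightarrow> Y * P h = \<chi> h \<cdot>\<^sub>m (P h * Y)"
  using assms by (auto simp: satisfies_relations_def)

lemma left_moduleD:
  assumes "left_module H M"
  shows "\<And>a. a \<in> free_space B \<Longrightarrow> act M a \<in> carrier_mat (vdim M) (vdim M)"
    "\<And>a b. a \<in> free_space B \<Longrightarrow> b \<in> free_space B \<Longrightarrow>
      act M (a \<otimes>\<^bsub>H_algebra G \<chi> n\<^esub> b) = act M a * act M b"
    "\<And>a c. a \<in> free_space B \<Longrightarrow> act M (\<lambda>x. c * a x) = c \<cdot>\<^sub>m act M a"
    "act M (H_grp \<one>) = 1\<^sub>m (vdim M)"
  using assms unfolding left_module_def H_simps by auto

lemma H_mult_carrier:
  assumes "u \<in> free_space B" "v \<in> free_space B"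
  shows "u \<otimes>\<^bsub>H_algebra G \<chi> n\<^esub> v \<in> free_space B"
proof -
  have "u \<otimes>\<^bsub>H_algebra G \<chi> n\<^esub> v = lin_ext B (\<lambda>b. lin_ext B
    ((\<lambda>(i, h) (j, k) x. if i + j < n
        then inverse (\<chi> h) ^ j * basis_elt (i + j, h \<otimes>\<^bsub>G\<^esub> k) x else 0) b) v) u"
    by (simp add: H_algebra_def based_algebra_def)
  then show ?thesis
    by (auto simp: free_space_def lin_ext_def H_basis_def basis_elt_def intro!: sum.neutral)
qed

lemma act_basis_elt:
  assumes M: "left_module H M" and i: "i < n" and h: "h \<in> carrier G"
  shows "act M (basis_elt (i, h)) = act M (H_y G) ^\<^sub>m i * act M (H_grp h)"
proof -
  note D = left_moduleD[OF M]
  have pow: "H_y G [^]\<^bsub>H_algebra G \<chi> n\<^esub> j \<in> free_space B \<and>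
      act M (H_y G [^]\<^bsub>H_algebra G \<chi> n\<^esub> j) = act M (H_y G) ^\<^sub>m j" for j
  proof (induction j)
    case 0
    have "H_y G [^]\<^bsub>H_algebra G \<chi> n\<^esub> (0::nat) = H_grp \<one>"
      by (simp add: nat_pow_def H_algebra_def based_algebra_def H_grp_def)
    then show ?case using H_grp_carrier[of \<one>] D(4) carrier_matD[OF D(1)[OF H_y_carrier]] by simp
  next
    case (Suc j)
    have "H_y G [^]\<^bsub>H_algebra G \<chi> n\<^esub> Suc j =
        H_y G [^]\<^bsub>H_algebra G \<chi> n\<^esub> j \<otimes>\<^bsub>H_algebra G \<chi> n\<^esub> H_y G"
      by (simp add: nat_pow_def)
    then show ?case using Suc H_mult_carrier[OF _ H_y_carrier] D(2)[OF _ H_y_carrier] by simp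
  qed
  show ?thesis
    using pow[of i] D(2)[OF _ H_grp_carrier[OF h]] H_basis_expression[OF i h, symmetric] by simp
qed

lemma left_module_satisfies_relations:
  assumes M: "left_module H M"
  shows "satisfies_relations (vdim M) (act M (H_y G)) (\<lambda>h. act M (H_grp h))"
  unfolding satisfies_relations_def
proof (intro conjI ballI)
  note D = left_moduleD[OF M]
  show Y: "act M (H_y G) \<in> carrier_mat (vdim M) (vdim M)" by (rule D(1)[OF H_y_carrier])
  show P: "act M (H_grp h) \<in> carrier_mat (vdim M) (vdim M)" if "h \<in> carrier G" for h
    by (rule D(1)[OF H_grp_carrier[OF that]])
  show "act M (H_grp \<one>) = 1\<^sub>m (vdim M)" by (rule D(4))
  show "act M (H_grp (h \<otimes> k)) = act M (H_grp h) * act M (H_grp k)"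
    if "h \<in> carrier G" "k \<in> carrier G" for h k
    using D(2)[OF H_grp_carrier[OF that(1)] H_grp_carrier[OF that(2)]] H_grp_mult[OF that] by simp
  show "act M (H_y G) * act M (H_grp h) = \<chi> h \<cdot>\<^sub>m (act M (H_grp h) * act M (H_y G))"
    if h: "h \<in> carrier G" for h
  proof -
    have "act M (H_y G) * act M (H_grp h) = act M (H_y G \<otimes>\<^bsub>H_algebra G \<chi> n\<^esub> H_grp h)"
      using D(2)[OF H_y_carrier H_grp_carrier[OF h]] by simp
    also have "\<dots> = act M (\<lambda>x. \<chi> h * (H_grp h \<otimes>\<^bsub>H_algebra G \<chi> n\<^esub> H_y G) x)"
      unfolding H_commutation[OF h] by (simp add: H_algebra_def based_algebra_def)
    also have "\<dots> = \<chi> h \<cdot>\<^sub>m (act M (H_grp h) * act M (H_y G))"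
      using D(3)[OF H_mult_carrier[OF H_grp_carrier[OF h] H_y_carrier]]
        D(2)[OF H_grp_carrier[OF h] H_y_carrier] by simp
    finally show ?thesis .
  qed
  have n1: "n - 1 < n" using order_ge_2 by simp
  \<comment> \<open>The relation \<open>y\<^sup>n = 0\<close>, read as the product of the basis element \<open>y\<^sup>n\<^sup>-\<^sup>1\<close> with \<open>y\<close>.\<close>
  have "act M (basis_elt (n - 1, \<one>) \<otimes>\<^bsub>H_algebra G \<chi> n\<^esub> H_y G) =
      act M (basis_elt (n - 1, \<one>)) * act M (H_y G)"
    using n1 by (intro D(2) H_y_carrier basis_elt_carrier) (auto simp: H_basis_def)
  also have "act M (basis_elt (n - 1, \<one>)) = act M (H_y G) ^\<^sub>m (n - 1)"
    using act_basis_elt[OF M n1, of \<one>] D(4) Y pow_carrier_mat[OF Y] by simp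
  also have "\<dots> * act M (H_y G) = act M (H_y G) ^\<^sub>m n"
    using order_ge_2 by (cases n) auto
  also have "basis_elt (n - 1, \<one>) \<otimes>\<^bsub>H_algebra G \<chi> n\<^esub> H_y G = (\<lambda>x. 0 * H_y G x)"
    unfolding H_y_def using order_ge_2 by (subst H_mult_basis) (auto simp: H_basis_def)
  also have "act M \<dots> = 0 \<cdot>\<^sub>m act M (H_y G)" by (rule D(3)[OF H_y_carrier])
  also have "\<dots> = 0\<^sub>m (vdim M) (vdim M)" using Y by (intro eq_matI) auto
  finally show "act M (H_y G) ^\<^sub>m n = 0\<^sub>m (vdim M) (vdim M)" by simp
qed

lemma act_generated:
  assumes M: "left_module H M" and u: "u \<in> free_space B"
  shows "act M u = lin_comb (vdim M) B (\<lambda>(i, h). act M (H_y G) ^\<^sub>m i * act M (H_grp h)) u"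
  unfolding act_lin_comb[OF M u]
  by (intro lin_comb_cong) (auto simp: H_basis_def act_basis_elt[OF M])

text \<open>
  Linearity is built in. For products, moving \<open>P h\<close> past \<open>Y\<^sup>j\<close> costs the factor \<open>\<chi>(h)\<^sup>-\<^sup>j\<close> that also
  occurs in the structure constants of \<open>H\<close>, and where these are zero, namely for \<open>i + j \<ge> n\<close>, the
  matrix \<open>Y\<^sup>i\<^sup>+\<^sup>j\<close> is zero as well.
\<close>

lemma left_module_generated_module:
  assumes R: "satisfies_relations d Y P"
  shows "left_module H (generated_module G n d Y P)"
    and act_y_generated_module: "act (generated_module G n d Y P) (H_y G) = Y"
    and act_grp_generated_module: "h \<in> carrier G \<Longrightarrow> act (generated_module G n d Y P) (H_grp h) = P h"
proof -
  note D = satisfies_relationsD[OF R]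
  let ?K = "\<lambda>(i, h). Y ^\<^sub>m i * P h"
  have K: "?K b \<in> carrier_mat d d" if "b \<in> B" for b
    using that D(1,2) by (auto simp: H_basis_def intro!: mult_carrier_mat[OF pow_carrier_mat])
  have be: "lin_comb d B ?K (basis_elt b) = ?K b" if "b \<in> B" for b
    by (rule lin_comb_basis_elt[OF finite_H_basis that K])
  show "act (generated_module G n d Y P) (H_y G) = Y"
    using order_ge_2 be[of "(1, \<one>)"] D by (simp add: generated_module_def H_y_def H_basis_def)
  show gr: "act (generated_module G n d Y P) (H_grp h) = P h" if "h \<in> carrier G" for h
    using that order_ge_2 be[of "(0, h)"] D(1) D(2)[OF that]
    by (simp add: generated_module_def H_grp_def H_basis_def)
  have PY: "P h * Y ^\<^sub>m j = inverse (\<chi> h) ^ j \<cdot>\<^sub>m (Y ^\<^sub>m j * P h)" if h: "h \<in> carrier G" for h j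
  proof (induction j)
    case 0
    show ?case using D(1) D(2)[OF h] by auto
  next
    case (Suc j)
    have Yj: "Y ^\<^sub>m j \<in> carrier_mat d d" using D(1) by simp
    have "inverse (\<chi> h) \<cdot>\<^sub>m (Y * P h) = P h * Y"
      using character_nonzero[OF h] D(6)[OF h] by (simp add: smult_smult_mat) (intro eq_matI, auto)
    then have 1: "P h * Y = inverse (\<chi> h) \<cdot>\<^sub>m (Y * P h)" by simp
    have "P h * Y ^\<^sub>m Suc j = inverse (\<chi> h) ^ j \<cdot>\<^sub>m (Y ^\<^sub>m j * P h) * Y"
      using Suc D(1) D(2)[OF h] Yj by (simp add: assoc_mult_mat[OF D(2)[OF h] Yj D(1), symmetric])
    also have "\<dots> = inverse (\<chi> h) ^ j \<cdot>\<^sub>m (Y ^\<^sub>m j * (P h * Y))"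
      by (simp add: mult_smult_assoc_mat[OF mult_carrier_mat[OF Yj D(2)[OF h]] D(1)]
          assoc_mult_mat[OF Yj D(2)[OF h] D(1)])
    also have "\<dots> = inverse (\<chi> h) ^ Suc j \<cdot>\<^sub>m (Y ^\<^sub>m Suc j * P h)"
      by (simp add: 1 mult_smult_distrib[OF Yj mult_carrier_mat[OF D(1) D(2)[OF h]]]
          smult_smult_mat assoc_mult_mat[OF Yj D(1) D(2)[OF h]] mult.commute)
    finally show ?case .
  qed
  have Yzero: "Y ^\<^sub>m (i + j) = 0\<^sub>m d d" if "\<not> i + j < n" for i j
  proof -
    have "Y ^\<^sub>m (n + k) = 0\<^sub>m d d" for k
      by (induction k) (use D in auto)
    from this[of "i + j - n"] show ?thesis using that by simp
  qed
  have Yadd: "Y ^\<^sub>m i * Y ^\<^sub>m j = Y ^\<^sub>m (i + j)" for i j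
    using D(1) by (induction j) (auto simp: assoc_mult_mat[OF pow_carrier_mat pow_carrier_mat, symmetric])
  have p: "lin_comb d B ?K ((\<lambda>(i, h) (j, k) x. if i + j < n
        then inverse (\<chi> h) ^ j * basis_elt (i + j, h \<otimes>\<^bsub>G\<^esub> k) x else 0) b c) = ?K b * ?K c"
    if bc: "b \<in> B" "c \<in> B" for b c
  proof -
    obtain i h j k where b: "b = (i, h)" "c = (j, k)" by (cases b, cases c) auto
    have hk: "h \<in> carrier G" "k \<in> carrier G" using bc b by (auto simp: H_basis_def)
    have carr: "Y ^\<^sub>m i \<in> carrier_mat d d" "Y ^\<^sub>m j \<in> carrier_mat d d"
      "P h \<in> carrier_mat d d" "P k \<in> carrier_mat d d"
      using D hk by auto
    have Phk: "P (h \<otimes> k) \<in> carrier_mat d d" using D(2) hk by simp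
    have "?K b * ?K c = Y ^\<^sub>m i * (P h * (Y ^\<^sub>m j * P k))"
      using carr by (simp add: b assoc_mult_mat[OF carr(1,3) mult_carrier_mat[OF carr(2,4)]])
    also have "P h * (Y ^\<^sub>m j * P k) = inverse (\<chi> h) ^ j \<cdot>\<^sub>m (Y ^\<^sub>m j * P h) * P k"
      using carr by (simp add: assoc_mult_mat[OF carr(3,2,4), symmetric] PY[OF hk(1)])
    also have "\<dots> = inverse (\<chi> h) ^ j \<cdot>\<^sub>m (Y ^\<^sub>m j * P (h \<otimes> k))"
      by (simp add: mult_smult_assoc_mat[OF mult_carrier_mat[OF carr(2,3)] carr(4)]
          assoc_mult_mat[OF carr(2,3,4)] D(5)[OF hk])
    also have "Y ^\<^sub>m i * \<dots> = inverse (\<chi> h) ^ j \<cdot>\<^sub>m (Y ^\<^sub>m (i + j) * P (h \<otimes> k))"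
      by (simp only: mult_smult_distrib[OF carr(1) mult_carrier_mat[OF carr(2) Phk]]
          assoc_mult_mat[OF carr(1,2) Phk, symmetric] Yadd)
    finally have 1: "?K b * ?K c = inverse (\<chi> h) ^ j \<cdot>\<^sub>m (Y ^\<^sub>m (i + j) * P (h \<otimes> k))" .
    show ?thesis
    proof (cases "i + j < n")
      case True
      then have 2: "(i + j, h \<otimes> k) \<in> B" using hk by (simp add: H_basis_def)
      have "lin_comb d B ?K (\<lambda>x. inverse (\<chi> h) ^ j * basis_elt (i + j, h \<otimes> k) x) =
          inverse (\<chi> h) ^ j \<cdot>\<^sub>m lin_comb d B ?K (basis_elt (i + j, h \<otimes> k))"
        using K by (intro eq_matI) (auto simp: lin_comb_index sum_distrib_left mult.assoc)
      also have "\<dots> = ?K b * ?K c" unfolding be[OF 2] 1 by simp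
      finally show ?thesis using True by (simp add: b)
    next
      case False
      then have "?K b * ?K c = 0\<^sub>m d d"
        unfolding 1 Yzero[OF False] using D(2)[of "h \<otimes> k"] hk by simp
      then show ?thesis using False K by (intro eq_matI) (auto simp: b lin_comb_index)
    qed
  qed
  have mult: "lin_comb d B ?K (u \<otimes>\<^bsub>H_algebra G \<chi> n\<^esub> v) = lin_comb d B ?K u * lin_comb d B ?K v" for u v
    unfolding H_algebra_def by (rule based_mult_lin_comb[OF K p])
  show "left_module H (generated_module G n d Y P)"
    unfolding left_module_def H_simps
  proof (intro conjI ballI allI)
    show "act (generated_module G n d Y P) (H_grp \<one>) = 1\<^sub>m (vdim (generated_module G n d Y P))"
      by (simp add: gr D)
  next
    fix u v :: "nat \<times> 'g \<Rightarrow> 'k" and c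
    show "act (generated_module G n d Y P) (\<lambda>x. u x + v x) =
        act (generated_module G n d Y P) u + act (generated_module G n d Y P) v"
      using K by (intro eq_matI)
        (auto simp: generated_module_def lin_comb_index sum.distrib distrib_right)
    show "act (generated_module G n d Y P) (\<lambda>x. c * u x) = c \<cdot>\<^sub>m act (generated_module G n d Y P) u"
      using K by (intro eq_matI)
        (auto simp: generated_module_def lin_comb_index sum_distrib_left mult.assoc)
    show "act (generated_module G n d Y P) (u \<otimes>\<^bsub>H_algebra G \<chi> n\<^esub> v) =
        act (generated_module G n d Y P) u * act (generated_module G n d Y P) v"
      by (simp add: generated_module_def mult)
  qed (simp add: generated_module_def)
qed

text \<open>
  A matrix that intertwines the generators intertwines the basis elements \<open>y\<^sup>i h\<close> and therefore
  everything.
\<close>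

lemma module_iso_generators:
  assumes M: "left_module H M" and N: "left_module H N" and d: "vdim M = vdim N"
    and Q: "Q \<in> carrier_mat (vdim N) (vdim M)" "invertible_mat Q"
    and y: "Q * act M (H_y G) = act N (H_y G) * Q"
    and h: "\<And>h. h \<in> carrier G \<Longrightarrow> Q * act M (H_grp h) = act N (H_grp h) * Q"
  shows "module_iso H M N"
proof -
  define d where "d = vdim N"
  have dM: "vdim M = d" and dN: "vdim N = d" using d by (simp_all add: d_def)
  have Qc: "Q \<in> carrier_mat d d" using Q(1) dM dN by simp
  note DM = satisfies_relationsD[OF left_module_satisfies_relations[OF M], unfolded dM]
  note DN = satisfies_relationsD[OF left_module_satisfies_relations[OF N], unfolded dN]
  have pow: "Q * act M (H_y G) ^\<^sub>m i = act N (H_y G) ^\<^sub>m i * Q" for i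
  proof (induction i)
    case 0
    then show ?case using DM(1) DN(1) Qc by auto
  next
    case (Suc i)
    let ?Y = "act M (H_y G)" and ?Z = "act N (H_y G)"
    have "Q * ?Y ^\<^sub>m Suc i = Q * ?Y ^\<^sub>m i * ?Y"
      by (simp add: assoc_mult_mat[OF Qc pow_carrier_mat[OF DM(1)] DM(1)])
    also have "\<dots> = ?Z ^\<^sub>m i * (?Z * Q)"
      unfolding Suc.IH y[symmetric] by (rule assoc_mult_mat[OF pow_carrier_mat[OF DN(1)] Qc DM(1)])
    also have "\<dots> = ?Z ^\<^sub>m Suc i * Q"
      by (simp add: assoc_mult_mat[OF pow_carrier_mat[OF DN(1)] DN(1) Qc])
    finally show ?case .
  qed
  have "Q * act M u = act N u * Q" if u: "u \<in> free_space B" for u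
  proof -
    let ?K = "\<lambda>(i, h). act M (H_y G) ^\<^sub>m i * act M (H_grp h)"
    let ?L = "\<lambda>(i, h). act N (H_y G) ^\<^sub>m i * act N (H_grp h)"
    have K: "?K b \<in> carrier_mat d d" and L: "?L b \<in> carrier_mat d d" if "b \<in> B" for b
      using that DM(1,2) DN(1,2) by (auto simp: H_basis_def intro!: mult_carrier_mat[OF pow_carrier_mat])
    have QK: "Q * ?K b = ?L b * Q" if bB: "b \<in> B" for b
    proof -
      obtain i k where b: "b = (i, k)" "k \<in> carrier G" using bB by (cases b) (auto simp: H_basis_def)
      note c = pow_carrier_mat[OF DM(1), of i] pow_carrier_mat[OF DN(1), of i] DM(2)[OF b(2)] DN(2)[OF b(2)]
      show ?thesis
        using assoc_mult_mat[OF Qc c(1,3)] assoc_mult_mat[OF c(2) Qc c(3)] assoc_mult_mat[OF c(2,4) Qc]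
          pow[of i] h[OF b(2)] by (simp add: b)
    qed
    have "Q * act M u = sum_mat d B (\<lambda>b. Q * (u b \<cdot>\<^sub>m ?K b))"
      unfolding act_generated[OF M u] lin_comb_def dM by (rule mult_sum_mat[OF Qc]) (use K in auto)
    also have "\<dots> = sum_mat d B (\<lambda>b. (u b \<cdot>\<^sub>m ?L b) * Q)"
    proof (intro sum_mat_cong refl)
      fix b assume b: "b \<in> B"
      show "Q * (u b \<cdot>\<^sub>m ?K b) = u b \<cdot>\<^sub>m ?L b * Q"
        unfolding mult_smult_distrib[OF Qc K[OF b]] mult_smult_assoc_mat[OF L[OF b] Qc] QK[OF b] ..
    qed
    also have "\<dots> = act N u * Q"
      unfolding act_generated[OF N u] lin_comb_def dN by (rule sum_mat_mult[OF Qc, symmetric]) (use L in auto)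
    finally show ?thesis .
  qed
  then show ?thesis using Q d by (auto simp: module_iso_def H_simps)
qed

end


section \<open>Isomorphisms and direct sums\<close>

lemma kron_one_left [simp]: "kron_mat (1\<^sub>m (Suc 0)) A = (A :: 'k::semiring_1 mat)"
  by (rule eq_matI) (auto simp: kron_index)

lemma kron_one_right [simp]: "kron_mat A (1\<^sub>m (Suc 0)) = (A :: 'k::semiring_1 mat)"
  by (rule eq_matI) (auto simp: kron_index)

lemma invertible_matI:
  fixes P :: "'k::semiring_1 mat"
  assumes "P \<in> carrier_mat d d" "Q \<in> carrier_mat d d" "P * Q = 1\<^sub>m d" "Q * P = 1\<^sub>m d"
  shows "invertible_mat P"
  using assms unfolding invertible_mat_def inverts_mat_def by auto

lemma invertible_matE:
  fixes P :: "'k::semiring_1 mat"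
  assumes "invertible_mat P" "P \<in> carrier_mat d d"
  obtains Q where "Q \<in> carrier_mat d d" "P * Q = 1\<^sub>m d" "Q * P = 1\<^sub>m d"
proof -
  obtain Q where Q: "P * Q = 1\<^sub>m (dim_row P)" "Q * P = 1\<^sub>m (dim_row Q)"
    using assms unfolding invertible_mat_def inverts_mat_def by auto
  have "dim_row Q = d" "dim_col Q = d"
    using arg_cong[OF Q(1), of dim_col] arg_cong[OF Q(2), of dim_col] assms(2) by auto
  then show ?thesis using that[of Q] Q assms(2) by auto
qed

lemma invertible_kron:
  fixes P :: "'k::comm_semiring_1 mat"
  assumes P: "invertible_mat P" "P \<in> carrier_mat d d" and Q: "invertible_mat Q" "Q \<in> carrier_mat e e"
  shows "invertible_mat (kron_mat P Q)"
proof -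
  obtain P' where P': "P' \<in> carrier_mat d d" "P * P' = 1\<^sub>m d" "P' * P = 1\<^sub>m d"
    using invertible_matE[OF P] .
  obtain Q' where Q': "Q' \<in> carrier_mat e e" "Q * Q' = 1\<^sub>m e" "Q' * Q = 1\<^sub>m e"
    using invertible_matE[OF Q] .
  show ?thesis
    by (rule invertible_matI[of _ "d * e" "kron_mat P' Q'"])
      (use P Q P' Q' in \<open>auto simp: kron_mult[OF P(2) P'(1) Q(2) Q'(1)] kron_mult[OF P'(1) P(2) Q'(1) Q(2)] kron_one\<close>)
qed

lemma module_iso_refl:
  fixes A :: "('k::field, 'b) hopf"
  assumes M: "left_module A M"
  shows "module_iso A M M"
proof -
  have "1\<^sub>m (vdim M) * act M a = act M a * 1\<^sub>m (vdim M)" if "a \<in> carrier A" for a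
  proof -
    have "act M a \<in> carrier_mat (vdim M) (vdim M)" using M that by (simp add: left_module_def)
    then show ?thesis by simp
  qed
  moreover have "invertible_mat (1\<^sub>m (vdim M) :: 'k mat)"
    by (rule invertible_matI[of _ "vdim M" "1\<^sub>m (vdim M)"]) auto
  ultimately show ?thesis
    unfolding module_iso_def by (intro conjI bexI[of _ "1\<^sub>m (vdim M)"]) auto
qed

lemma module_iso_sym:
  assumes M: "left_module A M" and N: "left_module A N" and "module_iso A M N"
  shows "module_iso A N M"
proof -
  define d where "d = vdim N"
  obtain P where d: "vdim M = d" and P: "P \<in> carrier_mat d d" "invertible_mat P"
    and eq: "\<And>a. a \<in> carrier A \<Longrightarrow> P * act M a = act N a * P"
    using assms(3) by (auto simp: module_iso_def d_def)
  obtain Q where Q: "Q \<in> carrier_mat d d" "P * Q = 1\<^sub>m d" "Q * P = 1\<^sub>m d"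
    using invertible_matE[OF P(2,1)] .
  have "Q * act N a = act M a * Q" if a: "a \<in> carrier A" for a
  proof -
    have Ma: "act M a \<in> carrier_mat d d" and Na: "act N a \<in> carrier_mat d d"
      using M N a d by (auto simp: left_module_def d_def)
    have "Q * act N a = Q * (act N a * (P * Q))" using Q Na by simp
    also have "\<dots> = Q * (P * act M a * Q)"
      using assoc_mult_mat[OF Na P(1) Q(1)] eq[OF a] by simp
    also have "\<dots> = (Q * P) * act M a * Q"
      by (simp only: assoc_mult_mat[OF Q(1) P(1) Ma]
          assoc_mult_mat[OF Q(1) mult_carrier_mat[OF P(1) Ma] Q(1)])
    finally show ?thesis using Q Ma by simp
  qed
  moreover have "invertible_mat Q" by (rule invertible_matI[OF Q(1) P(1) Q(3,2)])
  ultimately show ?thesis using Q d by (auto simp: module_iso_def d_def)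
qed

lemma module_iso_trans:
  fixes A :: "('k::field, 'b) hopf"
  assumes L: "left_module A L" and M: "left_module A M" and N: "left_module A N"
    and LM: "module_iso A L M" and MN: "module_iso A M N"
  shows "module_iso A L N"
proof -
  define d where "d = vdim N"
  obtain P where dM: "vdim M = d" and P: "P \<in> carrier_mat d d" "invertible_mat P"
    and eqP: "\<And>a. a \<in> carrier A \<Longrightarrow> P * act M a = act N a * P"
    using MN by (auto simp: module_iso_def d_def)
  obtain Q where dL: "vdim L = d" and Q: "Q \<in> carrier_mat d d" "invertible_mat Q"
    and eqQ: "\<And>a. a \<in> carrier A \<Longrightarrow> Q * act L a = act M a * Q"
    using LM dM by (auto simp: module_iso_def d_def)
  obtain P' where P': "P' \<in> carrier_mat d d" "P * P' = 1\<^sub>m d" "P' * P = 1\<^sub>m d"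
    using invertible_matE[OF P(2,1)] .
  obtain Q' where Q': "Q' \<in> carrier_mat d d" "Q * Q' = 1\<^sub>m d" "Q' * Q = 1\<^sub>m d"
    using invertible_matE[OF Q(2,1)] .
  have cancel: "A1 * A2 * (B2 * B1) = 1\<^sub>m d"
    if "A2 * B2 = 1\<^sub>m d" "A1 * B1 = 1\<^sub>m d" "A1 \<in> carrier_mat d d" "A2 \<in> carrier_mat d d"
      "B1 \<in> carrier_mat d d" "B2 \<in> carrier_mat d d" for A1 A2 B1 B2 :: "'k mat"
  proof -
    have "A1 * A2 * (B2 * B1) = A1 * (A2 * B2 * B1)"
      by (simp only: assoc_mult_mat[OF that(3,4) mult_carrier_mat[OF that(6,5)]] assoc_mult_mat[OF that(4,6,5)])
    then show ?thesis using that(1,2) left_mult_one_mat[OF that(5)] by simp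
  qed
  have inv: "invertible_mat (P * Q)"
  proof (rule invertible_matI)
    show "P * Q * (Q' * P') = 1\<^sub>m d" by (rule cancel) (use P Q P' Q' in auto)
    show "Q' * P' * (P * Q) = 1\<^sub>m d" by (rule cancel) (use P Q P' Q' in auto)
  qed (use P Q P' Q' in auto)
  have "P * Q * act L a = act N a * (P * Q)" if a: "a \<in> carrier A" for a
  proof -
    have c: "act L a \<in> carrier_mat d d" "act M a \<in> carrier_mat d d" "act N a \<in> carrier_mat d d"
      using L M N a dL dM by (auto simp: left_module_def d_def)
    show ?thesis
      using assoc_mult_mat[OF P(1) Q(1) c(1)] assoc_mult_mat[OF P(1) c(2) Q(1)]
        assoc_mult_mat[OF c(3) P(1) Q(1)] eqP[OF a] eqQ[OF a] by simp
  qed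
  moreover have "P * Q \<in> carrier_mat d d" using P Q by auto
  ultimately show ?thesis using inv dL unfolding module_iso_def by (auto simp flip: d_def)
qed

lemma vdim_direct_sum [simp]: "vdim (direct_sum M N) = vdim M + vdim N"
  by (simp add: direct_sum_def)

lemma act_direct_sum: "act (direct_sum M N) a = four_block_mat (act M a) (0\<^sub>m (vdim M) (vdim N))
    (0\<^sub>m (vdim N) (vdim M)) (act N a)"
  by (simp add: direct_sum_def)

lemma left_module_direct_sum:
  assumes M: "left_module A M" and N: "left_module A N"
  shows "left_module A (direct_sum M N)"
proof -
  define d e where "d = vdim M" and "e = vdim N"
  have c: "act M a \<in> carrier_mat d d" "act N a \<in> carrier_mat e e" if "a \<in> carrier A" for a
    using M N that by (auto simp: left_module_def d_def e_def)
  let ?F = "\<lambda>X Y. four_block_mat X (0\<^sub>m d e) (0\<^sub>m e d) Y"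
  have F: "act (direct_sum M N) a = ?F (act M a) (act N a)" for a
    by (simp add: act_direct_sum d_def e_def)
  have add: "?F X Y + ?F X' Y' = ?F (X + X') (Y + Y')"
    and mult: "?F X Y * ?F X' Y' = ?F (X * X') (Y * Y')"
    and sm: "s \<cdot>\<^sub>m ?F X Y = ?F (s \<cdot>\<^sub>m X) (s \<cdot>\<^sub>m Y)"
    if "X \<in> carrier_mat d d" "X' \<in> carrier_mat d d" "Y \<in> carrier_mat e e" "Y' \<in> carrier_mat e e"
    for X Y X' Y' s
  proof -
    show "?F X Y + ?F X' Y' = ?F (X + X') (Y + Y')" and "s \<cdot>\<^sub>m ?F X Y = ?F (s \<cdot>\<^sub>m X) (s \<cdot>\<^sub>m Y)"
      using that by (auto intro!: eq_matI)
    show "?F X Y * ?F X' Y' = ?F (X * X') (Y * Y')"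
    proof -
      have "?F X Y * ?F X' Y' = four_block_mat (X * X' + 0\<^sub>m d e * 0\<^sub>m e d) (X * 0\<^sub>m d e + 0\<^sub>m d e * Y')
          (0\<^sub>m e d * X' + Y * 0\<^sub>m e d) (0\<^sub>m e d * 0\<^sub>m d e + Y * Y')"
        by (rule mult_four_block_mat) (use that in auto)
      also have "\<dots> = ?F (X * X') (Y * Y')"
        using that by (intro cong_four_block_mat)
          (auto simp: left_add_zero_mat[OF mult_carrier_mat] right_add_zero_mat[OF mult_carrier_mat])
      finally show ?thesis .
    qed
  qed
  show ?thesis
    unfolding left_module_def F
    using M N unfolding left_module_def
    by (auto simp: add[OF c(1) c(1) c(2) c(2)] mult[OF c(1) c(1) c(2) c(2)] sm[OF c(1) c(1) c(2) c(2)]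
        c d_def[symmetric] e_def[symmetric])
qed

text \<open>
  In a tensor product the index of the left factor is the leading digit, so a block decomposition
  of the left factor is one of the product.
\<close>

lemma kron_four_block_left:
  fixes X :: "'k::semiring_0 mat"
  assumes "X \<in> carrier_mat a a" "Y \<in> carrier_mat b b" "Z \<in> carrier_mat c c"
  shows "kron_mat (four_block_mat X (0\<^sub>m a b) (0\<^sub>m b a) Y) Z =
    four_block_mat (kron_mat X Z) (0\<^sub>m (a * c) (b * c)) (0\<^sub>m (b * c) (a * c)) (kron_mat Y Z)"
proof (rule eq_matI)
  fix r s
  assume "r < dim_row (four_block_mat (kron_mat X Z) (0\<^sub>m (a * c) (b * c)) (0\<^sub>m (b * c) (a * c)) (kron_mat Y Z))"
    "s < dim_col (four_block_mat (kron_mat X Z) (0\<^sub>m (a * c) (b * c)) (0\<^sub>m (b * c) (a * c)) (kron_mat Y Z))"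
  then have rs: "r < (a + b) * c" "s < (a + b) * c" using assms by (auto simp: distrib_right)
  have "0 < c" using rs by (cases c) auto
  have lt: "x div c < a \<longleftrightarrow> x < a * c" for x
    by (rule div_less_iff_less_mult[OF \<open>0 < c\<close>])
  have split: "\<exists>t<b * c. x = a * c + t" if "\<not> x < a * c" "x < (a + b) * c" for x
    using that by (intro exI[of _ "x - a * c"]) (auto simp: distrib_right)
  have dims: "dim_row X = a" "dim_col X = a" "dim_row Y = b" "dim_col Y = b" "dim_row Z = c" "dim_col Z = c"
    using assms by auto
  have k: "kron_mat (four_block_mat X (0\<^sub>m a b) (0\<^sub>m b a) Y) Z $$ (r, s) =
      four_block_mat X (0\<^sub>m a b) (0\<^sub>m b a) Y $$ (r div c, s div c) * Z $$ (r mod c, s mod c)"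
    using rs dims by (simp add: kron_index)
  have b: "r div c < a + b" "s div c < a + b" using rs div_mod_bounds by blast+
  consider (1) "r < a * c" "s < a * c" | (2) t where "r < a * c" "t < b * c" "s = a * c + t"
    | (3) t where "t < b * c" "r = a * c + t" "s < a * c"
    | (4) t u where "t < b * c" "r = a * c + t" "u < b * c" "s = a * c + u"
    using split[OF _ rs(1)] split[OF _ rs(2)] by blast
  then show "kron_mat (four_block_mat X (0\<^sub>m a b) (0\<^sub>m b a) Y) Z $$ (r, s) =
    four_block_mat (kron_mat X Z) (0\<^sub>m (a * c) (b * c)) (0\<^sub>m (b * c) (a * c)) (kron_mat Y Z) $$ (r, s)"
  proof cases
    case 1
    then show ?thesis unfolding k using lt[of r] lt[of s] dims by (simp add: kron_index)
  next
    case 2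
    then show ?thesis unfolding k using lt[of r] dims \<open>0 < c\<close> div_mod_bounds(1)[OF 2(2)]
      by (simp add: kron_index)
  next
    case 3
    then show ?thesis unfolding k using lt[of s] dims \<open>0 < c\<close> div_mod_bounds(1)[OF 3(1)]
      by (simp add: kron_index)
  next
    case 4
    then show ?thesis unfolding k using dims \<open>0 < c\<close> div_mod_bounds(1)[OF 4(1)] div_mod_bounds(1)[OF 4(3)]
      by (simp add: kron_index)
  qed
qed (use assms in \<open>auto simp: distrib_right\<close>)

definition perm_matrix :: "nat \<Rightarrow> (nat \<Rightarrow> nat) \<Rightarrow> 'k::semiring_1 mat" where
  "perm_matrix d f = mat d d (\<lambda>(i, j). if i = f j then 1 else 0)"

lemma perm_matrix_carrier [simp]: "perm_matrix d f \<in> carrier_mat d d"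
  by (simp add: perm_matrix_def)

lemma perm_matrix_mult:
  fixes X :: "'k::comm_semiring_1 mat"
  assumes "X \<in> carrier_mat d d" "inj_on f {..<d}" "f ` {..<d} \<subseteq> {..<d}" "i < d" "j < d"
  shows "(perm_matrix d f * X) $$ (f i, j) = X $$ (i, j)"
    and "(X * perm_matrix d f) $$ (i, j) = X $$ (i, f j)"
proof -
  have fi: "f i < d" and fj: "f j < d" using assms by auto
  have "(perm_matrix d f * X) $$ (f i, j) = (\<Sum>x<d. (if f i = f x then 1 else 0) * X $$ (x, j))"
    unfolding mult_mat_index[OF perm_matrix_carrier assms(1) fi assms(5)]
    using fi by (intro sum.cong refl) (auto simp: perm_matrix_def)
  also have "\<dots> = (\<Sum>x<d. if x = i then X $$ (x, j) else 0)"
    using assms by (intro sum.cong refl) (auto dest: inj_onD)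
  finally show "(perm_matrix d f * X) $$ (f i, j) = X $$ (i, j)" using assms by simp
  have "(X * perm_matrix d f) $$ (i, j) = (\<Sum>x<d. X $$ (i, x) * (if x = f j then 1 else 0))"
    unfolding mult_mat_index[OF assms(1) perm_matrix_carrier assms(4,5)]
    using assms by (intro sum.cong refl) (auto simp: perm_matrix_def)
  also have "\<dots> = X $$ (i, f j)" using fj by (simp add: if_distrib[of "\<lambda>x. _ * x"] cong: if_cong)
  finally show "(X * perm_matrix d f) $$ (i, j) = X $$ (i, f j)" .
qed

text \<open>
  A permutation of the basis that carries the entries of \<open>X\<close> to those of \<open>Z\<close> is an isomorphism
  between the two.
\<close>

lemma perm_matrix_intertwines:
  fixes X :: "'k::comm_semiring_1 mat"
  assumes X: "X \<in> carrier_mat d d" and Z: "Z \<in> carrier_mat d d"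
    and f: "inj_on f {..<d}" "f ` {..<d} \<subseteq> {..<d}"
    and eq: "\<And>i j. i < d \<Longrightarrow> j < d \<Longrightarrow> X $$ (i, j) = Z $$ (f i, f j)"
  shows "perm_matrix d f * X = Z * perm_matrix d f"
proof (rule eq_matI)
  fix i j assume "i < dim_row (Z * perm_matrix d f)" "j < dim_col (Z * perm_matrix d f)"
  then have ij: "i < d" "j < d" using Z by (auto simp: perm_matrix_def)
  obtain i' where i': "i' < d" "i = f i'"
    using endo_inj_surj[of "{..<d}" f] f ij by auto
  show "(perm_matrix d f * X) $$ (i, j) = (Z * perm_matrix d f) $$ (i, j)"
    unfolding perm_matrix_mult(2)[OF Z f ij] unfolding i'(2) perm_matrix_mult(1)[OF X f i'(1) ij(2)]
    by (rule eq[OF i'(1) ij(2)])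
qed (use X Z in \<open>auto simp: perm_matrix_def\<close>)

lemma invertible_perm_matrix:
  assumes f: "inj_on f {..<d}" "f ` {..<d} \<subseteq> {..<d}"
  shows "invertible_mat (perm_matrix d f :: 'k::comm_semiring_1 mat)"
proof -
  define h where "h = the_inv_into {..<d} f"
  have fd: "f ` {..<d} = {..<d}" using endo_inj_surj[of "{..<d}" f] f by auto
  have fh: "f (h i) = i" "h i < d" if "i < d" for i
    using f_the_inv_into_f[OF f(1)] the_inv_into_into[OF f(1), of i "{..<d}"] fd that
    by (auto simp: h_def)
  have hf: "h (f i) = i" "f i < d" if "i < d" for i
    using the_inv_into_f_f[OF f(1)] fd that by (auto simp: h_def)
  have h: "inj_on h {..<d}" "h ` {..<d} \<subseteq> {..<d}"
    using fh by (auto intro: inj_on_inverseI[of _ f])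
  show ?thesis
  proof (rule invertible_matI[of _ d "perm_matrix d h"])
    show "perm_matrix d f * perm_matrix d h = (1\<^sub>m d :: 'k mat)"
    proof (rule eq_matI)
      fix i j assume "i < dim_row (1\<^sub>m d :: 'k mat)" "j < dim_col (1\<^sub>m d :: 'k mat)"
      then have ij: "i < d" "j < d" by auto
      show "(perm_matrix d f * perm_matrix d h) $$ (i, j) = (1\<^sub>m d :: 'k mat) $$ (i, j)"
        unfolding perm_matrix_mult(2)[OF perm_matrix_carrier h ij]
        using ij fh by (auto simp: perm_matrix_def)
    qed (auto simp: perm_matrix_def)
    show "perm_matrix d h * perm_matrix d f = (1\<^sub>m d :: 'k mat)"
    proof (rule eq_matI)
      fix i j assume "i < dim_row (1\<^sub>m d :: 'k mat)" "j < dim_col (1\<^sub>m d :: 'k mat)"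
      then have ij: "i < d" "j < d" by auto
      show "(perm_matrix d h * perm_matrix d f) $$ (i, j) = (1\<^sub>m d :: 'k mat) $$ (i, j)"
        unfolding perm_matrix_mult(2)[OF perm_matrix_carrier f ij]
        using ij hf by (auto simp: perm_matrix_def)
    qed (auto simp: perm_matrix_def)
  qed auto
qed

text \<open>
  The permutation of the basis that identifies \<open>K\<^sup>a \<otimes> (K\<^sup>b \<oplus> K\<^sup>c)\<close> with
  \<open>(K\<^sup>a \<otimes> K\<^sup>b) \<oplus> (K\<^sup>a \<otimes> K\<^sup>c)\<close>. The vector with index \<open>x (b + c) + s\<close> belongs to the first summand
  if \<open>s < b\<close> and to the second one, which comes after \<open>a b\<close> vectors, otherwise.
\<close>

definition distrib_index :: "nat \<Rightarrow> nat \<Rightarrow> nat \<Rightarrow> nat \<Rightarrow> nat" where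
  "distrib_index a b c r = (let x = r div (b + c); s = r mod (b + c) in
    if s < b then x * b + s else a * b + (x * c + (s - b)))"

lemma pair_index_bound: "x < a \<Longrightarrow> s < b \<Longrightarrow> x * b + s < a * (b::nat)"
proof -
  assume "x < a" "s < b"
  then have "x * b + s < Suc x * b" by simp
  also have "\<dots> \<le> a * b" using \<open>x < a\<close> by (intro mult_right_mono) auto
  finally show ?thesis .
qed

lemma distrib_index:
  assumes "r < a * (b + c)"
  obtains (left) x s where "r = x * (b + c) + s" "x < a" "s < b" "r div (b + c) = x" "r mod (b + c) = s"
      "distrib_index a b c r = x * b + s" "x * b + s < a * b"
  | (right) x s where "r = x * (b + c) + (b + s)" "x < a" "s < c" "r div (b + c) = x" "r mod (b + c) = b + s"
      "distrib_index a b c r = a * b + (x * c + s)" "x * c + s < a * c"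
proof (cases "r mod (b + c) < b")
  case True
  show ?thesis
  proof (rule left[of "r div (b + c)" "r mod (b + c)"])
    show "r = r div (b + c) * (b + c) + r mod (b + c)" by (simp only: div_mult_mod_eq)
    show "distrib_index a b c r = r div (b + c) * b + r mod (b + c)"
      using True by (simp add: distrib_index_def)
    show "r div (b + c) * b + r mod (b + c) < a * b"
      by (rule pair_index_bound[OF div_mod_bounds(1)[OF assms] True])
  qed (rule div_mod_bounds(1)[OF assms] True refl)+
next
  case False
  then have s: "r mod (b + c) - b < c" "b + (r mod (b + c) - b) = r mod (b + c)"
    using div_mod_bounds[OF assms] by auto
  show ?thesis
  proof (rule right[of "r div (b + c)" "r mod (b + c) - b"])
    show "r = r div (b + c) * (b + c) + (b + (r mod (b + c) - b))" by (simp only: s div_mult_mod_eq)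
    show "distrib_index a b c r = a * b + (r div (b + c) * c + (r mod (b + c) - b))"
      using False by (simp add: distrib_index_def)
    show "r div (b + c) * c + (r mod (b + c) - b) < a * c"
      by (rule pair_index_bound[OF div_mod_bounds(1)[OF assms] s(1)])
  qed (rule div_mod_bounds(1)[OF assms] s refl s(2)[symmetric])+
qed

lemma distrib_index_inj:
  "inj_on (distrib_index a b c) {..<a * (b + c)}"
  "distrib_index a b c ` {..<a * (b + c)} \<subseteq> {..<a * (b + c)}"
proof -
  have eq: "x = x' \<and> s = s'" if "x * d + s = x' * d + s'" "s < d" "s' < d" for x s x' s' d :: nat
    using arg_cong[OF that(1), of "\<lambda>r. r div d"] arg_cong[OF that(1), of "\<lambda>r. r mod d"] that(2,3)
    by auto
  show "inj_on (distrib_index a b c) {..<a * (b + c)}"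
  proof (rule inj_onI)
    fix r r' assume rr: "r \<in> {..<a * (b + c)}" "r' \<in> {..<a * (b + c)}"
      and e: "distrib_index a b c r = distrib_index a b c r'"
    from rr(1) have "r < a * (b + c)" by simp
    then show "r = r'"
    proof (cases rule: distrib_index)
      case r: (left x s)
      from rr(2) have "r' < a * (b + c)" by simp
      then show ?thesis
      proof (cases rule: distrib_index)
        case r': (left x' s')
        have "x * b + s = x' * b + s'" using e r'(6) r(6) by simp
        then have "x = x' \<and> s = s'" by (intro eq[OF _ r(3) r'(3)]) simp
        then show ?thesis using r(1) r'(1) by simp
      next
        case r': (right x' s')
        then show ?thesis using e r(6,7) by simp
      qed
    next
      case r: (right x s)
      from rr(2) have "r' < a * (b + c)" by simp
      then show ?thesis
      proof (cases rule: distrib_index)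
        case r': (right x' s')
        have "a * b + (x * c + s) = a * b + (x' * c + s')" using e r'(6) r(6) by simp
        then have "x = x' \<and> s = s'" by (intro eq[OF _ r(3) r'(3)]) simp
        then show ?thesis using r(1) r'(1) by simp
      next
        case r': (left x' s')
        then show ?thesis using e r(6,7) by simp
      qed
    qed
  qed
  show "distrib_index a b c ` {..<a * (b + c)} \<subseteq> {..<a * (b + c)}"
  proof
    fix y assume "y \<in> distrib_index a b c ` {..<a * (b + c)}"
    then obtain r where r: "r < a * (b + c)" "y = distrib_index a b c r" by auto
    from r(1) show "y \<in> {..<a * (b + c)}"
      by (cases rule: distrib_index) (use r in \<open>auto simp: distrib_left\<close>)
  qed
qed

lemma kron_four_block_right:
  fixes X :: "'k::comm_semiring_1 mat"
  assumes X: "X \<in> carrier_mat a a" and Y: "Y \<in> carrier_mat b b" and Z: "Z \<in> carrier_mat c c"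
  shows "perm_matrix (a * (b + c)) (distrib_index a b c) *
      kron_mat X (four_block_mat Y (0\<^sub>m b c) (0\<^sub>m c b) Z) =
    four_block_mat (kron_mat X Y) (0\<^sub>m (a * b) (a * c)) (0\<^sub>m (a * c) (a * b)) (kron_mat X Z) *
      perm_matrix (a * (b + c)) (distrib_index a b c)"
proof (rule perm_matrix_intertwines[OF _ _ distrib_index_inj])
  show "kron_mat X (four_block_mat Y (0\<^sub>m b c) (0\<^sub>m c b) Z) \<in> carrier_mat (a * (b + c)) (a * (b + c))"
    using assms by auto
  show "four_block_mat (kron_mat X Y) (0\<^sub>m (a * b) (a * c)) (0\<^sub>m (a * c) (a * b)) (kron_mat X Z)
      \<in> carrier_mat (a * (b + c)) (a * (b + c))"
    using assms by (auto simp: distrib_left)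
  fix i j assume ij: "i < a * (b + c)" "j < a * (b + c)"
  have dm: "(x * d + s) div d = x" "(x * d + s) mod d = s" if "s < d" for x s d :: nat
    using that by auto
  have dims: "dim_row X = a" "dim_col X = a" "dim_row Y = b" "dim_col Y = b" "dim_row Z = c" "dim_col Z = c"
    using assms by auto
  have k: "kron_mat X (four_block_mat Y (0\<^sub>m b c) (0\<^sub>m c b) Z) $$ (i, j) =
      X $$ (i div (b + c), j div (b + c)) *
      four_block_mat Y (0\<^sub>m b c) (0\<^sub>m c b) Z $$ (i mod (b + c), j mod (b + c))"
    using ij dims by (simp add: kron_index)
  show "kron_mat X (four_block_mat Y (0\<^sub>m b c) (0\<^sub>m c b) Z) $$ (i, j) =
    four_block_mat (kron_mat X Y) (0\<^sub>m (a * b) (a * c)) (0\<^sub>m (a * c) (a * b)) (kron_mat X Z) $$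
      (distrib_index a b c i, distrib_index a b c j)"
    using ij(1)
  proof (cases rule: distrib_index)
    case i: (left x s)
    show ?thesis using ij(2)
    proof (cases rule: distrib_index)
      case j: (left x' s')
      show ?thesis unfolding k i(4-6) j(4-6)
        using i(2,3,7) j(2,3,7) by (simp add: dims kron_index dm)
    next
      case j: (right x' s')
      show ?thesis unfolding k i(4-6) j(4-6)
        using i(2,3,7) j(2,3,7) by (simp add: dims kron_index dm)
    qed
  next
    case i: (right x s)
    show ?thesis using ij(2)
    proof (cases rule: distrib_index)
      case j: (left x' s')
      show ?thesis unfolding k i(4-6) j(4-6)
        using i(2,3,7) j(2,3,7) by (simp add: dims kron_index dm)
    next
      case j: (right x' s')
      show ?thesis unfolding k i(4-6) j(4-6)
        using i(2,3,7) j(2,3,7) by (simp add: dims kron_index dm)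
    qed
  qed
qed


section \<open>Tensor products\<close>

context nilpotent_group_datum
begin

abbreviation y_mat :: "(nat \<times> 'g, 'k) fd_module \<Rightarrow> 'k mat" where "y_mat M \<equiv> act M (H_y G)"
abbreviation grp_mat :: "(nat \<times> 'g, 'k) fd_module \<Rightarrow> 'g \<Rightarrow> 'k mat" where
  "grp_mat M h \<equiv> act M (H_grp h)"

lemmas module_relations = satisfies_relationsD[OF left_module_satisfies_relations]

text \<open>
  The actions of \<open>\<Delta>(y) = y \<otimes> g + 1 \<otimes> y\<close> and of \<open>\<Delta>(h) = h \<otimes> h\<close>.
\<close>

definition tensor_y :: "(nat \<times> 'g, 'k) fd_module \<Rightarrow> (nat \<times> 'g, 'k) fd_module \<Rightarrow> 'k mat" where
  "tensor_y M N = kron_mat (y_mat M) (grp_mat N g) + kron_mat (1\<^sub>m (vdim M)) (y_mat N)"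

definition tensor_grp :: "(nat \<times> 'g, 'k) fd_module \<Rightarrow> (nat \<times> 'g, 'k) fd_module \<Rightarrow> 'g \<Rightarrow> 'k mat" where
  "tensor_grp M N h = kron_mat (grp_mat M h) (grp_mat N h)"

text \<open>
  The summands \<open>A = y \<otimes> g\<close> and \<open>B = 1 \<otimes> y\<close> satisfy \<open>B A = q A B\<close> because \<open>y g = q g y\<close>, which is the
  hypothesis of the quantum binomial formula. The commutation with \<open>h \<otimes> h\<close> holds for each summand
  separately; for the first it uses that \<open>g\<close> is central.
\<close>

lemma tensor_satisfies_relations:
  assumes M: "left_module H M" and N: "left_module H N"
  shows "satisfies_relations (vdim M * vdim N) (tensor_y M N) (tensor_grp M N)"
proof -
  note DM = module_relations[OF M] and DN = module_relations[OF N]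
  let ?d = "vdim M" and ?e = "vdim N"
  let ?A = "kron_mat (y_mat M) (grp_mat N g)" and ?B = "kron_mat (1\<^sub>m ?d) (y_mat N)"
  note gN = DN(2)[OF g_closed] and one = one_carrier_mat[of ?d]
  have A: "?A \<in> carrier_mat (?d * ?e) (?d * ?e)" and B: "?B \<in> carrier_mat (?d * ?e) (?d * ?e)"
    using DM(1) DN(1) gN by auto
  have P: "tensor_grp M N h \<in> carrier_mat (?d * ?e) (?d * ?e)" if "h \<in> carrier G" for h
    using DM(2)[OF that] DN(2)[OF that] by (auto simp: tensor_grp_def)
  have BA: "?B * ?A = \<chi> g \<cdot>\<^sub>m (?A * ?B)"
    by (simp only: kron_mult[OF one DM(1) DN(1) gN] kron_mult[OF DM(1) one gN DN(1)]
        left_mult_one_mat[OF DM(1)] right_mult_one_mat[OF DM(1)] DN(6)[OF g_closed] kron_smult_right)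
  have nil: "(?A + ?B) ^\<^sub>m n = 0\<^sub>m (?d * ?e) (?d * ?e)"
  proof (rule q_commuting_nilpotent[OF A B BA order_power order_minimal])
    show "?A ^\<^sub>m n = 0\<^sub>m (?d * ?e) (?d * ?e)"
      by (simp only: kron_pow[OF DM(1) gN] DM(3) kron_zero_left[OF pow_carrier_mat[OF gN]])
    show "?B ^\<^sub>m n = 0\<^sub>m (?d * ?e) (?d * ?e)"
      by (simp only: kron_pow[OF one DN(1)] DN(3) kron_zero_right[OF pow_carrier_mat[OF one]])
  qed (use order_ge_2 in auto)
  have comm: "tensor_y M N * tensor_grp M N h = \<chi> h \<cdot>\<^sub>m (tensor_grp M N h * tensor_y M N)"
    if h: "h \<in> carrier G" for h
  proof -
    note Mh = DM(2)[OF h] and Nh = DN(2)[OF h]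
    have gh: "grp_mat N g * grp_mat N h = grp_mat N h * grp_mat N g"
      using DN(5)[OF g_closed h] DN(5)[OF h g_closed] g_central[OF h] by simp
    have "?A * tensor_grp M N h = \<chi> h \<cdot>\<^sub>m (tensor_grp M N h * ?A)"
      by (simp only: tensor_grp_def kron_mult[OF DM(1) Mh gN Nh] kron_mult[OF Mh DM(1) Nh gN]
          DM(6)[OF h] gh kron_smult_left)
    moreover have "?B * tensor_grp M N h = \<chi> h \<cdot>\<^sub>m (tensor_grp M N h * ?B)"
      by (simp only: tensor_grp_def kron_mult[OF one Mh DN(1) Nh] kron_mult[OF Mh one Nh DN(1)]
          DN(6)[OF h] left_mult_one_mat[OF Mh] right_mult_one_mat[OF Mh] kron_smult_right)
    ultimately show ?thesis
      unfolding tensor_y_def add_mult_distrib_mat[OF A B P[OF h]] mult_add_distrib_mat[OF P[OF h] A B]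
      by (simp add: add_smult_distrib_left_mat[OF mult_carrier_mat[OF P[OF h] A] mult_carrier_mat[OF P[OF h] B]])
  qed
  have mult: "tensor_grp M N (h \<otimes> k) = tensor_grp M N h * tensor_grp M N k"
    if h: "h \<in> carrier G" and k: "k \<in> carrier G" for h k
    by (simp only: tensor_grp_def DM(5)[OF h k] DN(5)[OF h k]
        kron_mult[OF DM(2)[OF h] DM(2)[OF k] DN(2)[OF h] DN(2)[OF k]])
  have "tensor_grp M N \<one> = 1\<^sub>m (?d * ?e)" by (simp only: tensor_grp_def DM(4) DN(4) kron_one)
  moreover have "tensor_y M N \<in> carrier_mat (?d * ?e) (?d * ?e)" using A B by (simp add: tensor_y_def)
  moreover have "tensor_y M N ^\<^sub>m n = 0\<^sub>m (?d * ?e) (?d * ?e)" using nil by (simp only: tensor_y_def)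
  ultimately show ?thesis
    unfolding satisfies_relations_def using P comm mult by blast
qed

text \<open>
  The comultiplication of \<open>y\<^sup>i h\<close> is the product \<open>\<Delta>(y)\<^sup>i (h \<otimes> h)\<close>, formed in the tensor square. That
  algebra acts on the tensor product of the two spaces compatibly with multiplication, so the
  product acts by the \<open>i\<close>-th power of the matrix of \<open>\<Delta>(y)\<close> times the matrix of \<open>h \<otimes> h\<close>.
\<close>

lemma tensor_module_generated:
  assumes M: "left_module H M" and N: "left_module H N"
  shows "tensor_module H M N = generated_module G n (vdim M * vdim N) (tensor_y M N) (tensor_grp M N)"
proof -
  let ?d = "vdim M" and ?e = "vdim N" and ?T = "tensor_square B (H_algebra G \<chi> n)"
  let ?DY = "elt_tensor (H_y G) (H_grp g) \<oplus>\<^bsub>?T\<^esub> elt_tensor \<one>\<^bsub>H_algebra G \<chi> n\<^esub> (H_y G)"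
  let ?Delta = "\<lambda>(i, h). ?DY [^]\<^bsub>?T\<^esub> i \<otimes>\<^bsub>?T\<^esub> elt_tensor (H_grp h) (H_grp h)"
  define K where "K = (\<lambda>(b, c). kron_mat (act M (basis_elt b)) (act N (basis_elt c)))"
  let ?act = "lin_comb (?d * ?e) (B \<times> B) K"
  note DM = module_relations[OF M] and DN = module_relations[OF N]
  have basM: "act M (basis_elt b) \<in> carrier_mat ?d ?d" and basN: "act N (basis_elt b) \<in> carrier_mat ?e ?e"
    if "b \<in> B" for b
    by (rule left_moduleD(1)[OF M basis_elt_carrier[OF that]])
      (rule left_moduleD(1)[OF N basis_elt_carrier[OF that]])
  have K: "K p \<in> carrier_mat (?d * ?e) (?d * ?e)" if "p \<in> B \<times> B" for p
    using that basM basN by (auto simp: K_def)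
  have tens: "?act (elt_tensor u v) = kron_mat (act M u) (act N v)"
    if "u \<in> free_space B" "v \<in> free_space B" for u v
    unfolding K_def by (subst kron_lin_comb[OF basM basN])
      (simp_all add: act_lin_comb[OF M that(1)] act_lin_comb[OF N that(2)])
  have mult: "?act (u \<otimes>\<^bsub>?T\<^esub> v) = ?act u * ?act v" for u v
    unfolding tensor_square_def
  proof (rule based_mult_lin_comb[OF K])
    fix p p' assume p: "p \<in> B \<times> B" "p' \<in> B \<times> B"
    obtain b c b' c' where bc: "p = (b, c)" "p' = (b', c')" "b \<in> B" "c \<in> B" "b' \<in> B" "c' \<in> B"
      using p by auto
    note be = basis_elt_carrier[OF bc(3)] basis_elt_carrier[OF bc(4)]
      basis_elt_carrier[OF bc(5)] basis_elt_carrier[OF bc(6)]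
    have "?act (elt_tensor (basis_elt b \<otimes>\<^bsub>H_algebra G \<chi> n\<^esub> basis_elt b')
        (basis_elt c \<otimes>\<^bsub>H_algebra G \<chi> n\<^esub> basis_elt c')) = K p * K p'"
      unfolding tens[OF H_mult_carrier[OF be(1,3)] H_mult_carrier[OF be(2,4)]]
        left_moduleD(2)[OF M be(1,3)] left_moduleD(2)[OF N be(2,4)]
      by (simp add: bc K_def kron_mult[OF basM[OF bc(3)] basM[OF bc(5)] basN[OF bc(4)] basN[OF bc(6)]])
    then show "?act ((\<lambda>(b, c) (b', c'). elt_tensor (basis_elt b \<otimes>\<^bsub>H_algebra G \<chi> n\<^esub> basis_elt b')
        (basis_elt c \<otimes>\<^bsub>H_algebra G \<chi> n\<^esub> basis_elt c')) p p') = K p * K p'"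
      by (simp add: bc)
  qed
  have one: "\<one>\<^bsub>H_algebra G \<chi> n\<^esub> = H_grp \<one>" by (simp add: H_algebra_def based_algebra_def H_grp_def)
  have "?DY = (\<lambda>x. elt_tensor (H_y G) (H_grp g) x + elt_tensor (H_grp \<one>) (H_y G) x)"
    unfolding one by (simp add: tensor_square_def based_algebra_def)
  moreover have "?act (\<lambda>x. u x + v x) = ?act u + ?act v" for u v
    by (intro eq_matI) (simp_all add: lin_comb_index[OF K] sum.distrib distrib_right)
  ultimately have y: "?act ?DY = tensor_y M N"
    using DM(4) by (simp only: tens H_y_carrier H_grp_carrier[OF one_closed] H_grp_carrier[OF g_closed] tensor_y_def)
  have pow: "?act (?DY [^]\<^bsub>?T\<^esub> i) = tensor_y M N ^\<^sub>m i" for i :: nat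
  proof (induction i)
    case 0
    have "?DY [^]\<^bsub>?T\<^esub> (0::nat) = elt_tensor (H_grp \<one>) (H_grp \<one>)"
      by (simp add: nat_pow_def) (simp add: tensor_square_def based_algebra_def one[unfolded based_algebra_def])
    then have "?act (?DY [^]\<^bsub>?T\<^esub> (0::nat)) = 1\<^sub>m (?d * ?e)"
      by (simp only: tens[OF H_grp_carrier[OF one_closed] H_grp_carrier[OF one_closed]] DM(4) DN(4) kron_one)
    moreover have "tensor_y M N ^\<^sub>m 0 = 1\<^sub>m (?d * ?e)"
      using DM(1) DN(1) by (simp add: tensor_y_def)
    ultimately show ?case by (simp only:)
  next
    case (Suc i)
    have "?DY [^]\<^bsub>?T\<^esub> Suc i = ?DY [^]\<^bsub>?T\<^esub> i \<otimes>\<^bsub>?T\<^esub> ?DY" by (simp add: nat_pow_def)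
    then show ?case by (simp add: mult Suc y)
  qed
  have cm: "comult H = lin_ext B ?Delta"
    by (simp add: H_hopf_def Let_def based_hopf_def module.defs hopf.defs)
  have "act (tensor_module H M N) = (\<lambda>a. ?act (comult H a))"
    by (auto simp: tensor_module_def H_simps lin_comb_def K_def fun_eq_iff intro!: sum_mat_cong)
  also have "\<dots> = lin_comb (?d * ?e) B (\<lambda>b. ?act (?Delta b))"
    unfolding cm by (simp only: lin_comb_lin_ext[OF K])
  also have "\<dots> = lin_comb (?d * ?e) B (\<lambda>(i, h). tensor_y M N ^\<^sub>m i * tensor_grp M N h)"
  proof (intro ext lin_comb_cong refl)
    fix b assume "b \<in> B"
    then obtain i h where b: "b = (i, h)" and h: "h \<in> carrier G"
      by (cases b) (auto simp: H_basis_def)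
    show "?act (?Delta b) = (case b of (i, h) \<Rightarrow> tensor_y M N ^\<^sub>m i * tensor_grp M N h)"
      by (simp only: b prod.case mult pow tens[OF H_grp_carrier[OF h] H_grp_carrier[OF h]] tensor_grp_def)
  qed
  finally show ?thesis by (simp add: generated_module_def tensor_module_def)
qed

lemma left_module_tensor:
  assumes "left_module H M" "left_module H N"
  shows "left_module H (tensor_module H M N)"
  unfolding tensor_module_generated[OF assms]
  by (rule left_module_generated_module[OF tensor_satisfies_relations[OF assms]])

lemma y_mat_tensor:
  assumes "left_module H M" "left_module H N"
  shows "y_mat (tensor_module H M N) = tensor_y M N"
  unfolding tensor_module_generated[OF assms]
  by (rule act_y_generated_module[OF tensor_satisfies_relations[OF assms]])

lemma grp_mat_tensor:
  assumes "left_module H M" "left_module H N" "h \<in> carrier G"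
  shows "grp_mat (tensor_module H M N) h = tensor_grp M N h"
  unfolding tensor_module_generated[OF assms(1,2)]
  by (rule act_grp_generated_module[OF tensor_satisfies_relations[OF assms(1,2)] assms(3)])

lemma vdim_tensor [simp]: "vdim (tensor_module A M N) = vdim M * vdim N"
  by (simp add: tensor_module_def)

text \<open>
  On both sides \<open>y\<close> acts by \<open>y \<otimes> g \<otimes> g + 1 \<otimes> y \<otimes> g + 1 \<otimes> 1 \<otimes> y\<close>. As Kronecker products are strictly
  associative, the two modules are equal and not merely isomorphic.
\<close>

lemma tensor_module_assoc:
  assumes L: "left_module H L" and M: "left_module H M" and N: "left_module H N"
  shows "tensor_module H (tensor_module H L M) N = tensor_module H L (tensor_module H M N)"
proof -
  note LM = left_module_tensor[OF L M] and MN = left_module_tensor[OF M N]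
  note DL = module_relations[OF L] and DM = module_relations[OF M] and DN = module_relations[OF N]
  show ?thesis
    unfolding tensor_module_generated[OF LM N] tensor_module_generated[OF L MN]
  proof (rule generated_module_cong)
    show "tensor_y (tensor_module H L M) N = tensor_y L (tensor_module H M N)"
    proof -
      note Lg = DL(1) DL(2)[OF g_closed] and Mg = DM(1) DM(2)[OF g_closed] and Ng = DN(1) DN(2)[OF g_closed]
      let ?a = "vdim L" and ?b = "vdim M" and ?c = "vdim N"
      have "kron_mat (kron_mat (y_mat L) (grp_mat M g) + kron_mat (1\<^sub>m ?a) (y_mat M)) (grp_mat N g) =
          kron_mat (y_mat L) (kron_mat (grp_mat M g) (grp_mat N g)) +
          kron_mat (1\<^sub>m ?a) (kron_mat (y_mat M) (grp_mat N g))"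
        by (simp only: kron_add_left[OF kron_carrier[OF Lg(1) Mg(2)] kron_carrier[OF one_carrier_mat Mg(1)] Ng(2)]
            kron_assoc)
      moreover have "kron_mat (1\<^sub>m ?a) (kron_mat (y_mat M) (grp_mat N g) + kron_mat (1\<^sub>m ?b) (y_mat N)) =
          kron_mat (1\<^sub>m ?a) (kron_mat (y_mat M) (grp_mat N g)) + kron_mat (1\<^sub>m (?a * ?b)) (y_mat N)"
        by (simp only: kron_add_right[OF kron_carrier[OF Mg(1) Ng(2)] kron_carrier[OF one_carrier_mat Ng(1)] one_carrier_mat]
            kron_assoc[symmetric] kron_one)
      ultimately show ?thesis
        unfolding tensor_y_def[of "tensor_module H L M"] tensor_y_def[of L "tensor_module H M N"]
          y_mat_tensor[OF L M] y_mat_tensor[OF M N] grp_mat_tensor[OF M N g_closed] vdim_tensor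
        unfolding tensor_y_def tensor_grp_def
        by (simp only:) (rule assoc_add_mat[OF kron_carrier[OF Lg(1) kron_carrier[OF Mg(2) Ng(2)]]
            kron_carrier[OF one_carrier_mat kron_carrier[OF Mg(1) Ng(2)]]],
          use kron_carrier[OF one_carrier_mat[of "?a * ?b"] Ng(1)] in \<open>simp only: mult.assoc\<close>)
    qed
    show "tensor_grp (tensor_module H L M) N h = tensor_grp L (tensor_module H M N) h"
      if h: "h \<in> carrier G" for h
      by (simp add: tensor_grp_def grp_mat_tensor[OF L M h] grp_mat_tensor[OF M N h] kron_assoc)
  qed simp
qed

lemma trivial_relations: "satisfies_relations 1 (0\<^sub>m 1 1) (\<lambda>_. 1\<^sub>m 1)"
proof -
  have "0\<^sub>m 1 1 ^\<^sub>m n = (0\<^sub>m 1 1 :: 'k mat)" using order_ge_2 by (cases n) (auto intro!: eq_matI)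
  then show ?thesis by (auto simp: satisfies_relations_def)
qed

lemma trivial_generated: "trivial_module H = generated_module G n 1 (0\<^sub>m 1 1) (\<lambda>_. 1\<^sub>m 1)"
proof -
  have p: "0\<^sub>m 1 1 ^\<^sub>m i * 1\<^sub>m 1 = (if i = 0 then 1\<^sub>m 1 else 0\<^sub>m 1 1 :: 'k mat)" for i
    by (cases i) (auto intro!: eq_matI)
  have "counit H = (\<lambda>u. \<Sum>b\<in>B. u b * (case b of (i, h) \<Rightarrow> if i = 0 then 1 else 0))"
    by (simp add: H_hopf_def Let_def based_hopf_def module.defs hopf.defs)
  then show ?thesis
    unfolding trivial_module_def generated_module_def p
    by (auto simp: fun_eq_iff lin_comb_def intro!: eq_matI sum.cong split: prod.splits)
qed

lemma left_module_trivial: "left_module H (trivial_module H)"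
  unfolding trivial_generated by (rule left_module_generated_module[OF trivial_relations])

lemma y_mat_trivial: "y_mat (trivial_module H) = 0\<^sub>m 1 1"
  unfolding trivial_generated by (rule act_y_generated_module[OF trivial_relations])

lemma grp_mat_trivial: "h \<in> carrier G \<Longrightarrow> grp_mat (trivial_module H) h = 1\<^sub>m 1"
  unfolding trivial_generated by (rule act_grp_generated_module[OF trivial_relations])

lemma vdim_trivial [simp]: "vdim (trivial_module A) = 1"
  by (simp add: trivial_module_def)

lemma module_iso_same_generators:
  assumes M: "left_module H M" and N: "left_module H N" and d: "vdim M = vdim N"
    and "y_mat M = y_mat N" "\<And>h. h \<in> carrier G \<Longrightarrow> grp_mat M h = grp_mat N h"
  shows "module_iso H M N"
proof (rule module_iso_generators[OF M N d])
  show "invertible_mat (1\<^sub>m (vdim N) :: 'k mat)"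
    by (rule invertible_matI[of _ "vdim N" "1\<^sub>m (vdim N)"]) auto
  note DN = module_relations(1,2)[OF N]
  show "1\<^sub>m (vdim N) * y_mat M = y_mat N * 1\<^sub>m (vdim N)"
    using assms(4) by (simp only: left_mult_one_mat[OF DN(1)] right_mult_one_mat[OF DN(1)])
  show "1\<^sub>m (vdim N) * grp_mat M h = grp_mat N h * 1\<^sub>m (vdim N)" if h: "h \<in> carrier G" for h
    by (simp only: assms(5)[OF h] left_mult_one_mat[OF DN(2)[OF h]] right_mult_one_mat[OF DN(2)[OF h]])
qed (simp add: d)

lemma tensor_trivial_left:
  assumes M: "left_module H M"
  shows "module_iso H (tensor_module H (trivial_module H) M) M"
proof (rule module_iso_same_generators[OF left_module_tensor[OF left_module_trivial M] M])
  note DM = module_relations[OF M]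
  show "y_mat (tensor_module H (trivial_module H) M) = y_mat M"
    unfolding y_mat_tensor[OF left_module_trivial M] tensor_y_def y_mat_trivial
    using DM(1,2) g_closed by (simp add: kron_zero_left[OF DM(2)])
  show "grp_mat (tensor_module H (trivial_module H) M) h = grp_mat M h" if h: "h \<in> carrier G" for h
    unfolding grp_mat_tensor[OF left_module_trivial M h] tensor_grp_def
    by (simp add: grp_mat_trivial[OF h])
qed simp

lemma tensor_trivial_right:
  assumes M: "left_module H M"
  shows "module_iso H (tensor_module H M (trivial_module H)) M"
proof (rule module_iso_same_generators[OF left_module_tensor[OF M left_module_trivial] M])
  note DM = module_relations[OF M]
  show "y_mat (tensor_module H M (trivial_module H)) = y_mat M"
    unfolding y_mat_tensor[OF M left_module_trivial] tensor_y_def y_mat_trivial grp_mat_trivial[OF g_closed]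
    using DM(1,2) g_closed by (simp add: kron_zero_right[of _ "vdim M" "vdim M"])
  show "grp_mat (tensor_module H M (trivial_module H)) h = grp_mat M h" if h: "h \<in> carrier G" for h
    unfolding grp_mat_tensor[OF M left_module_trivial h] tensor_grp_def
    by (simp add: grp_mat_trivial[OF h])
qed simp

lemma tensor_module_cong:
  assumes M: "left_module H M" "left_module H M'" and N: "left_module H N" "left_module H N'"
    and isoM: "module_iso H M M'" and isoN: "module_iso H N N'"
  shows "module_iso H (tensor_module H M N) (tensor_module H M' N')"
proof -
  define d e where "d = vdim M'" and "e = vdim N'"
  obtain P where d: "vdim M = d" and P: "P \<in> carrier_mat d d" "invertible_mat P"
    and eqP: "\<And>a. a \<in> free_space B \<Longrightarrow> P * act M a = act M' a * P"
    using isoM by (auto simp: module_iso_def d_def H_simps)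
  obtain Q where e: "vdim N = e" and Q: "Q \<in> carrier_mat e e" "invertible_mat Q"
    and eqQ: "\<And>a. a \<in> free_space B \<Longrightarrow> Q * act N a = act N' a * Q"
    using isoN by (auto simp: module_iso_def e_def H_simps)
  note DM = module_relations[OF M(1), unfolded d] and DM' = module_relations[OF M(2), folded d_def]
  note DN = module_relations[OF N(1), unfolded e] and DN' = module_relations[OF N(2), folded e_def]
  have kron: "kron_mat P Q * kron_mat X Y = kron_mat X' Y' * kron_mat P Q"
    if "X \<in> carrier_mat d d" "X' \<in> carrier_mat d d" "Y \<in> carrier_mat e e" "Y' \<in> carrier_mat e e"
      "P * X = X' * P" "Q * Y = Y' * Q" for X X' Y Y'
    using that by (simp add: kron_mult[OF P(1) that(1) Q(1) that(3)] kron_mult[OF that(2) P(1) that(4) Q(1)])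
  note eqs = eqP[OF H_y_carrier] eqP[OF H_grp_carrier] eqQ[OF H_y_carrier] eqQ[OF H_grp_carrier]
  have PQ: "kron_mat P Q \<in> carrier_mat (d * e) (d * e)" using P Q by auto
  show ?thesis
  proof (rule module_iso_generators[OF left_module_tensor[OF M(1) N(1)] left_module_tensor[OF M(2) N(2)],
        where Q = "kron_mat P Q"])
    show "invertible_mat (kron_mat P Q)" by (rule invertible_kron[OF P(2,1) Q(2,1)])
    have A: "kron_mat (y_mat M) (grp_mat N g) \<in> carrier_mat (d * e) (d * e)"
      "kron_mat (1\<^sub>m d) (y_mat N) \<in> carrier_mat (d * e) (d * e)"
      "kron_mat (y_mat M') (grp_mat N' g) \<in> carrier_mat (d * e) (d * e)"
      "kron_mat (1\<^sub>m d) (y_mat N') \<in> carrier_mat (d * e) (d * e)"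
      using DM(1,2) DM'(1,2) DN(1,2) DN'(1,2) g_closed by auto
    show "kron_mat P Q * y_mat (tensor_module H M N) = y_mat (tensor_module H M' N') * kron_mat P Q"
      unfolding y_mat_tensor[OF M(1) N(1)] y_mat_tensor[OF M(2) N(2)] tensor_y_def d d_def[symmetric]
        mult_add_distrib_mat[OF PQ A(1,2)] add_mult_distrib_mat[OF A(3,4) PQ]
      using DM(1,2) DM'(1,2) DN(1,2) DN'(1,2) g_closed eqs P(1)
      by (intro arg_cong2[where f = "(+)"] kron) auto
    show "kron_mat P Q * grp_mat (tensor_module H M N) h = grp_mat (tensor_module H M' N') h * kron_mat P Q"
      if h: "h \<in> carrier G" for h
      unfolding grp_mat_tensor[OF M(1) N(1) h] grp_mat_tensor[OF M(2) N(2) h] tensor_grp_def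
      using DM(1,2) DM'(1,2) DN(1,2) DN'(1,2) h eqs by (intro kron) auto
  qed (use PQ d e in \<open>auto simp: d_def e_def\<close>)
qed

lemma four_block_add:
  fixes X :: "'k mat"
  assumes "X \<in> carrier_mat d d" "X' \<in> carrier_mat d d" "Y \<in> carrier_mat e e" "Y' \<in> carrier_mat e e"
  shows "four_block_mat X (0\<^sub>m d e) (0\<^sub>m e d) Y + four_block_mat X' (0\<^sub>m d e) (0\<^sub>m e d) Y' =
    four_block_mat (X + X') (0\<^sub>m d e) (0\<^sub>m e d) (Y + Y')"
  using assms by (intro eq_matI) auto

lemma tensor_direct_sum_left:
  assumes L: "left_module H L" and M: "left_module H M" and N: "left_module H N"
  shows "module_iso H (tensor_module H (direct_sum M N) L)
    (direct_sum (tensor_module H M L) (tensor_module H N L))"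
proof (rule module_iso_same_generators)
  note MN = left_module_direct_sum[OF M N]
    and M_L = left_module_tensor[OF M L]
    and N_L = left_module_tensor[OF N L]
  show "left_module H (tensor_module H (direct_sum M N) L)" by (rule left_module_tensor[OF MN L])
  show "left_module H (direct_sum (tensor_module H M L) (tensor_module H N L))"
    by (rule left_module_direct_sum[OF M_L N_L])
  note DM = module_relations[OF M] and DN = module_relations[OF N] and DL = module_relations[OF L]
  let ?a = "vdim M" and ?b = "vdim N" and ?c = "vdim L"
  have one: "1\<^sub>m (?a + ?b) = four_block_mat (1\<^sub>m ?a) (0\<^sub>m ?a ?b) (0\<^sub>m ?b ?a) (1\<^sub>m ?b :: 'k mat)"
    by simp
  show "y_mat (tensor_module H (direct_sum M N) L) = y_mat (direct_sum (tensor_module H M L) (tensor_module H N L))"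
    unfolding y_mat_tensor[OF MN L] act_direct_sum y_mat_tensor[OF M L] y_mat_tensor[OF N L]
    unfolding tensor_y_def act_direct_sum vdim_direct_sum vdim_tensor one
      kron_four_block_left[OF DM(1) DN(1) DL(2)[OF g_closed]]
      kron_four_block_left[OF one_carrier_mat one_carrier_mat DL(1)]
    using DM(1,2) DN(1,2) DL(1,2) g_closed by (intro four_block_add) auto
  show "grp_mat (tensor_module H (direct_sum M N) L) h = grp_mat (direct_sum (tensor_module H M L) (tensor_module H N L)) h"
    if h: "h \<in> carrier G" for h
    unfolding grp_mat_tensor[OF MN L h] act_direct_sum grp_mat_tensor[OF M L h] grp_mat_tensor[OF N L h]
    unfolding tensor_grp_def act_direct_sum vdim_tensor
    by (rule kron_four_block_left[OF DM(2)[OF h] DN(2)[OF h] DL(2)[OF h]])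
qed (simp add: distrib_right)

lemma tensor_direct_sum_right:
  assumes L: "left_module H L" and M: "left_module H M" and N: "left_module H N"
  shows "module_iso H (tensor_module H L (direct_sum M N))
    (direct_sum (tensor_module H L M) (tensor_module H L N))"
proof -
  note MN = left_module_direct_sum[OF M N] and LM = left_module_tensor[OF L M] and LN = left_module_tensor[OF L N]
  note DM = module_relations[OF M] and DN = module_relations[OF N] and DL = module_relations[OF L]
  let ?a = "vdim L" and ?b = "vdim M" and ?c = "vdim N"
  let ?P = "perm_matrix (?a * (?b + ?c)) (distrib_index ?a ?b ?c) :: 'k mat"
  let ?F = "\<lambda>Y Z. four_block_mat Y (0\<^sub>m ?b ?c) (0\<^sub>m ?c ?b) Z"
  let ?F' = "\<lambda>Y Z. four_block_mat Y (0\<^sub>m (?a * ?b) (?a * ?c)) (0\<^sub>m (?a * ?c) (?a * ?b)) Z"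
  have P: "?P \<in> carrier_mat (?a * (?b + ?c)) (?a * (?b + ?c))" by simp
  have F: "kron_mat X (?F Y Z) \<in> carrier_mat (?a * (?b + ?c)) (?a * (?b + ?c))"
    and F': "?F' (kron_mat X Y) (kron_mat X Z) \<in> carrier_mat (?a * (?b + ?c)) (?a * (?b + ?c))"
    if "X \<in> carrier_mat ?a ?a" "Y \<in> carrier_mat ?b ?b" "Z \<in> carrier_mat ?c ?c" for X Y Z :: "'k mat"
    using that by (auto simp: distrib_left)
  show ?thesis
  proof (rule module_iso_generators[OF left_module_tensor[OF L MN] left_module_direct_sum[OF LM LN], where Q = ?P])
    show "invertible_mat ?P" by (rule invertible_perm_matrix[OF distrib_index_inj])
    show "?P * y_mat (tensor_module H L (direct_sum M N)) =
        y_mat (direct_sum (tensor_module H L M) (tensor_module H L N)) * ?P"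
    proof -
      note c1 = DL(1) DM(2)[OF g_closed] DN(2)[OF g_closed] and c2 = one_carrier_mat[of ?a] DM(1) DN(1)
      have "y_mat (direct_sum (tensor_module H L M) (tensor_module H L N)) =
          ?F' (kron_mat (y_mat L) (grp_mat M g)) (kron_mat (y_mat L) (grp_mat N g)) +
          ?F' (kron_mat (1\<^sub>m ?a) (y_mat M)) (kron_mat (1\<^sub>m ?a) (y_mat N))"
        unfolding act_direct_sum y_mat_tensor[OF L M] y_mat_tensor[OF L N] tensor_y_def vdim_tensor
        using c1 c2 by (intro four_block_add[symmetric]) auto
      moreover have "y_mat (tensor_module H L (direct_sum M N)) =
          kron_mat (y_mat L) (?F (grp_mat M g) (grp_mat N g)) + kron_mat (1\<^sub>m ?a) (?F (y_mat M) (y_mat N))"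
        unfolding y_mat_tensor[OF L MN] tensor_y_def act_direct_sum ..
      ultimately show ?thesis
        by (simp only: mult_add_distrib_mat[OF P F[OF c1] F[OF c2]] add_mult_distrib_mat[OF F'[OF c1] F'[OF c2] P]
            kron_four_block_right[OF c1] kron_four_block_right[OF c2])
    qed
    show "?P * grp_mat (tensor_module H L (direct_sum M N)) h =
        grp_mat (direct_sum (tensor_module H L M) (tensor_module H L N)) h * ?P"
      if h: "h \<in> carrier G" for h
      unfolding grp_mat_tensor[OF L MN h] act_direct_sum grp_mat_tensor[OF L M h] grp_mat_tensor[OF L N h]
      unfolding tensor_grp_def act_direct_sum vdim_tensor
      by (rule kron_four_block_right[OF DL(2)[OF h] DM(2)[OF h] DN(2)[OF h]])
  qed (auto simp: distrib_left)
qed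

end


section \<open>The Green ring\<close>

definition green_mult ::
    "('k::field, 'b) hopf \<Rightarrow> (('b, 'k) fd_module set \<Rightarrow>\<^sub>0 int) \<Rightarrow> (('b, 'k) fd_module set \<Rightarrow>\<^sub>0 int)
      \<Rightarrow> ('b, 'k) fd_module set \<Rightarrow>\<^sub>0 int" where
  "green_mult A x y = frag_extend (\<lambda>X. frag_extend (\<lambda>Y. frag_of (tensor_class A X Y)) y) x"

lemma free_green_simps:
  "x \<in> carrier (free_green A) \<longleftrightarrow> Poly_Mapping.keys x \<subseteq> iso_classes A"
  "x \<otimes>\<^bsub>free_green A\<^esub> y = green_mult A x y"
  "x \<oplus>\<^bsub>free_green A\<^esub> y = x + y"
  "\<zero>\<^bsub>free_green A\<^esub> = 0"
  "\<one>\<^bsub>free_green A\<^esub> = frag_of (iso_class A (trivial_module A))"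
  by (simp_all add: free_green_def green_mult_def)

lemma green_mult_frag_of: "green_mult A (frag_of X) (frag_of Y) = frag_of (tensor_class A X Y)"
  by (simp add: green_mult_def)

lemma green_mult_zero [simp]: "green_mult A 0 y = 0" "green_mult A x 0 = 0"
  by (simp_all add: green_mult_def frag_extend_eq_0)

text \<open>
  Biadditivity is stated for differences, since these are the steps of the induction principle for
  free Abelian groups.
\<close>

lemma green_mult_diff_left: "green_mult A (x - x') y = green_mult A x y - green_mult A x' y"
  by (simp add: green_mult_def frag_extend_diff)

lemma green_mult_diff_right: "green_mult A x (y - y') = green_mult A x y - green_mult A x y'"
proof -
  have "frag_extend (\<lambda>X. f X - h X) c = frag_extend f c - frag_extend h c"
    for f h :: "('a, 'b) fd_module set \<Rightarrow> ('a, 'b) fd_module set \<Rightarrow>\<^sub>0 int" and c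
    using subset_UNIV[of "Poly_Mapping.keys c"]
    by (induction c rule: frag_induction) (auto simp: frag_extend_diff)
  then show ?thesis by (simp add: green_mult_def frag_extend_diff)
qed

lemma green_mult_minus:
  "green_mult A (- x) y = - green_mult A x y" "green_mult A x (- y) = - green_mult A x y"
  using green_mult_diff_left[of A 0 x y] green_mult_diff_right[of A x 0 y] by simp_all

lemma green_mult_add:
  "green_mult A (x + x') y = green_mult A x y + green_mult A x' y"
  "green_mult A x (y + y') = green_mult A x y + green_mult A x y'"
  using green_mult_diff_left[of A x "- x'" y] green_mult_diff_right[of A x y "- y'"]
  by (simp_all add: green_mult_minus)

text \<open>
  The properties of tensor products that turn isomorphism classes of modules into a ring.
\<close>

locale monoidal_modules =
  fixes A :: "('k::field, 'b) hopf"
  assumes tensor_closed: "\<lbrakk>left_module A M; left_module A N\<rbrakk> \<Longrightarrow> left_module A (tensor_module A M N)"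
    and tensor_cong: "\<lbrakk>left_module A M; left_module A M'; left_module A N; left_module A N';
      module_iso A M M'; module_iso A N N'\<rbrakk> \<Longrightarrow> module_iso A (tensor_module A M N) (tensor_module A M' N')"
    and tensor_assoc: "\<lbrakk>left_module A L; left_module A M; left_module A N\<rbrakk> \<Longrightarrow>
      module_iso A (tensor_module A (tensor_module A L M) N) (tensor_module A L (tensor_module A M N))"
    and trivial_closed: "left_module A (trivial_module A)"
    and trivial_tensor: "left_module A M \<Longrightarrow> module_iso A (tensor_module A (trivial_module A) M) M"
    and tensor_trivial: "left_module A M \<Longrightarrow> module_iso A (tensor_module A M (trivial_module A)) M"
    and direct_sum_tensor: "\<lbrakk>left_module A L; left_module A M; left_module A N\<rbrakk> \<Longrightarrow>
      module_iso A (tensor_module A (direct_sum M N) L) (direct_sum (tensor_module A M L) (tensor_module A N L))"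
    and tensor_direct_sum: "\<lbrakk>left_module A L; left_module A M; left_module A N\<rbrakk> \<Longrightarrow>
      module_iso A (tensor_module A L (direct_sum M N)) (direct_sum (tensor_module A L M) (tensor_module A L N))"
begin

lemma iso_class_eqI:
  assumes M: "left_module A M" and N: "left_module A N" and MN: "module_iso A M N"
  shows "iso_class A M = iso_class A N"
  using module_iso_trans[OF M N _ MN] module_iso_trans[OF N M _ module_iso_sym[OF M N MN]]
  by (auto simp: iso_class_def)

lemma iso_class_in: "left_module A M \<Longrightarrow> iso_class A M \<in> iso_classes A"
  by (simp add: iso_classes_def)

lemma iso_classesE:
  assumes "X \<in> iso_classes A"
  obtains M where "left_module A M" "X = iso_class A M"
  using assms by (auto simp: iso_classes_def)

text \<open>
  The product of two classes is a union over all representatives; all members of this union are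
  one and the same class.
\<close>

lemma tensor_class_iso_class:
  assumes M: "left_module A M" and N: "left_module A N"
  shows "tensor_class A (iso_class A M) (iso_class A N) = iso_class A (tensor_module A M N)"
proof -
  have "iso_class A (tensor_module A M' N') = iso_class A (tensor_module A M N)"
    if "M' \<in> iso_class A M" "N' \<in> iso_class A N" for M' N'
  proof -
    have M': "left_module A M'" "module_iso A M M'" and N': "left_module A N'" "module_iso A N N'"
      using that by (simp_all add: iso_class_def)
    show ?thesis
      by (rule iso_class_eqI[symmetric, OF tensor_closed[OF M N] tensor_closed[OF M'(1) N'(1)]
            tensor_cong[OF M M'(1) N N'(1) M'(2) N'(2)]])
  qed
  moreover have "M \<in> iso_class A M" "N \<in> iso_class A N"
    using M N by (auto simp: iso_class_def module_iso_refl)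
  ultimately show ?thesis unfolding tensor_class_def by blast
qed

lemma tensor_class_closed:
  "X \<in> iso_classes A \<Longrightarrow> Y \<in> iso_classes A \<Longrightarrow> tensor_class A X Y \<in> iso_classes A"
  by (auto elim!: iso_classesE simp: tensor_class_iso_class intro!: iso_class_in tensor_closed)

lemma green_mult_closed:
  assumes "Poly_Mapping.keys x \<subseteq> iso_classes A" "Poly_Mapping.keys y \<subseteq> iso_classes A"
  shows "Poly_Mapping.keys (green_mult A x y) \<subseteq> iso_classes A"
  unfolding green_mult_def using assms
  by (intro order_trans[OF keys_frag_extend] UN_least)
    (auto simp: tensor_class_closed subset_iff keys_frag_of dest!: subsetD[OF keys_frag_extend])

text \<open>
  By biadditivity every ring law reduces to classes of modules, where it is one of the assumed
  isomorphisms.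
\<close>

lemma ring_free_green: "ring (free_green A)"
proof (rule ringI)
  show "abelian_group (free_green A)"
  proof (rule abelian_groupI, unfold free_green_simps)
    show "\<exists>y\<in>carrier (free_green A). y + x = 0"
      if "Poly_Mapping.keys x \<subseteq> iso_classes A" for x
      using that by (intro bexI[of _ "- x"]) (simp_all add: free_green_simps)
  qed (auto simp: ac_simps dest!: subsetD[OF keys_add])
  show "monoid (free_green A)"
  proof (rule monoidI, unfold free_green_simps)
    fix x y z :: "('b, 'k) fd_module set \<Rightarrow>\<^sub>0 int"
    assume x: "Poly_Mapping.keys x \<subseteq> iso_classes A" and y: "Poly_Mapping.keys y \<subseteq> iso_classes A"
      and z: "Poly_Mapping.keys z \<subseteq> iso_classes A"
    show "Poly_Mapping.keys (green_mult A x y) \<subseteq> iso_classes A" by (rule green_mult_closed[OF x y])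
    show "green_mult A (green_mult A x y) z = green_mult A x (green_mult A y z)"
      using x
    proof (induction x rule: free_Abelian_group_induct[consumes 1])
      case (3 X)
      show ?case using y
      proof (induction y rule: free_Abelian_group_induct[consumes 1])
        case (3 Y)
        show ?case using z
        proof (induction z rule: free_Abelian_group_induct[consumes 1])
          case (3 Z)
          obtain L M N where "left_module A L" "left_module A M" "left_module A N"
            "X = iso_class A L" "Y = iso_class A M" "Z = iso_class A N"
            using \<open>X \<in> _\<close> \<open>Y \<in> _\<close> \<open>Z \<in> _\<close> by (auto elim!: iso_classesE)
          moreover from this have "iso_class A (tensor_module A (tensor_module A L M) N) =
              iso_class A (tensor_module A L (tensor_module A M N))"
            by (intro iso_class_eqI tensor_assoc tensor_closed)
          ultimately show ?case
            by (simp add: green_mult_frag_of tensor_class_iso_class tensor_closed)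
        qed (simp_all add: green_mult_diff_right)
      qed (simp_all add: green_mult_diff_left green_mult_diff_right)
    qed (simp_all add: green_mult_diff_left)
    show "green_mult A (frag_of (iso_class A (trivial_module A))) x = x"
      using x
    proof (induction x rule: free_Abelian_group_induct[consumes 1])
      case (3 X)
      obtain M where M: "left_module A M" "X = iso_class A M" using 3 by (rule iso_classesE)
      have "iso_class A (tensor_module A (trivial_module A) M) = iso_class A M"
        by (intro iso_class_eqI trivial_tensor tensor_closed trivial_closed M)
      then show ?case by (simp add: M green_mult_frag_of tensor_class_iso_class trivial_closed)
    qed (simp_all add: green_mult_diff_right)
    show "green_mult A x (frag_of (iso_class A (trivial_module A))) = x"
      using x
    proof (induction x rule: free_Abelian_group_induct[consumes 1])
      case (3 X)
      obtain M where M: "left_module A M" "X = iso_class A M" using 3 by (rule iso_classesE)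
      have "iso_class A (tensor_module A M (trivial_module A)) = iso_class A M"
        by (intro iso_class_eqI tensor_trivial tensor_closed trivial_closed M)
      then show ?case by (simp add: M green_mult_frag_of tensor_class_iso_class trivial_closed)
    qed (simp_all add: green_mult_diff_left)
  next
    show "Poly_Mapping.keys (frag_of (iso_class A (trivial_module A))) \<subseteq> iso_classes A"
      by (simp add: iso_class_in trivial_closed)
  qed
qed (simp_all add: free_green_simps green_mult_add)

definition sum_relations :: "(('b, 'k) fd_module set \<Rightarrow>\<^sub>0 int) set" where
  "sum_relations = {frag_of (iso_class A (direct_sum M N)) - (frag_of (iso_class A M) + frag_of (iso_class A N)) | M N.
      left_module A M \<and> left_module A N}"

lemma green_relations_eq: "green_relations A = generate (free_Abelian_group (iso_classes A)) sum_relations"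
  by (simp add: green_relations_def sum_relations_def)

lemma sum_relations_keys: "x \<in> sum_relations \<Longrightarrow> Poly_Mapping.keys x \<subseteq> iso_classes A"
  by (auto simp: sum_relations_def keys_frag_of iso_class_in left_module_direct_sum
      dest!: subsetD[OF keys_diff] subsetD[OF keys_add])

lemma green_relations_subgroup: "subgroup (green_relations A) (free_Abelian_group (iso_classes A))"
  unfolding green_relations_eq
  by (rule group.generate_is_subgroup[OF group_free_Abelian_group])
    (use sum_relations_keys in auto)

lemma green_relations_diff: "x \<in> green_relations A \<Longrightarrow> y \<in> green_relations A \<Longrightarrow> x - y \<in> green_relations A"
proof -
  assume x: "x \<in> green_relations A" and y: "y \<in> green_relations A"
  have k: "Poly_Mapping.keys y \<subseteq> iso_classes A"
    using subgroup.mem_carrier[OF green_relations_subgroup y] by simp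
  show ?thesis
    using subgroup.m_closed[OF green_relations_subgroup x subgroup.m_inv_closed[OF green_relations_subgroup y]]
    by (simp add: k)
qed

lemma green_relations_zero: "0 \<in> green_relations A"
  using subgroup.one_closed[OF green_relations_subgroup] by simp

text \<open>
  Distributivity turns the relation for \<open>M \<oplus> N\<close> into the relation for \<open>(M \<otimes> L) \<oplus> (N \<otimes> L)\<close>, and
  likewise on the other side. This is why the relations generate an ideal already as a group.
\<close>

lemma sum_relations_mult:
  assumes r: "r \<in> sum_relations" and X: "X \<in> iso_classes A"
  shows "green_mult A r (frag_of X) \<in> sum_relations" "green_mult A (frag_of X) r \<in> sum_relations"
proof -
  obtain M N where MN: "left_module A M" "left_module A N"
    and r: "r = frag_of (iso_class A (direct_sum M N)) - (frag_of (iso_class A M) + frag_of (iso_class A N))"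
    using r by (auto simp: sum_relations_def)
  obtain L where L: "left_module A L" and X: "X = iso_class A L" using X by (rule iso_classesE)
  note sum = left_module_direct_sum[OF MN]
  have 1: "iso_class A (tensor_module A (direct_sum M N) L) =
      iso_class A (direct_sum (tensor_module A M L) (tensor_module A N L))"
    by (intro iso_class_eqI direct_sum_tensor tensor_closed left_module_direct_sum MN L)
  have 2: "iso_class A (tensor_module A L (direct_sum M N)) =
      iso_class A (direct_sum (tensor_module A L M) (tensor_module A L N))"
    by (intro iso_class_eqI tensor_direct_sum tensor_closed left_module_direct_sum MN L)
  have "green_mult A r (frag_of X) = frag_of (iso_class A (direct_sum (tensor_module A M L) (tensor_module A N L))) -
      (frag_of (iso_class A (tensor_module A M L)) + frag_of (iso_class A (tensor_module A N L)))"
    by (simp add: r X green_mult_diff_left green_mult_add green_mult_frag_of tensor_class_iso_class MN L sum 1)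
  then show "green_mult A r (frag_of X) \<in> sum_relations"
    unfolding sum_relations_def using tensor_closed MN L by blast
  have "green_mult A (frag_of X) r = frag_of (iso_class A (direct_sum (tensor_module A L M) (tensor_module A L N))) -
      (frag_of (iso_class A (tensor_module A L M)) + frag_of (iso_class A (tensor_module A L N)))"
    by (simp add: r X green_mult_diff_right green_mult_add green_mult_frag_of tensor_class_iso_class MN L sum 2)
  then show "green_mult A (frag_of X) r \<in> sum_relations"
    unfolding sum_relations_def using tensor_closed MN L by blast
qed

lemma green_relations_mult:
  assumes r: "r \<in> green_relations A" and x: "Poly_Mapping.keys x \<subseteq> iso_classes A"
  shows "green_mult A r x \<in> green_relations A \<and> green_mult A x r \<in> green_relations A"
proof -
  have base: "green_mult A r x \<in> green_relations A \<and> green_mult A x r \<in> green_relations A"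
    if r: "r \<in> sum_relations" for r
    using x
  proof (induction x rule: free_Abelian_group_induct[consumes 1])
    case (3 X)
    show ?case using sum_relations_mult[OF r 3] by (simp add: green_relations_eq generate.incl)
  qed (simp_all add: green_relations_zero green_relations_diff green_mult_diff_left green_mult_diff_right)
  show ?thesis using r unfolding green_relations_eq
  proof (induction r rule: generate.induct)
    case one
    then show ?case using green_relations_zero by (simp add: green_relations_eq)
  next
    case (incl h)
    then show ?case using base by (simp add: green_relations_eq)
  next
    case (inv h)
    have "- green_mult A h x \<in> green_relations A" "- green_mult A x h \<in> green_relations A"
      using green_relations_diff[OF green_relations_zero] base[OF inv] by force+
    then show ?case
      using sum_relations_keys[OF inv] by (simp add: green_mult_minus green_relations_eq)
  next
    case (eng h1 h2)
    then show ?case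
      using generate.eng[of _ "free_Abelian_group (iso_classes A)" sum_relations] by (simp add: green_mult_add)
  qed
qed

lemma ideal_green_relations: "ideal (green_relations A) (free_green A)"
proof (rule idealI[OF ring_free_green])
  have "add_monoid (free_green A) = free_Abelian_group (iso_classes A)"
    by (simp add: free_green_def free_Abelian_group_def)
  then show "subgroup (green_relations A) (add_monoid (free_green A))"
    using green_relations_subgroup by simp
qed (use green_relations_mult in \<open>auto simp: free_green_simps\<close>)

lemma ring_green_ring: "ring (green_ring A)"
  unfolding green_ring_def by (rule ideal.quotient_is_ring[OF ideal_green_relations])

lemma green_class_closed: "left_module A M \<Longrightarrow> green_class A M \<in> carrier (green_ring A)"
  and green_class_tensor: "left_module A M \<Longrightarrow> left_module A N \<Longrightarrow>
    green_class A (tensor_module A M N) = green_class A M \<otimes>\<^bsub>green_ring A\<^esub> green_class A N"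
  and green_class_trivial: "green_class A (trivial_module A) = \<one>\<^bsub>green_ring A\<^esub>"
  and green_class_direct_sum: "left_module A M \<Longrightarrow> left_module A N \<Longrightarrow>
    green_class A (direct_sum M N) = green_class A M \<oplus>\<^bsub>green_ring A\<^esub> green_class A N"
proof -
  interpret I: ideal "green_relations A" "free_green A" by (rule ideal_green_relations)
  let ?h = "(+>\<^bsub>free_green A\<^esub>) (green_relations A)"
  have h: "?h \<in> Ring.ring_hom (free_green A) (green_ring A)"
    unfolding green_ring_def by (rule I.rcos_ring_hom)
  have c: "frag_of (iso_class A M) \<in> carrier (free_green A)" if "left_module A M" for M
    using that by (simp add: free_green_simps iso_class_in)
  show "green_class A M \<in> carrier (green_ring A)" if "left_module A M"
    unfolding green_class_def by (rule ring_hom_closed[OF h c[OF that]])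
  show "green_class A (tensor_module A M N) = green_class A M \<otimes>\<^bsub>green_ring A\<^esub> green_class A N"
    if "left_module A M" "left_module A N"
    unfolding green_class_def ring_hom_mult[OF h c[OF that(1)] c[OF that(2)], symmetric]
    by (simp add: free_green_simps green_mult_frag_of tensor_class_iso_class that)
  show "green_class A (trivial_module A) = \<one>\<^bsub>green_ring A\<^esub>"
    unfolding green_class_def ring_hom_one[OF h, symmetric] by (simp add: free_green_simps)
  show "green_class A (direct_sum M N) = green_class A M \<oplus>\<^bsub>green_ring A\<^esub> green_class A N"
    if MN: "left_module A M" "left_module A N"
  proof -
    let ?x = "frag_of (iso_class A M) + frag_of (iso_class A N)" and ?s = "frag_of (iso_class A (direct_sum M N))"
    have x: "?x \<in> carrier (free_green A)"
      using I.add.m_closed[OF c[OF MN(1)] c[OF MN(2)]] by (simp add: free_green_simps)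
    \<comment> \<open>The two classes differ by a defining relation, hence have the same coset.\<close>
    have "?s - ?x \<in> green_relations A"
      unfolding green_relations_eq by (rule generate.incl) (use MN in \<open>auto simp: sum_relations_def\<close>)
    then have "?s \<in> ?h ?x"
      by (auto simp: a_r_coset_def' free_green_simps intro!: bexI[of _ "?s - ?x"])
    then have "?h ?x = ?h ?s"
      by (intro I.a_repr_independence) (use x I.a_subgroup in auto)
    then show ?thesis
      unfolding green_class_def ring_hom_add[OF h c[OF MN(1)] c[OF MN(2)], symmetric]
      by (simp add: free_green_simps)
  qed
qed

lemma green_class_iso:
  assumes "left_module A M" "left_module A N" "module_iso A M N"
  shows "green_class A M = green_class A N"
  unfolding green_class_def iso_class_eqI[OF assms] ..

end

context nilpotent_group_datum
begin

lemma monoidal_modules_H: "monoidal_modules H"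
proof
  show "module_iso H (tensor_module H (tensor_module H L M) N) (tensor_module H L (tensor_module H M N))"
    if "left_module H L" "left_module H M" "left_module H N" for L M N
    unfolding tensor_module_assoc[OF that] by (intro module_iso_refl left_module_tensor that)
qed (fact left_module_tensor tensor_module_cong left_module_trivial tensor_trivial_left
  tensor_trivial_right tensor_direct_sum_left tensor_direct_sum_right)+

end


section \<open>Uniserial modules and tensoring with a two-dimensional one\<close>

definition shift_mat :: "nat \<Rightarrow> 'k::zero_neq_one mat" where
  "shift_mat j = mat j j (\<lambda>(r, s). if r = Suc s then 1 else 0)"

lemma shift_mat_carrier [simp]: "shift_mat j \<in> carrier_mat j j"
  by (simp add: shift_mat_def)

lemma shift_mat_dim [simp]: "dim_row (shift_mat j) = j" "dim_col (shift_mat j) = j"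
  by (simp_all add: shift_mat_def)

lemma shift_mat_pow: "shift_mat j ^\<^sub>m i = (mat j j (\<lambda>(r, s). if r = s + i then 1 else 0) :: 'k::comm_semiring_1 mat)"
proof (induction i)
  case 0
  show ?case by (intro eq_matI) auto
next
  case (Suc i)
  have "mat j j (\<lambda>(r, s). if r = s + i then 1 else 0) * shift_mat j =
      (mat j j (\<lambda>(r, s). if r = s + Suc i then 1 else 0) :: 'k mat)" (is "?X * _ = ?Z")
  proof (rule eq_matI)
    fix r s assume "r < dim_row ?Z" "s < dim_col ?Z"
    then have rs: "r < j" "s < j" by auto
    have "(?X * shift_mat j) $$ (r, s) = (\<Sum>x<j. (if r = x + i then 1 else 0) * (if x = Suc s then 1 else 0 :: 'k))"
      using rs by (subst mult_mat_index[of _ j j _ j]) (auto simp: shift_mat_def intro!: sum.cong)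
    also have "\<dots> = (\<Sum>x<j. if x = Suc s then if r = Suc s + i then 1 else 0 else 0)"
      by (intro sum.cong) auto
    finally show "(?X * shift_mat j) $$ (r, s) = ?Z $$ (r, s)" using rs by (simp only: sum.delta finite_lessThan) auto
  qed auto
  then show ?case using Suc by simp
qed

lemma invertible_of_right_inverse:
  fixes P Q :: "'k::field mat"
  assumes "P \<in> carrier_mat d d" "Q \<in> carrier_mat d d" "P * Q = 1\<^sub>m d"
  shows "invertible_mat P"
  using assms mat_mult_left_right_inverse[OF assms] by (intro invertible_matI[of P d Q]) auto

text \<open>
  The base changes below have at most two entries in each column. The rows \<open>f j\<close> and \<open>h j\<close> of the
  two entries may coincide, in which case the entries add up.
\<close>

definition two_entry_mat ::
    "nat \<Rightarrow> (nat \<Rightarrow> nat) \<Rightarrow> (nat \<Rightarrow> 'k) \<Rightarrow> (nat \<Rightarrow> nat) \<Rightarrow> (nat \<Rightarrow> 'k) \<Rightarrow> 'k::semiring_0 mat" where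
  "two_entry_mat d f a h b = mat d d (\<lambda>(i, j). (if i = f j then a j else 0) + (if i = h j then b j else 0))"

lemma two_entry_mat_carrier [simp]: "two_entry_mat d f a h b \<in> carrier_mat d d"
  by (simp add: two_entry_mat_def)

lemma mult_two_entry_mat:
  fixes X :: "'k::comm_semiring_0 mat"
  assumes X: "X \<in> carrier_mat d d" and ij: "i < d" "j < d" and fh: "f j < d" "h j < d"
  shows "(X * two_entry_mat d f a h b) $$ (i, j) = X $$ (i, f j) * a j + X $$ (i, h j) * b j"
proof -
  have "(X * two_entry_mat d f a h b) $$ (i, j) =
      (\<Sum>x<d. (if x = f j then X $$ (i, x) * a j else 0) + (if x = h j then X $$ (i, x) * b j else 0))"
    unfolding mult_mat_index[OF X two_entry_mat_carrier ij]
    using ij by (intro sum.cong) (auto simp: two_entry_mat_def distrib_left)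
  then show ?thesis using fh by (simp add: sum.distrib)
qed

text \<open>
  If the group acts diagonally on both sides, a base change is equivariant as soon as it only
  combines basis vectors of equal weight.
\<close>

lemma diagonal_intertwines:
  fixes P :: "'k::comm_semiring_1 mat"
  assumes P: "P \<in> carrier_mat d d"
    and eq: "\<And>i j. i < d \<Longrightarrow> j < d \<Longrightarrow> P $$ (i, j) \<noteq> 0 \<Longrightarrow> f i = h j"
  shows "P * mat_diag d h = mat_diag d f * P"
proof (rule eq_matI)
  fix i j assume "i < dim_row (mat_diag d f * P)" "j < dim_col (mat_diag d f * P)"
  then have ij: "i < d" "j < d" using P by (auto simp: mat_diag_def)
  show "(P * mat_diag d h) $$ (i, j) = (mat_diag d f * P) $$ (i, j)"
    unfolding mat_diag_mult_left[OF P] mat_diag_mult_right[OF P]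
    using ij eq[OF ij] by (cases "P $$ (i, j) = 0") (auto simp: mult.commute)
qed (use P in \<open>auto simp: mat_diag_def\<close>)

context nilpotent_group_datum
begin

definition weight_mat :: "nat \<Rightarrow> nat \<Rightarrow> 'g \<Rightarrow> 'k mat" where
  "weight_mat t j h = mat_diag j (\<lambda>r. inverse (\<chi> h) ^ (t + r))"

text \<open>
  The uniserial module on \<open>e\<^sub>0, \<dots>, e\<^sub>j\<^sub>-\<^sub>1\<close> with \<open>y e\<^sub>r = e\<^sub>r\<^sub>+\<^sub>1\<close>, whose top \<open>e\<^sub>0\<close> has weight
  \<open>\<chi>\<^sup>-\<^sup>t\<close>.
\<close>

definition chain :: "nat \<Rightarrow> nat \<Rightarrow> (nat \<times> 'g, 'k) fd_module" where
  "chain t j = generated_module G n j (shift_mat j) (weight_mat t j)"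

lemma weight_mat_dim [simp]: "dim_row (weight_mat t j h) = j" "dim_col (weight_mat t j h) = j"
  by (simp_all add: weight_mat_def mat_diag_def)

lemma weight_mat_carrier [simp]: "weight_mat t j h \<in> carrier_mat j j"
  by (simp add: weight_mat_def)

lemma vdim_chain [simp]: "vdim (chain t j) = j"
  by (simp add: chain_def)

lemma chain_relations:
  assumes "j \<le> n"
  shows "satisfies_relations j (shift_mat j) (weight_mat t j)"
  unfolding satisfies_relations_def
proof (intro conjI ballI)
  show "shift_mat j ^\<^sub>m n = (0\<^sub>m j j :: 'k mat)"
    unfolding shift_mat_pow using assms by (intro eq_matI) auto
  show "weight_mat t j \<one> = 1\<^sub>m j"
    by (intro eq_matI) (auto simp: weight_mat_def mat_diag_def character_one)
  show "weight_mat t j (h \<otimes> k) = weight_mat t j h * weight_mat t j k"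
    if "h \<in> carrier G" "k \<in> carrier G" for h k
    using that by (simp add: weight_mat_def character_mult power_mult_distrib)
  show "shift_mat j * weight_mat t j h = \<chi> h \<cdot>\<^sub>m (weight_mat t j h * shift_mat j)"
    if h: "h \<in> carrier G" for h
    unfolding weight_mat_def mat_diag_mult_left[OF shift_mat_carrier] mat_diag_mult_right[OF shift_mat_carrier]
    using character_nonzero[OF h] by (intro eq_matI) (auto simp: shift_mat_def)
qed auto

lemma left_module_chain: "j \<le> n \<Longrightarrow> left_module H (chain t j)"
  unfolding chain_def by (rule left_module_generated_module[OF chain_relations])

lemma y_mat_chain: "j \<le> n \<Longrightarrow> y_mat (chain t j) = shift_mat j"
  unfolding chain_def by (rule act_y_generated_module[OF chain_relations])

lemma grp_mat_chain: "j \<le> n \<Longrightarrow> h \<in> carrier G \<Longrightarrow> grp_mat (chain t j) h = weight_mat t j h"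
  unfolding chain_def by (rule act_grp_generated_module[OF chain_relations])

lemma indec_module_chain:
  assumes d: "vdim V = 1" and V: "\<And>h. h \<in> carrier G \<Longrightarrow> act V (basis_elt h) = inverse (\<chi> h) ^ t \<cdot>\<^sub>m 1\<^sub>m 1"
  shows "indec_module G \<chi> n V j = chain t j"
proof -
  have "indec_y j 1 = (shift_mat j :: 'k mat)"
    by (simp add: indec_y_def shift_mat_def)
  moreover have "indec_grp \<chi> V j h = weight_mat t j h" if "h \<in> carrier G" for h
    unfolding indec_grp_def V[OF that] kron_smult_right
    by (intro eq_matI) (auto simp: weight_mat_def mat_diag_def power_add)
  ultimately show ?thesis
    by (auto simp: indec_module_def chain_def generated_module_def d lin_comb_def fun_eq_iff H_basis_def
        intro!: sum_mat_cong)
qed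

lemma trivial_chain: "trivial_module H = chain 0 1"
  unfolding trivial_generated chain_def
  by (rule generated_module_cong)
    (auto simp: weight_mat_def mat_diag_def shift_mat_def intro!: eq_matI)

lemma weight_mat_one: "weight_mat t (Suc 0) h = inverse (\<chi> h) ^ t \<cdot>\<^sub>m 1\<^sub>m (Suc 0)"
  by (intro eq_matI) (auto simp: weight_mat_def mat_diag_def)

lemma shift_mat_one: "shift_mat (Suc 0) = 0\<^sub>m (Suc 0) (Suc 0)"
  by (intro eq_matI) (auto simp: shift_mat_def)

text \<open>
  On \<open>chain 1 1\<close> the element \<open>y\<close> acts by zero, so on the tensor product it acts by \<open>1 \<otimes> y\<close> alone, and
  all weights are multiplied by \<open>\<chi>\<^sup>-\<^sup>1\<close>.
\<close>

lemma tensor_chain_one: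
  assumes "j \<le> n"
  shows "tensor_module H (chain 1 1) (chain t j) = chain (Suc t) j"
proof -
  have n1: "1 \<le> n" using order_ge_2 by simp
  note C = left_module_chain[OF n1, of 1] left_module_chain[OF assms, of t]
  show ?thesis
    unfolding tensor_module_generated[OF C] chain_def[of "Suc t" j]
  proof (rule generated_module_cong)
    show "tensor_y (chain 1 1) (chain t j) = shift_mat j"
      unfolding tensor_y_def y_mat_chain[OF n1] y_mat_chain[OF assms] grp_mat_chain[OF assms g_closed]
      by (simp add: shift_mat_one kron_zero_left[OF weight_mat_carrier])
    show "tensor_grp (chain 1 1) (chain t j) h = weight_mat (Suc t) j h" if h: "h \<in> carrier G" for h
      unfolding tensor_grp_def grp_mat_chain[OF n1 h] grp_mat_chain[OF assms h]
      by (simp add: weight_mat_one kron_smult_left) (intro eq_matI, auto simp: weight_mat_def mat_diag_def)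
  qed simp
qed

text \<open>
  With the one-dimensional factor on the right, \<open>y\<close> acts by \<open>y \<otimes> g\<close>, that is, by \<open>q\<^sup>-\<^sup>1\<close> times the
  shift. Rescaling a basis vector removes the factor.
\<close>

lemma tensor_one_chain_two: "module_iso H (tensor_module H (chain 0 2) (chain 1 1)) (chain 1 2)"
proof -
  have n1: "1 \<le> n" using order_ge_2 by simp
  note C = left_module_chain[OF order_ge_2, of 0] left_module_chain[OF n1, of 1]
  define w where "w = inverse (\<chi> g)"
  have w: "w \<noteq> 0" using character_nonzero[OF g_closed] by (simp add: w_def)
  let ?P = "mat_diag 2 (\<lambda>i. if i = 0 then w else 1)"
  show ?thesis
  proof (rule module_iso_generators[OF left_module_tensor[OF C] left_module_chain[OF order_ge_2], where Q = ?P])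
    show "invertible_mat ?P"
    proof (rule invertible_of_right_inverse)
      have "(\<lambda>i. (if i = 0 then w else 1) * (if i = 0 then inverse w else 1)) = (\<lambda>i :: nat. 1)"
        using w by auto
      then show "?P * mat_diag 2 (\<lambda>i. if i = 0 then inverse w else 1) = 1\<^sub>m 2"
        by (simp only: mat_diag_diag mat_diag_one)
    qed auto
    show "?P * y_mat (tensor_module H (chain 0 2) (chain 1 1)) = y_mat (chain 1 2) * ?P"
      unfolding y_mat_tensor[OF C] tensor_y_def y_mat_chain[OF order_ge_2] y_mat_chain[OF n1]
        grp_mat_chain[OF n1 g_closed]
      by (simp add: shift_mat_one weight_mat_one kron_smult_right kron_zero_right[OF one_carrier_mat]
          mat_diag_mult_left[of _ 2 2] mat_diag_mult_right[of _ 2 2] right_add_zero_mat[of _ 2 2] flip: w_def)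
        (intro eq_matI, auto simp: shift_mat_def)
    show "?P * grp_mat (tensor_module H (chain 0 2) (chain 1 1)) h = grp_mat (chain 1 2) h * ?P"
      if h: "h \<in> carrier G" for h
      unfolding grp_mat_tensor[OF C h] tensor_grp_def grp_mat_chain[OF order_ge_2 h] grp_mat_chain[OF n1 h]
    proof -
      have "kron_mat (weight_mat 0 2 h) (weight_mat 1 1 h) = weight_mat 1 2 h"
        by (simp add: weight_mat_one kron_smult_right)
          (intro eq_matI, auto simp: weight_mat_def mat_diag_def)
      then show "?P * kron_mat (weight_mat 0 2 h) (weight_mat 1 1 h) = weight_mat 1 2 h * ?P"
        by (simp add: weight_mat_def mult.commute)
    qed
  qed auto
qed

text \<open>
  The quantum integers for \<open>q\<^sup>-\<^sup>1\<close>, which are the numbers \<open>c\<^sub>b\<close> in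
  \<open>y\<^sup>b (e\<^sub>0 \<otimes> e\<^sub>0) = e\<^sub>0 \<otimes> e\<^sub>b + c\<^sub>b (e\<^sub>1 \<otimes> e\<^sub>b\<^sub>-\<^sub>1)\<close>.
\<close>

definition qint :: "nat \<Rightarrow> 'k" where
  "qint b = (\<Sum>i<b. inverse (\<chi> g) ^ i)"

lemma qint_0 [simp]: "qint 0 = 0" and qint_Suc: "qint (Suc b) = qint b + inverse (\<chi> g) ^ b"
  by (simp_all add: qint_def)

lemma qint_n: "qint n = 0" and qint_nonzero: "0 < b \<Longrightarrow> b < n \<Longrightarrow> qint b \<noteq> 0"
proof -
  let ?w = "inverse (\<chi> g)"
  have g: "(1 - ?w) * qint b = 1 - ?w ^ b" for b
    unfolding qint_def by (rule one_diff_power_eq[symmetric])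
  have "?w ^ b \<noteq> 1" if "0 < b" "b < n" for b
    using order_minimal[OF that] by (simp add: power_inverse)
  then show "qint b \<noteq> 0" if "0 < b" "b < n" using g[of b] that by auto
  have "?w \<noteq> 1" using order_minimal[of 1] order_ge_2 by auto
  moreover have "?w ^ n = 1" using order_power by (simp add: power_inverse)
  ultimately show "qint n = 0" using g[of n] by simp
qed

lemma double_index:
  assumes "i < 2 * (k::nat)"
  shows "i div k = (if i < k then 0 else 1)" "i mod k = (if i < k then i else i - k)"
  using assms by (auto simp: div_if mod_if)

text \<open>
  The vector \<open>e\<^sub>0 \<otimes> e\<^sub>b\<close> has index \<open>b\<close> and \<open>e\<^sub>1 \<otimes> e\<^sub>b\<close> has index \<open>k + b\<close>. Hence the first term is
  the passage from \<open>e\<^sub>0 \<otimes> e\<^sub>b\<close> to \<open>q\<^sup>-\<^sup>b (e\<^sub>1 \<otimes> e\<^sub>b)\<close>, and the second one raises the right index, where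
  \<open>i \<noteq> k\<close> keeps the step from leading out of the first block.
\<close>

lemma y_mat_two_tensor_chain:
  assumes k: "k \<le> n"
  shows "y_mat (tensor_module H (chain 0 2) (chain 0 k)) = mat (2 * k) (2 * k) (\<lambda>(i, j).
    (if i = j + k then inverse (\<chi> g) ^ j else 0) + (if i = Suc j \<and> i \<noteq> k then 1 else 0))"
    (is "?L = ?R")
proof -
  note C = left_module_chain[OF order_ge_2, of 0] left_module_chain[OF k, of 0]
  have L: "?L = kron_mat (shift_mat 2) (weight_mat 0 k g) + kron_mat (1\<^sub>m 2) (shift_mat k)"
    unfolding y_mat_tensor[OF C] tensor_y_def
    by (simp only: y_mat_chain[OF order_ge_2] y_mat_chain[OF k] grp_mat_chain[OF k g_closed] vdim_chain)
  show ?thesis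
  proof (rule eq_matI)
    fix i j assume "i < dim_row ?R" "j < dim_col ?R"
    then have ij: "i < 2 * k" "j < 2 * k" by auto
    have "?L $$ (i, j) = (if i div k = Suc (j div k) \<and> i mod k = j mod k then inverse (\<chi> g) ^ (i mod k) else 0) +
        (if i div k = j div k \<and> i mod k = Suc (j mod k) then 1 else 0)"
    proof -
      note b = div_mod_bounds[OF ij(1)] div_mod_bounds[OF ij(2)]
      have "shift_mat 2 $$ (i div k, j div k) = (if i div k = Suc (j div k) then 1 else 0 :: 'k)"
        "shift_mat k $$ (i mod k, j mod k) = (if i mod k = Suc (j mod k) then 1 else 0 :: 'k)"
        "weight_mat 0 k g $$ (i mod k, j mod k) = (if i mod k = j mod k then inverse (\<chi> g) ^ (i mod k) else 0)"
        "(1\<^sub>m 2 :: 'k mat) $$ (i div k, j div k) = (if i div k = j div k then 1 else 0)"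
        using b by (simp_all add: shift_mat_def weight_mat_def mat_diag_def)
      then show ?thesis unfolding L using ij by (simp add: kron_index)
    qed
    also have "\<dots> = ?R $$ (i, j)"
      using ij by (cases "i < k"; cases "j < k") (auto simp: double_index)
    finally show "?L $$ (i, j) = ?R $$ (i, j)" .
  qed (auto simp: L)
qed

lemma grp_mat_two_tensor_chain:
  assumes k: "k \<le> n" and h: "h \<in> carrier G"
  shows "grp_mat (tensor_module H (chain 0 2) (chain 0 k)) h =
    mat_diag (2 * k) (\<lambda>i. inverse (\<chi> h) ^ (if i < k then i else Suc i - k))" (is "?L = ?R")
proof -
  note C = left_module_chain[OF order_ge_2, of 0] left_module_chain[OF k, of 0]
  have L: "?L = kron_mat (weight_mat 0 2 h) (weight_mat 0 k h)"
    unfolding grp_mat_tensor[OF C h] tensor_grp_def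
    by (simp only: grp_mat_chain[OF order_ge_2 h] grp_mat_chain[OF k h])
  show ?thesis
  proof (rule eq_matI)
    fix i j assume "i < dim_row ?R" "j < dim_col ?R"
    then have ij: "i < 2 * k" "j < 2 * k" by (auto simp: mat_diag_def)
    have eq: "i = j \<longleftrightarrow> i div k = j div k \<and> i mod k = j mod k" by (metis div_mult_mod_eq)
    have "?L $$ (i, j) = (if i = j then inverse (\<chi> h) ^ (i div k + i mod k) else 0)"
      unfolding L eq using ij div_mod_bounds[OF ij(1)] div_mod_bounds[OF ij(2)]
      by (simp add: kron_index) (auto simp: weight_mat_def mat_diag_def power_add)
    also have "\<dots> = ?R $$ (i, j)"
      using ij by (auto simp: double_index mat_diag_def Suc_diff_le)
    finally show "?L $$ (i, j) = ?R $$ (i, j)" .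
  qed (auto simp: L mat_diag_def)
qed

lemma y_mat_chain_sum:
  assumes "a \<le> n" "b \<le> n"
  shows "y_mat (direct_sum (chain t a) (chain u b)) =
    two_entry_mat (a + b) (\<lambda>j. if Suc j < a + b then Suc j else 0)
      (\<lambda>j. if Suc j = a \<or> Suc j = a + b then 0 else 1) (\<lambda>j. j) (\<lambda>_. 0)"
  unfolding act_direct_sum y_mat_chain[OF assms(1)] y_mat_chain[OF assms(2)] vdim_chain
  by (intro eq_matI) (auto simp: shift_mat_def two_entry_mat_def)

lemma mult_y_mat_chain_sum:
  assumes ab: "a \<le> n" "b \<le> n" and P: "P \<in> carrier_mat (a + b) (a + b)" and ij: "i < a + b" "j < a + b"
  shows "(P * y_mat (direct_sum (chain t a) (chain u b))) $$ (i, j) =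
    (if Suc j = a \<or> Suc j = a + b then 0 else P $$ (i, Suc j))"
  unfolding y_mat_chain_sum[OF ab] using ij by (subst mult_two_entry_mat[OF P ij]) auto

lemma grp_mat_chain_sum:
  assumes "a \<le> n" "b \<le> n" "h \<in> carrier G"
  shows "grp_mat (direct_sum (chain t a) (chain u b)) h =
    mat_diag (a + b) (\<lambda>i. inverse (\<chi> h) ^ (if i < a then t + i else u + (i - a)))"
  unfolding act_direct_sum grp_mat_chain[OF assms(1,3)] grp_mat_chain[OF assms(2,3)] vdim_chain
  by (intro eq_matI) (auto simp: weight_mat_def mat_diag_def)

text \<open>
  Let \<open>v\<^sub>b = y\<^sup>b (e\<^sub>0 \<otimes> e\<^sub>0)\<close>. Then \<open>v\<^sub>k = c\<^sub>k (e\<^sub>1 \<otimes> e\<^sub>k\<^sub>-\<^sub>1)\<close> is not zero but is killed by \<open>y\<close>, so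
  \<open>v\<^sub>0, \<dots>, v\<^sub>k\<close> span a chain. A complement is generated by
  \<open>w\<^sub>0 = v\<^sub>1 - c\<^sub>k (e\<^sub>1 \<otimes> e\<^sub>0)\<close>, of weight \<open>\<chi>\<^sup>-\<^sup>1\<close>: the vectors
  \<open>w\<^sub>b = y\<^sup>b w\<^sub>0 = v\<^sub>b\<^sub>+\<^sub>1 - c\<^sub>k (e\<^sub>1 \<otimes> e\<^sub>b)\<close> form a chain that ends with \<open>w\<^sub>k\<^sub>-\<^sub>2\<close>, because
  \<open>v\<^sub>k = c\<^sub>k (e\<^sub>1 \<otimes> e\<^sub>k\<^sub>-\<^sub>1)\<close>.
\<close>

lemma two_tensor_chain:
  assumes k: "1 \<le> k" "k < n"
  shows "module_iso H (tensor_module H (chain 0 2) (chain 0 k)) (direct_sum (chain 0 (Suc k)) (chain 1 (k - 1)))"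
proof -
  let ?S = "direct_sum (chain 0 (Suc k)) (chain 1 (k - 1))" and ?T = "tensor_module H (chain 0 2) (chain 0 k)"
  have kn: "k \<le> n" "Suc k \<le> n" "k - 1 \<le> n" using k by auto
  note C = left_module_chain[OF order_ge_2, of 0] left_module_chain[OF kn(1), of 0]
  note T = left_module_tensor[OF C]
  note S = left_module_direct_sum[OF left_module_chain[OF kn(2), of 0] left_module_chain[OF kn(3), of 1]]
  have d: "Suc k + (k - 1) = 2 * k" using k by simp
  let ?w = "inverse (\<chi> g)" and ?c = "qint k"
  have c: "?c \<noteq> 0" using qint_nonzero k by simp
  \<comment> \<open>The columns of \<open>P\<close> are \<open>v\<^sub>0, \<dots>, v\<^sub>k, w\<^sub>0, \<dots>, w\<^sub>k\<^sub>-\<^sub>2\<close>; its inverse \<open>Q\<close> has denominators \<open>c\<^sub>k\<close>.\<close>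
  define P where "P = two_entry_mat (2 * k)
    (\<lambda>j. if j \<le> k then j else j - k) (\<lambda>j. if j = k then 0 else 1)
    (\<lambda>j. if j \<le> k then k + j - 1 else j - 1) (\<lambda>j. if j \<le> k then qint j else qint (j - k) - ?c)"
  define Q where "Q = two_entry_mat (2 * k)
    (\<lambda>j. if j < k then j else j - k + 1) (\<lambda>j. if j < k then 1 - qint j / ?c else 1 / ?c)
    (\<lambda>j. if j < k then k + j else if Suc j = 2 * k then 0 else Suc j)
    (\<lambda>j. if j < k then qint j / ?c else if Suc j = 2 * k then 0 else - (1 / ?c))"
  have P: "P \<in> carrier_mat (2 * k) (2 * k)" and Q: "Q \<in> carrier_mat (2 * k) (2 * k)"
    by (simp_all add: P_def Q_def)
  have P_0: "P $$ (i, 0) = (if i = 0 then 1 else 0)"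
    and P_Suc: "\<And>b. Suc b < k \<Longrightarrow> P $$ (i, Suc b) =
      (if i = Suc b then 1 else 0) + (if i = k + b then qint (Suc b) else 0)"
    and P_k: "P $$ (i, k) = (if Suc i = 2 * k then ?c else 0)"
    and P_k_Suc: "\<And>b. Suc b < k \<Longrightarrow> P $$ (i, Suc (k + b)) =
      (if i = Suc b then 1 else 0) + (if i = k + b then qint (Suc b) - ?c else 0)"
    if "i < 2 * k" for i
    using that k by (auto simp: P_def two_entry_mat_def)
  have columns: thesis if "j < 2 * k" "j = 0 \<Longrightarrow> thesis" "\<And>b. j = Suc b \<Longrightarrow> Suc b < k \<Longrightarrow> thesis"
    "\<And>b. j = k + b \<Longrightarrow> Suc b < k \<Longrightarrow> thesis" "\<And>b. j = k + b \<Longrightarrow> Suc b = k \<Longrightarrow> thesis" for j thesis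
  proof (cases "j < k")
    case True
    then show ?thesis using that(2,3) by (cases j) auto
  next
    case False
    then have "j = k + (j - k)" "Suc (j - k) < k \<or> Suc (j - k) = k" using that(1) by auto
    then show ?thesis using that(4,5) by blast
  qed
  have PQ: "P * Q = 1\<^sub>m (2 * k)"
  proof (rule eq_matI)
    fix i j assume "i < dim_row (1\<^sub>m (2 * k) :: 'k mat)" "j < dim_col (1\<^sub>m (2 * k) :: 'k mat)"
    then have ij: "i < 2 * k" "j < 2 * k" by auto
    have "(P * Q) $$ (i, j) =
      P $$ (i, if j < k then j else j - k + 1) * (if j < k then 1 - qint j / ?c else 1 / ?c) +
      P $$ (i, if j < k then k + j else if Suc j = 2 * k then 0 else Suc j) *
        (if j < k then qint j / ?c else if Suc j = 2 * k then 0 else - (1 / ?c))"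
      unfolding Q_def by (subst mult_two_entry_mat[OF P ij]) (use ij k in auto)
    also have "\<dots> = (if i = j then 1 else 0)"
    proof (rule columns[OF ij(2)])
      assume j: "j = 0"
      show ?thesis using k by (simp add: j P_0[OF ij(1)])
    next
      fix b assume j: "j = Suc b" and b: "Suc b < k"
      show ?thesis
        using b c by (simp add: j P_Suc[OF ij(1) b] P_k_Suc[OF ij(1) b]) (auto simp: field_simps)
    next
      fix b assume j: "j = k + b" and b: "Suc b < k"
      show ?thesis
        using b c by (simp add: j P_Suc[OF ij(1) b] P_k_Suc[OF ij(1) b]) (auto simp: field_simps)
    next
      fix b assume j: "j = k + b" and b: "Suc b = k"
      have "P $$ (i, Suc b) = (if i = j then ?c else 0)" using P_k[OF ij(1)] j b by auto
      then show ?thesis using c j b by simp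
    qed
    finally show "(P * Q) $$ (i, j) = 1\<^sub>m (2 * k) $$ (i, j)" using ij by simp
  qed (use P Q in auto)
  have Y: "P * y_mat ?S =
      y_mat ?T * P" (is "P * ?Z = ?Y * P")
  proof (rule eq_matI)
    note Ye = y_mat_two_tensor_chain[OF kn(1)]
    have Yc: "?Y \<in> carrier_mat (2 * k) (2 * k)" using Ye by simp
    then show "dim_row (P * ?Z) = dim_row (?Y * P)" "dim_col (P * ?Z) = dim_col (?Y * P)"
      using P unfolding y_mat_chain_sum[OF kn(2,3)] d by (auto simp: two_entry_mat_def)
    fix i j assume "i < dim_row (?Y * P)" "j < dim_col (?Y * P)"
    then have ij: "i < 2 * k" "j < 2 * k" using P Yc by auto
    have "(?Y * P) $$ (i, j) = ?Y $$ (i, if j \<le> k then j else j - k) * (if j = k then 0 else 1) +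
        ?Y $$ (i, if j \<le> k then k + j - 1 else j - 1) * (if j \<le> k then qint j else qint (j - k) - ?c)"
      unfolding P_def by (subst mult_two_entry_mat[OF Yc ij]) (use ij k in auto)
    also have "\<dots> = (if Suc j = Suc k \<or> Suc j = 2 * k then 0 else P $$ (i, Suc j))"
    proof (rule columns[OF ij(2)])
      assume j: "j = 0"
      have y0: "?Y $$ (i, 0) = (if i = k then 1 else 0) + (if i = Suc 0 \<and> i \<noteq> k then 1 else 0)"
        using ij(1) k by (simp add: Ye)
      show ?thesis
      proof (cases "k = 1")
        case True
        then show ?thesis using ij(1) P_k[OF ij(1)] y0 by (auto simp: j qint_Suc)
      next
        case False
        then show ?thesis using k ij(1) P_Suc[OF ij(1), of 0] by (auto simp: j Ye qint_Suc)
      qed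
    next
      fix b assume j: "j = Suc b" and b: "Suc b < k"
      show ?thesis
      proof (cases "Suc (Suc b) = k")
        case True
        then show ?thesis using ij(1) P_k[OF ij(1)] by (auto simp: j Ye qint_Suc)
      next
        case False
        then show ?thesis using b ij(1) P_Suc[OF ij(1), of "Suc b"] by (auto simp: j Ye qint_Suc)
      qed
    next
      fix b assume j: "j = k + b" and b: "Suc b < k"
      show ?thesis
      proof (cases b)
        case 0
        then show ?thesis using k ij(1) by (auto simp: j Ye)
      next
        case (Suc b')
        then show ?thesis using b ij(1) P_k_Suc[OF ij(1), of b] by (auto simp: j Ye qint_Suc)
      qed
    next
      fix b assume j: "j = k + b" and b: "Suc b = k"
      show ?thesis
      proof (cases b)
        case 0
        then show ?thesis using b ij(1) by (auto simp: j Ye)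
      next
        case (Suc b')
        have "qint k = qint b + ?w ^ b" using qint_Suc[of b] b by simp
        then show ?thesis using Suc b ij(1) by (auto simp: j Ye)
      qed
    qed
    finally show "(P * ?Z) $$ (i, j) = (?Y * P) $$ (i, j)"
      using mult_y_mat_chain_sum[OF kn(2,3), of P i j] P ij unfolding d by simp
  qed
  have "module_iso H ?S ?T"
  proof (rule module_iso_generators[OF S T, where Q = P])
    show "invertible_mat P" by (rule invertible_of_right_inverse[OF P Q PQ])
    show "P * grp_mat ?S h =
        grp_mat ?T h * P" if h: "h \<in> carrier G" for h
      unfolding grp_mat_chain_sum[OF kn(2,3) h] grp_mat_two_tensor_chain[OF kn(1) h] d
    proof (rule diagonal_intertwines[OF P])
      fix i j assume ij: "i < 2 * k" "j < 2 * k" and nz: "P $$ (i, j) \<noteq> 0"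
      have "(if i < k then i else Suc i - k) = (if j < Suc k then 0 + j else 1 + (j - Suc k))"
      proof (rule columns[OF ij(2)])
        assume j: "j = 0"
        show ?thesis using nz k by (simp add: j P_0[OF ij(1)] split: if_splits)
      next
        fix b assume j: "j = Suc b" and b: "Suc b < k"
        show ?thesis using nz b by (auto simp: j P_Suc[OF ij(1) b] split: if_splits)
      next
        fix b assume j: "j = k + b" and b: "Suc b < k"
        show ?thesis
        proof (cases b)
          case 0
          then show ?thesis using nz k by (auto simp: j P_k[OF ij(1)] split: if_splits)
        next
          case (Suc b')
          then show ?thesis using nz b P_k_Suc[OF ij(1), of b'] by (auto simp: j split: if_splits)
        qed
      next
        fix b assume j: "j = k + b" and b: "Suc b = k"
        show ?thesis
        proof (cases b)
          case 0
          then show ?thesis using nz k by (auto simp: j P_k[OF ij(1)] split: if_splits)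
        next
          case (Suc b')
          then show ?thesis using nz b P_k_Suc[OF ij(1), of b'] by (auto simp: j split: if_splits)
        qed
      qed
      then show "inverse (\<chi> h) ^ (if i < k then i else Suc i - k) =
          inverse (\<chi> h) ^ (if j < Suc k then 0 + j else 1 + (j - Suc k))" by simp
    qed
  qed (use P Y d k in auto)
  then show ?thesis by (rule module_iso_sym[OF S T])
qed

text \<open>
  Now \<open>c\<^sub>n = 0\<close>, so \<open>v\<^sub>b = y\<^sup>b (e\<^sub>0 \<otimes> e\<^sub>0)\<close> vanishes for \<open>b = n\<close>, and the span of
  \<open>v\<^sub>0, \<dots>, v\<^sub>n\<^sub>-\<^sub>1\<close> is complemented by the submodule spanned by all \<open>e\<^sub>1 \<otimes> e\<^sub>b\<close>.
\<close>

lemma two_tensor_chain_n: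
  "module_iso H (tensor_module H (chain 0 2) (chain 0 n)) (direct_sum (chain 0 n) (chain 1 n))"
proof -
  let ?S = "direct_sum (chain 0 n) (chain 1 n)" and ?T = "tensor_module H (chain 0 2) (chain 0 n)"
  note C = left_module_chain[OF order_ge_2, of 0] left_module_chain[OF order_refl, of 0]
  note T = left_module_tensor[OF C]
  note S = left_module_direct_sum[OF left_module_chain[OF order_refl, of 0] left_module_chain[OF order_refl, of 1]]
  have d: "n + n = 2 * n" by simp
  have n0: "0 < n" using order_ge_2 by simp
  \<comment> \<open>The columns of \<open>X 1\<close> are \<open>v\<^sub>0, \<dots>, v\<^sub>n\<^sub>-\<^sub>1\<close> and all \<open>e\<^sub>1 \<otimes> e\<^sub>b\<close>; its inverse is \<open>X (- 1)\<close>.\<close>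
  define X where "X s = two_entry_mat (2 * n) (\<lambda>j. j) (\<lambda>_. 1)
    (\<lambda>j. if j < n then n + j - 1 else 0) (\<lambda>j. if j < n then s * qint j else 0)" for s
  have X: "X s \<in> carrier_mat (2 * n) (2 * n)" for s by (simp add: X_def)
  have X_0: "X s $$ (i, 0) = (if i = 0 then 1 else 0)"
    and X_Suc: "\<And>b. Suc b < n \<Longrightarrow> X s $$ (i, Suc b) =
      (if i = Suc b then 1 else 0) + (if i = n + b then s * qint (Suc b) else 0)"
    and X_n: "\<And>b. b < n \<Longrightarrow> X s $$ (i, n + b) = (if i = n + b then 1 else 0)"
    if "i < 2 * n" for i s
    using that n0 by (auto simp: X_def two_entry_mat_def)
  have columns: thesis if "j < 2 * n" "j = 0 \<Longrightarrow> thesis" "\<And>b. j = Suc b \<Longrightarrow> Suc b < n \<Longrightarrow> thesis"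
    "\<And>b. j = n + b \<Longrightarrow> b < n \<Longrightarrow> thesis" for j thesis
  proof (cases "j < n")
    case True
    then show ?thesis using that(2,3) by (cases j) auto
  next
    case False
    then have "j = n + (j - n)" "j - n < n" using that(1) by auto
    then show ?thesis using that(4) by blast
  qed
  have inv: "X 1 * X (- 1) = 1\<^sub>m (2 * n)"
  proof (rule eq_matI)
    fix i j assume "i < dim_row (1\<^sub>m (2 * n) :: 'k mat)" "j < dim_col (1\<^sub>m (2 * n) :: 'k mat)"
    then have ij: "i < 2 * n" "j < 2 * n" by auto
    have "(X 1 * X (- 1)) $$ (i, j) = X 1 $$ (i, j) * 1 +
        X 1 $$ (i, if j < n then n + j - 1 else 0) * (if j < n then - 1 * qint j else 0)"
      unfolding X_def[of "- 1"] by (subst mult_two_entry_mat[OF X ij]) (use ij n0 in auto)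
    also have "\<dots> = (if i = j then 1 else 0)"
    proof (rule columns[OF ij(2)])
      assume j: "j = 0"
      show ?thesis by (simp add: j X_0[OF ij(1)])
    next
      fix b assume j: "j = Suc b" and b: "Suc b < n"
      show ?thesis using b by (simp add: j X_Suc[OF ij(1)] X_n[OF ij(1)])
    next
      fix b assume j: "j = n + b" and b: "b < n"
      show ?thesis using b by (simp add: j X_n[OF ij(1)])
    qed
    finally show "(X 1 * X (- 1)) $$ (i, j) = 1\<^sub>m (2 * n) $$ (i, j)" using ij by simp
  qed (auto simp: X_def two_entry_mat_def)
  have Y: "X 1 * y_mat ?S =
      y_mat ?T * X 1" (is "_ * ?Z = ?Y * _")
  proof (rule eq_matI)
    note Ye = y_mat_two_tensor_chain[OF order_refl]
    have Yc: "?Y \<in> carrier_mat (2 * n) (2 * n)" using Ye by simp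
    then show "dim_row (X 1 * ?Z) = dim_row (?Y * X 1)" "dim_col (X 1 * ?Z) = dim_col (?Y * X 1)"
      using X[of 1] unfolding y_mat_chain_sum[OF order_refl order_refl] d by (auto simp: two_entry_mat_def)
    fix i j assume "i < dim_row (?Y * X 1)" "j < dim_col (?Y * X 1)"
    then have ij: "i < 2 * n" "j < 2 * n" using X[of 1] Yc by auto
    have "(?Y * X 1) $$ (i, j) = ?Y $$ (i, j) * 1 +
        ?Y $$ (i, if j < n then n + j - 1 else 0) * (if j < n then 1 * qint j else 0)"
      unfolding X_def by (subst mult_two_entry_mat[OF Yc ij]) (use ij n0 in auto)
    also have "\<dots> = (if Suc j = n \<or> Suc j = 2 * n then 0 else X 1 $$ (i, Suc j))"
    proof (rule columns[OF ij(2)])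
      assume j: "j = 0"
      show ?thesis using ij(1) order_ge_2 X_Suc[OF ij(1), of 0 1] by (auto simp: j Ye qint_Suc)
    next
      fix b assume j: "j = Suc b" and b: "Suc b < n"
      show ?thesis
      proof (cases "Suc (Suc b) = n")
        case True
        have "qint (Suc b) + inverse (\<chi> g) ^ Suc b = 0"
          using qint_n qint_Suc[of "Suc b"] True by simp
        then show ?thesis using ij(1) True by (auto simp: j Ye add.commute)
      next
        case False
        then show ?thesis using b ij(1) X_Suc[OF ij(1), of "Suc b" 1] by (auto simp: j Ye qint_Suc)
      qed
    next
      fix b assume j: "j = n + b" and b: "b < n"
      show ?thesis
      proof (cases "Suc b = n")
        case True
        then show ?thesis using ij(1) by (auto simp: j Ye)
      next
        case False
        then show ?thesis using b ij(1) X_n[OF ij(1), of "Suc b" 1] by (auto simp: j Ye)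
      qed
    qed
    finally show "(X 1 * ?Z) $$ (i, j) = (?Y * X 1) $$ (i, j)"
      using mult_y_mat_chain_sum[OF order_refl order_refl, of "X 1" i j] X ij unfolding d by simp
  qed
  have "module_iso H ?S ?T"
  proof (rule module_iso_generators[OF S T, where Q = "X 1"])
    show "invertible_mat (X 1)" by (rule invertible_of_right_inverse[OF X X inv])
    show "X 1 * grp_mat ?S h =
        grp_mat ?T h * X 1" if h: "h \<in> carrier G" for h
      unfolding grp_mat_chain_sum[OF order_refl order_refl h] grp_mat_two_tensor_chain[OF order_refl h] d
    proof (rule diagonal_intertwines[OF X])
      fix i j assume ij: "i < 2 * n" "j < 2 * n" and nz: "X 1 $$ (i, j) \<noteq> 0"
      have "(if i < n then i else Suc i - n) = (if j < n then 0 + j else 1 + (j - n))"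
      proof (rule columns[OF ij(2)])
        assume j: "j = 0"
        show ?thesis using nz n0 by (simp add: j X_0[OF ij(1)] split: if_splits)
      next
        fix b assume j: "j = Suc b" and b: "Suc b < n"
        show ?thesis using nz b by (auto simp: j X_Suc[OF ij(1) b] split: if_splits)
      next
        fix b assume j: "j = n + b" and b: "b < n"
        show ?thesis using nz b by (auto simp: j X_n[OF ij(1) b] split: if_splits)
      qed
      then show "inverse (\<chi> h) ^ (if i < n then i else Suc i - n) =
          inverse (\<chi> h) ^ (if j < n then 0 + j else 1 + (j - n))" by simp
    qed
  qed (use X[of 1] Y in \<open>simp_all add: mult_2\<close>)
  then show ?thesis by (rule module_iso_sym[OF S T])
qed

end


section \<open>A truncated Chebyshev recursion\<close>

text \<open>
  With \<open>a = 1\<close> the relation below \<open>n\<close> is the recursion of the Chebyshev polynomials of the second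
  kind in \<open>z / 2\<close>. The relation at \<open>n\<close> amounts to continuing it by
  \<open>U\<^sub>n\<^sub>+\<^sub>1 = U\<^sub>n + a U\<^sub>n - a U\<^sub>n\<^sub>-\<^sub>1\<close>.
\<close>

locale truncated_chebyshev = ring R for R (structure) +
  fixes z a :: 'a and U :: "nat \<Rightarrow> 'a" and n :: nat
  assumes closed [simp]: "z \<in> carrier R" "a \<in> carrier R" "U k \<in> carrier R"
    and commute: "z \<otimes> a = a \<otimes> z"
    and U_0: "U 0 = \<zero>" and U_1: "U (Suc 0) = \<one>"
    and U_step: "\<lbrakk>1 \<le> k; k < n\<rbrakk> \<Longrightarrow> z \<otimes> U k = U (Suc k) \<oplus> a \<otimes> U (k - 1)"
    and U_top: "z \<otimes> U n = U n \<oplus> a \<otimes> U n"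
begin

text \<open>
  The recursion expresses each \<open>U k\<close> through \<open>z\<close>, \<open>a\<close> and the two preceding members.
\<close>

lemma commutes_U:
  assumes x: "x \<in> carrier R" and xz: "x \<otimes> z = z \<otimes> x" and xa: "x \<otimes> a = a \<otimes> x"
  shows "k \<le> n \<Longrightarrow> x \<otimes> U k = U k \<otimes> x"
proof (induction k rule: less_induct)
  case (less k)
  consider "k = 0" | "k = 1" | j where "k = Suc j" "1 \<le> j"
    by (cases k) (auto, metis One_nat_def Suc_leI neq0_conv)
  then show ?case
  proof cases
    case 3
    have j: "x \<otimes> U j = U j \<otimes> x" "x \<otimes> U (j - 1) = U (j - 1) \<otimes> x"
      using less 3 by auto
    have step: "z \<otimes> U j = U (Suc j) \<oplus> a \<otimes> U (j - 1)" using U_step[of j] less.prems 3 by simp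
    have "x \<otimes> U (Suc j) \<oplus> x \<otimes> (a \<otimes> U (j - 1)) = x \<otimes> (z \<otimes> U j)"
      using x by (simp add: step r_distr)
    also have "\<dots> = z \<otimes> U j \<otimes> x"
      using x by (metis closed j(1) m_assoc xz)
    also have "\<dots> = U (Suc j) \<otimes> x \<oplus> a \<otimes> U (j - 1) \<otimes> x"
      using x by (simp add: step l_distr)
    also have "a \<otimes> U (j - 1) \<otimes> x = x \<otimes> (a \<otimes> U (j - 1))"
      using x by (metis closed(2,3) j(2) m_assoc xa)
    finally show ?thesis using x 3 by (simp add: add.right_cancel)
  qed (use x in \<open>simp_all add: U_0 U_1\<close>)
qed

lemma U_commute: "k \<le> n \<Longrightarrow> l \<le> n \<Longrightarrow> U k \<otimes> U l = U l \<otimes> U k"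
  using commutes_U[of "U k" l] commutes_U[of z k] commutes_U[of a k] commute by simp

text \<open>
  The summand with number \<open>t\<close> of \<open>U k \<otimes> U l\<close>, where \<open>s = k + l - 1\<close>. For \<open>s \<ge> n\<close> the condition
  \<open>t + n \<le> s\<close> says \<open>t \<le> r\<close>, where \<open>r = s - n\<close>, and for \<open>s < n\<close> it fails, so that one expression covers
  both product formulas.
\<close>

definition summand :: "nat \<Rightarrow> nat \<Rightarrow> 'a" where
  "summand s t = a [^] t \<otimes> U (if t + n \<le> s then n else s - 2 * t)"

lemma summand_closed [simp]: "summand s t \<in> carrier R"
  by (simp add: summand_def)

text \<open>
  The first part \<open>x (t + 1)\<close> of one term is paired with the second part \<open>y t\<close> of the term before;
  the parts \<open>x 0\<close> and \<open>y m\<close> are left over at the ends.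
\<close>

lemma finsum_shifted:
  assumes c: "\<And>t. x t \<in> carrier R" "\<And>t. y t \<in> carrier R" "\<And>t. e t \<in> carrier R"
    and "x 0 = e 0" "\<And>t. t < m \<Longrightarrow> e (Suc t) = y t"
  shows "(\<Oplus>t\<in>{..<Suc m}. x t \<oplus> y t) = (\<Oplus>t\<in>{..<Suc m}. e t) \<oplus> (\<Oplus>t\<in>{..<m}. x (Suc t)) \<oplus> y m"
  using assms(5)
proof (induction m)
  case 0
  then show ?case using c assms(4) by (simp add: lessThan_Suc)
next
  case (Suc m)
  have IH: "(\<Oplus>t\<in>{..<Suc m}. x t \<oplus> y t) = (\<Oplus>t\<in>{..<Suc m}. e t) \<oplus> (\<Oplus>t\<in>{..<m}. x (Suc t)) \<oplus> y m"
    using Suc by simp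
  have S: "(\<Oplus>t\<in>{..<Suc j}. f t) = f j \<oplus> (\<Oplus>t\<in>{..<j}. f t)" if "\<And>t. f t \<in> carrier R" for f j
    using that by (simp add: lessThan_Suc Pi_def)
  have cl: "(\<Oplus>t\<in>{..<j}. f t) \<in> carrier R" if "\<And>t. f t \<in> carrier R" for f and j :: nat
    using that by (intro finsum_closed) auto
  have "e (Suc m) = y m" using Suc.prems by simp
  then show ?case
    using c cl[of e "Suc m"] cl[of "\<lambda>t. x (Suc t)" m]
    by (simp only: S[of "\<lambda>t. x t \<oplus> y t" "Suc m"] S[of e "Suc m"] S[of "\<lambda>t. x (Suc t)" m] IH a_closed)
      (simp add: a_ac)
qed

lemma z_summand:
  assumes "1 \<le> s - 2 * t \<or> t + n \<le> s"
  shows "z \<otimes> summand s t = a [^] t \<otimes> U (if t + n \<le> s then n else Suc (s - 2 * t)) \<oplus>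
    a [^] Suc t \<otimes> U (if t + n \<le> s then n else s - 2 * t - 1)"
proof -
  have za: "z \<otimes> a [^] t = a [^] t \<otimes> z"
    using commute by (induction t) (simp_all, metis closed(1,2) m_assoc nat_pow_closed)
  have *: "z \<otimes> (a [^] t \<otimes> u) = a [^] t \<otimes> (z \<otimes> u)" if "u \<in> carrier R" for u
    using that by (simp add: m_assoc[symmetric] za)
  show ?thesis
  proof (cases "t + n \<le> s")
    case True
    then show ?thesis by (simp add: summand_def * U_top r_distr m_assoc)
  next
    case False
    then have "z \<otimes> U (s - 2 * t) = U (Suc (s - 2 * t)) \<oplus> a \<otimes> U (s - 2 * t - 1)"
      using assms by (intro U_step) auto
    then show ?thesis using False by (simp add: summand_def * r_distr m_assoc)
  qed
qed

text \<open>
  Multiplying the formula for \<open>k\<close> by \<open>z\<close> splits summand \<open>t\<close> into a multiple of \<open>a\<^sup>t\<close> and a multiple of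
  \<open>a\<^sup>t\<^sup>+\<^sup>1\<close>. The multiples of \<open>a\<^sup>t\<^sup>+\<^sup>1\<close>, together with the first multiple of \<open>a\<^sup>0\<close>, are the summands for
  \<open>k + 1\<close>, and the other multiples of \<open>a\<^sup>t\<^sup>+\<^sup>1\<close>, coming from the next term, are \<open>a\<close> times the summands
  for \<open>k - 1\<close>. Cancelling the latter against the recursion gives the formula for \<open>k + 1\<close>.
\<close>

lemma U_mult_le:
  assumes "k \<le> l" "1 \<le> l" "l \<le> n"
  shows "U k \<otimes> U l = (\<Oplus>t\<in>{..<k}. summand (k + l - 1) t)"
  using assms(1)
proof (induction k rule: less_induct)
  case (less k)
  consider "k = 0" | "k = 1" | m where "k = Suc (Suc m)"
    by (metis One_nat_def not0_implies_Suc)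
  then show ?case
  proof cases
    case 1
    then show ?thesis by (simp add: U_0)
  next
    case 2
    have "summand l 0 = U l" using assms(3) by (auto simp: summand_def)
    then show ?thesis using 2 by (simp add: U_1 lessThan_Suc)
  next
    case 3
    define s where "s = m + l"
    let ?x = "\<lambda>t. a [^] t \<otimes> U (if t + n \<le> s then n else Suc (s - 2 * t))"
      and ?y = "\<lambda>t. a [^] Suc t \<otimes> U (if t + n \<le> s then n else s - 2 * t - 1)"
    have l: "Suc (Suc m) \<le> l" using less.prems 3 by simp
    have IH1: "U (Suc m) \<otimes> U l = (\<Oplus>t\<in>{..<Suc m}. summand s t)"
      using less.IH[of "Suc m"] less.prems 3 by (simp add: s_def)
    have IH0: "U m \<otimes> U l = (\<Oplus>t\<in>{..<m}. summand (s - 1) t)"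
      using less.IH[of m] less.prems 3 by (simp add: s_def)
    have "z \<otimes> (U (Suc m) \<otimes> U l) = (\<Oplus>t\<in>{..<Suc m}. z \<otimes> summand s t)"
      unfolding IH1 by (rule finsum_rdistr) auto
    also have "\<dots> = (\<Oplus>t\<in>{..<Suc m}. ?x t \<oplus> ?y t)"
    proof (rule finsum_cong')
      fix t assume "t \<in> {..<Suc m}"
      then have "1 \<le> s - 2 * t" using l by (simp add: s_def)
      then show "z \<otimes> summand s t = ?x t \<oplus> ?y t" by (intro z_summand disjI1)
    qed auto
    also have "\<dots> = (\<Oplus>t\<in>{..<Suc m}. summand (Suc s) t) \<oplus> (\<Oplus>t\<in>{..<m}. ?x (Suc t)) \<oplus> ?y m"
    proof (rule finsum_shifted)
      have "(if 0 + n \<le> s then n else Suc (s - 2 * 0)) = (if 0 + n \<le> Suc s then n else Suc s - 2 * 0)"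
        by auto
      then show "?x 0 = summand (Suc s) 0" by (simp only: summand_def)
      show "summand (Suc s) (Suc t) = ?y t" if "t < m" for t
        unfolding summand_def by simp
    qed auto
    also have "?y m = summand (Suc s) (Suc m)" by (simp add: summand_def)
    also have "(\<Oplus>t\<in>{..<m}. ?x (Suc t)) = (\<Oplus>t\<in>{..<m}. a \<otimes> summand (s - 1) t)"
    proof (rule finsum_cong')
      fix t assume t: "t \<in> {..<m}"
      have "a [^] Suc t = a \<otimes> a [^] t" by (rule nat_pow_Suc2) simp
      moreover have "(if Suc t + n \<le> s then n else Suc (s - 2 * Suc t)) =
          (if t + n \<le> s - 1 then n else s - 1 - 2 * t)"
        using t l by (auto simp: s_def)
      ultimately show "?x (Suc t) = a \<otimes> summand (s - 1) t"
        unfolding summand_def by (simp only:) (rule m_assoc, auto)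
    qed auto
    also have "\<dots> = a \<otimes> (U m \<otimes> U l)" unfolding IH0 by (rule finsum_rdistr[symmetric]) auto
    finally have "z \<otimes> (U (Suc m) \<otimes> U l) = (\<Oplus>t\<in>{..<Suc (Suc m)}. summand (Suc s) t) \<oplus> a \<otimes> (U m \<otimes> U l)"
      by (simp add: lessThan_Suc[of "Suc m"] a_ac)
    moreover have "z \<otimes> U (Suc m) = U (Suc (Suc m)) \<oplus> a \<otimes> U m"
      using U_step[of "Suc m"] l assms(3) by simp
    then have "z \<otimes> (U (Suc m) \<otimes> U l) = U (Suc (Suc m)) \<otimes> U l \<oplus> a \<otimes> (U m \<otimes> U l)"
      by (simp add: m_assoc[symmetric] l_distr)
    ultimately have "U (Suc (Suc m)) \<otimes> U l = (\<Oplus>t\<in>{..<Suc (Suc m)}. summand (Suc s) t)"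
      by (simp add: add.right_cancel)
    then show ?thesis using 3 by (simp add: s_def)
  qed
qed

lemma U_mult:
  assumes "1 \<le> k" "k \<le> n" "1 \<le> l" "l \<le> n"
  shows "U k \<otimes> U l = (\<Oplus>t\<in>{..<min k l}. summand (k + l - 1) t)"
proof (cases "k \<le> l")
  case True
  then show ?thesis using U_mult_le[of k l] assms by (simp add: min_def)
next
  case False
  then show ?thesis using U_mult_le[of l k] U_commute[of k l] assms by (simp add: min_def add.commute)
qed

end

section \<open>The orbit of the trivial module under \<open>\<tau>\<close>\<close>

context nilpotent_group_datum
begin

abbreviation KG :: "('k, 'g) hopf" where "KG \<equiv> group_algebra G"

lemma KG_simps:
  "carrier KG = free_space (carrier G)" "\<one>\<^bsub>KG\<^esub> = basis_elt \<one>" "u \<oplus>\<^bsub>KG\<^esub> v = (\<lambda>x. u x + v x)"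
  "c \<odot>\<^bsub>KG\<^esub> u = (\<lambda>x. c * u x)" "hbasis KG = carrier G"
  "u \<otimes>\<^bsub>KG\<^esub> v = u \<otimes>\<^bsub>based_algebra (carrier G) (\<lambda>h k. basis_elt (h \<otimes> k)) (basis_elt \<one>)\<^esub> v"
  "comult KG = lin_ext (carrier G) (\<lambda>h. basis_elt (h, h))" "counit KG u = (\<Sum>h\<in>carrier G. u h)"
  by (simp_all add: group_algebra_def Let_def based_hopf_def module.defs hopf.defs based_algebra_def)

lemma trivial_KG_act: "act (trivial_module KG) u = lin_comb 1 (carrier G) (\<lambda>_. 1\<^sub>m 1) u"
  by (intro eq_matI) (auto simp: trivial_module_def KG_simps lin_comb_def)

lemma left_module_trivial_KG: "left_module KG (trivial_module KG)"
proof -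
  let ?L = "lin_comb 1 (carrier G) (\<lambda>_. 1\<^sub>m 1) :: ('g \<Rightarrow> 'k) \<Rightarrow> 'k mat"
  have one: "?L (basis_elt h) = 1\<^sub>m 1" if "h \<in> carrier G" for h
    by (rule lin_comb_basis_elt[OF finite_carrier that]) simp
  have "?L (u \<otimes>\<^bsub>KG\<^esub> v) = ?L u * ?L v" for u v
    unfolding KG_simps by (rule based_mult_lin_comb) (simp_all add: one[simplified])
  then show ?thesis
    unfolding left_module_def trivial_KG_act vdim_trivial
    by (auto simp: KG_simps lin_comb_index sum.distrib sum_distrib_left basis_elt_def finite_carrier
        intro!: eq_matI)
qed

text \<open>
  It follows that a complete list of simple modules is not empty, so that it contains \<open>V 1\<close>.
\<close>

lemma simple_trivial_KG: "simple_module KG (trivial_module KG)"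
  unfolding simple_module_def vdim_trivial
proof (intro conjI allI impI left_module_trivial_KG)
  fix W assume "submodule_set KG (trivial_module KG) W"
  then have W: "W \<subseteq> carrier_vec 1" "0\<^sub>v 1 \<in> W" "\<And>c v. v \<in> W \<Longrightarrow> c \<cdot>\<^sub>v v \<in> W"
    by (auto simp: submodule_set_def)
  show "W = {0\<^sub>v 1} \<or> W = carrier_vec 1"
  proof (cases "W \<subseteq> {0\<^sub>v 1}")
    case True
    then show ?thesis using W(2) by auto
  next
    case False
    then obtain v where v: "v \<in> W" "v \<noteq> 0\<^sub>v 1" by auto
    have dv: "dim_vec v = 1" using v W(1) by auto
    have nz: "v $ 0 \<noteq> 0"
    proof
      assume "v $ 0 = 0"
      then have "v = 0\<^sub>v 1" using dv by (intro eq_vecI) auto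
      then show False using v by simp
    qed
    have "u \<in> W" if "u \<in> carrier_vec 1" for u
    proof -
      have "u = (u $ 0 / v $ 0) \<cdot>\<^sub>v v" using that dv nz by (intro eq_vecI) auto
      then show ?thesis using W(3)[OF v(1)] by metis
    qed
    then show ?thesis using W(1) by auto
  qed
qed simp

text \<open>
  In dimension one, conjugation by a matrix changes nothing.
\<close>

lemma module_iso_scalar:
  assumes iso: "module_iso KG M N" and N: "left_module KG N" and a: "a \<in> free_space (carrier G)"
    and M: "vdim M = 1" "act M a = c \<cdot>\<^sub>m 1\<^sub>m 1"
  shows "vdim N = 1" "act N a = c \<cdot>\<^sub>m 1\<^sub>m 1"
proof -
  show N1: "vdim N = 1" using iso M by (simp add: module_iso_def)
  obtain P where P: "P \<in> carrier_mat 1 1" "invertible_mat P" "P * act M a = act N a * P"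
    using iso a M(1) N1 by (auto simp: module_iso_def KG_simps)
  obtain Q where Q: "Q \<in> carrier_mat 1 1" "P * Q = 1\<^sub>m 1" using invertible_matE[OF P(2,1)] by metis
  have Na: "act N a \<in> carrier_mat 1 1" using N a N1 by (auto simp: left_module_def KG_simps)
  have "act N a = act N a * (P * Q)" using Na Q by simp
  also have "\<dots> = P * act M a * Q" using assoc_mult_mat[OF Na P(1) Q(1)] P(3) by simp
  also have "P * act M a = c \<cdot>\<^sub>m P"
    unfolding M(2) using mult_smult_distrib[OF P(1) one_carrier_mat] right_mult_one_mat[OF P(1)] by simp
  also have "c \<cdot>\<^sub>m P * Q = c \<cdot>\<^sub>m 1\<^sub>m 1" using mult_smult_assoc_mat[OF P(1) Q(1)] Q(2) by simp
  finally show "act N a = c \<cdot>\<^sub>m 1\<^sub>m 1" .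
qed

lemma tensor_KG_basis_elt:
  assumes M: "\<And>h. h \<in> carrier G \<Longrightarrow> act M (basis_elt h) \<in> carrier_mat (vdim M) (vdim M)"
    and N: "\<And>h. h \<in> carrier G \<Longrightarrow> act N (basis_elt h) \<in> carrier_mat (vdim N) (vdim N)" and h: "h \<in> carrier G"
  shows "act (tensor_module KG M N) (basis_elt h) = kron_mat (act M (basis_elt h)) (act N (basis_elt h))"
proof -
  let ?K = "\<lambda>(b, c). kron_mat (act M (basis_elt b)) (act N (basis_elt c))"
  have "act (tensor_module KG M N) (basis_elt h) =
      lin_comb (vdim M * vdim N) (carrier G \<times> carrier G) ?K (comult KG (basis_elt h))"
    by (auto simp: tensor_module_def KG_simps lin_comb_def intro!: sum_mat_cong)
  also have "comult KG (basis_elt h) = basis_elt (h, h)"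
    by (simp add: KG_simps lin_ext_basis_elt[OF finite_carrier h])
  also have "lin_comb (vdim M * vdim N) (carrier G \<times> carrier G) ?K (basis_elt (h, h)) = ?K (h, h)"
    using M N h finite_carrier by (intro lin_comb_basis_elt) auto
  finally show ?thesis by simp
qed

text \<open>
  Each step from \<open>i\<close> to \<open>\<tau> i\<close> tensors with the character \<open>\<chi>\<^sup>-\<^sup>1\<close>, and the orbit starts at the trivial
  module.
\<close>

lemma tau_orbit:
  assumes simples: "complete_simples KG m V" and V1: "module_iso KG (V 1) (trivial_module KG)"
    and tau: "is_tau G \<chi> m V \<tau>"
  shows "(\<tau> ^^ t) 1 \<in> {1..m} \<and> vdim (V ((\<tau> ^^ t) 1)) = 1 \<and>
    (\<forall>h\<in>carrier G. act (V ((\<tau> ^^ t) 1)) (basis_elt h) = inverse (\<chi> h) ^ t \<cdot>\<^sub>m 1\<^sub>m 1)"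
proof (induction t)
  have V: "simple_module KG (V i)" if "i \<in> {1..m}" for i
    using simples that unfolding complete_simples_def by blast
  {
  case 0
  have "1 \<in> {1..m}" using simples simple_trivial_KG by (fastforce simp: complete_simples_def)
  then have L: "left_module KG (V 1)"
    using V by (simp only: simple_module_def)
  have iso: "module_iso KG (trivial_module KG) (V 1)"
    by (rule module_iso_sym[OF L left_module_trivial_KG V1])
  have "act (trivial_module KG) (basis_elt h) = 1 \<cdot>\<^sub>m 1\<^sub>m 1" if "h \<in> carrier G" for h
    using finite_carrier that by (simp add: trivial_module_def KG_simps basis_elt_def)
  note act = module_iso_scalar[OF iso L basis_elt_carrier vdim_trivial this]
  have "act (V 1) (basis_elt h) = inverse (\<chi> h) ^ 0 \<cdot>\<^sub>m 1\<^sub>m 1" if "h \<in> carrier G" for h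
    using act(2)[OF that that] by simp
  then show ?case using \<open>1 \<in> {1..m}\<close> act(1)[OF one_closed one_closed] by simp
next
  case (Suc t)
  let ?i = "(\<tau> ^^ t) 1" and ?L = "character_module G (\<lambda>h. inverse (\<chi> h))"
  have i: "?i \<in> {1..m}" using Suc by simp
  then have ti: "\<tau> ?i \<in> {1..m}" using tau by (auto simp: is_tau_def dest: bij_betwE)
  have N: "left_module KG (V (\<tau> ?i))"
    using V[OF ti] by (simp only: simple_module_def)
  have iso: "module_iso KG (tensor_module KG ?L (V ?i)) (V (\<tau> ?i))"
    using tau i by (auto simp: is_tau_def Let_def)
  have L: "act ?L (basis_elt h) = inverse (\<chi> h) \<cdot>\<^sub>m 1\<^sub>m 1" if "h \<in> carrier G" for h
    using finite_carrier that
    by (simp add: character_module_def basis_elt_def if_distrib[of "\<lambda>x. x * _"] cong: if_cong)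
  have Ld: "vdim ?L = 1" by (simp add: character_module_def)
  have act: "act (tensor_module KG ?L (V ?i)) (basis_elt h) = inverse (\<chi> h) ^ Suc t \<cdot>\<^sub>m 1\<^sub>m 1"
    if h: "h \<in> carrier G" for h
    using Suc h by (subst tensor_KG_basis_elt)
      (auto simp: L Ld kron_smult_left kron_smult_right smult_smult_mat mult.commute)
  have "vdim (tensor_module KG ?L (V ?i)) = 1" using Suc by (simp add: Ld)
  note V' = module_iso_scalar[OF iso N basis_elt_carrier this act]
  show ?case
    unfolding funpow.simps comp_apply using ti V'(1)[OF one_closed one_closed] V'(2) by blast
  }
qed

section \<open>Products of the classes of uniserial modules\<close>

text \<open>
  Since \<open>U 1 = 1\<close> and \<open>z = U 2\<close>, the recursion for \<open>k = 1\<close> holds with \<open>U 0 = 0\<close>. Beyond \<open>n\<close>, where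
  \<open>y\<^sup>n\<close> does not vanish on a chain of length \<open>k\<close>, the value is set to zero as well.
\<close>

lemma green_truncated_chebyshev:
  "truncated_chebyshev (green_ring H) (green_class H (chain 0 2)) (green_class H (chain 1 1))
    (\<lambda>k. if 1 \<le> k \<and> k \<le> n then green_class H (chain 0 k) else \<zero>\<^bsub>green_ring H\<^esub>) n"
proof -
  interpret monoidal_modules H by (rule monoidal_modules_H)
  interpret R: ring "green_ring H" by (rule ring_green_ring)
  have n1: "1 \<le> n" using order_ge_2 by simp
  let ?U = "\<lambda>k. if 1 \<le> k \<and> k \<le> n then green_class H (chain 0 k) else \<zero>\<^bsub>green_ring H\<^esub>"
  let ?z = "green_class H (chain 0 2)" and ?a = "green_class H (chain 1 1)"
  note L = left_module_chain
  have shift: "?a \<otimes>\<^bsub>green_ring H\<^esub> green_class H (chain t j) = green_class H (chain (Suc t) j)" if "j \<le> n" for t j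
    by (simp only: tensor_chain_one[OF that, symmetric] green_class_tensor[OF L[OF n1] L[OF that]])
  have shift0: "?a \<otimes>\<^bsub>green_ring H\<^esub> green_class H (chain 0 j) = green_class H (chain 1 j)" if "j \<le> n" for j
    using shift[OF that, of 0] by (simp only: One_nat_def)
  have U_1: "?U (Suc 0) = \<one>\<^bsub>green_ring H\<^esub>"
    using green_class_trivial n1 by (simp add: trivial_chain)
  show ?thesis
  proof
    show z: "?z \<in> carrier (green_ring H)" and "?a \<in> carrier (green_ring H)"
      by (intro green_class_closed L order_ge_2 n1)+
    show "?U k \<in> carrier (green_ring H)" for k
      by (auto intro!: green_class_closed L)
    have "green_class H (tensor_module H (chain 0 2) (chain 1 1)) = green_class H (chain 1 2)"
      by (intro green_class_iso tensor_one_chain_two tensor_closed L order_ge_2 n1)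
    then show "?z \<otimes>\<^bsub>green_ring H\<^esub> ?a = ?a \<otimes>\<^bsub>green_ring H\<^esub> ?z"
      using green_class_tensor[OF L[OF order_ge_2] L[OF n1]] shift[OF order_ge_2] by simp
    show "?U 0 = \<zero>\<^bsub>green_ring H\<^esub>" by simp
    show "?U (Suc 0) = \<one>\<^bsub>green_ring H\<^esub>" by (rule U_1)
    have "green_class H (tensor_module H (chain 0 2) (chain 0 n)) = green_class H (direct_sum (chain 0 n) (chain 1 n))"
      by (intro green_class_iso two_tensor_chain_n tensor_closed left_module_direct_sum L order_ge_2 order_refl)
    then show "?z \<otimes>\<^bsub>green_ring H\<^esub> ?U n = ?U n \<oplus>\<^bsub>green_ring H\<^esub> ?a \<otimes>\<^bsub>green_ring H\<^esub> ?U n"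
      using n1 by (simp add: green_class_tensor green_class_direct_sum L order_ge_2 shift0 del: One_nat_def)
    show "?z \<otimes>\<^bsub>green_ring H\<^esub> ?U k = ?U (Suc k) \<oplus>\<^bsub>green_ring H\<^esub> ?a \<otimes>\<^bsub>green_ring H\<^esub> ?U (k - 1)"
      if k: "1 \<le> k" "k < n" for k
    proof (cases "k = 1")
      case True
      then show ?thesis using U_1 z n1 order_ge_2 \<open>?a \<in> _\<close> by (simp add: numeral_2_eq_2)
    next
      case False
      have "green_class H (tensor_module H (chain 0 2) (chain 0 k)) =
          green_class H (direct_sum (chain 0 (Suc k)) (chain 1 (k - 1)))"
        using k by (intro green_class_iso two_tensor_chain tensor_closed left_module_direct_sum L order_ge_2) auto
      moreover have "1 \<le> k - 1" "k - 1 \<le> n" using k False by auto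
      ultimately show ?thesis
        using k by (simp add: green_class_tensor green_class_direct_sum L order_ge_2 shift0 del: One_nat_def)
    qed
  qed
qed

lemma green_class_chain:
  assumes "1 \<le> j" "j \<le> n"
  shows "green_class H (chain t j) = green_class H (chain 1 1) [^]\<^bsub>green_ring H\<^esub> t \<otimes>\<^bsub>green_ring H\<^esub> green_class H (chain 0 j)"
proof (induction t)
  interpret monoidal_modules H by (rule monoidal_modules_H)
  interpret R: ring "green_ring H" by (rule ring_green_ring)
  note L = left_module_chain
  have n1: "1 \<le> n" using order_ge_2 by simp
  note c = green_class_closed[OF L[OF n1, of 1]] green_class_closed[OF L[OF assms(2), of 0]]
  {
    case 0
    show ?case using c by simp
  next
    case (Suc t)
    have "green_class H (chain (Suc t) j) = green_class H (chain 1 1) \<otimes>\<^bsub>green_ring H\<^esub> green_class H (chain t j)"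
      by (simp only: tensor_chain_one[OF assms(2), symmetric] green_class_tensor[OF L[OF n1] L[OF assms(2)]])
    also have "\<dots> = green_class H (chain 1 1) [^]\<^bsub>green_ring H\<^esub> Suc t \<otimes>\<^bsub>green_ring H\<^esub> green_class H (chain 0 j)"
      unfolding Suc R.nat_pow_Suc2[OF c(1)] using c by (simp only: R.m_assoc R.nat_pow_closed)
    finally show ?case .
  }
qed

lemma green_class_chain_mult:
  assumes kl: "1 \<le> k" "k \<le> n" "1 \<le> l" "l \<le> n"
  shows "green_class H (chain 0 k) \<otimes>\<^bsub>green_ring H\<^esub> green_class H (chain 0 l) =
    (\<Oplus>\<^bsub>green_ring H\<^esub>t\<in>{..<min k l}. green_class H (chain t (if t + n \<le> k + l - 1 then n else k + l - 1 - 2 * t)))"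
proof -
  interpret monoidal_modules H by (rule monoidal_modules_H)
  interpret C: truncated_chebyshev "green_ring H" "green_class H (chain 0 2)" "green_class H (chain 1 1)"
    "\<lambda>k. if 1 \<le> k \<and> k \<le> n then green_class H (chain 0 k) else \<zero>\<^bsub>green_ring H\<^esub>" n
    by (rule green_truncated_chebyshev)
  have "green_class H (chain 0 k) \<otimes>\<^bsub>green_ring H\<^esub> green_class H (chain 0 l) =
      (\<Oplus>\<^bsub>green_ring H\<^esub>t\<in>{..<min k l}. C.summand (k + l - 1) t)"
    using C.U_mult[OF kl] kl by simp
  also have "\<dots> = (\<Oplus>\<^bsub>green_ring H\<^esub>t\<in>{..<min k l}.
      green_class H (chain t (if t + n \<le> k + l - 1 then n else k + l - 1 - 2 * t)))"
  proof (rule C.finsum_cong')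
    show "(\<lambda>t. green_class H (chain t (if t + n \<le> k + l - 1 then n else k + l - 1 - 2 * t)))
        \<in> {..<min k l} \<rightarrow> carrier (green_ring H)"
      by (auto intro!: green_class_closed left_module_chain)
    fix t assume "t \<in> {..<min k l}"
    then have j: "1 \<le> (if t + n \<le> k + l - 1 then n else k + l - 1 - 2 * t)"
      "(if t + n \<le> k + l - 1 then n else k + l - 1 - 2 * t) \<le> n"
      using order_ge_2 by auto
    show "C.summand (k + l - 1) t = green_class H (chain t (if t + n \<le> k + l - 1 then n else k + l - 1 - 2 * t))"
      by (simp only: C.summand_def green_class_chain[OF j, of t] j simp_thms if_True)
  qed simp
  finally show ?thesis .
qed

end

theorem proposition4p2:
  fixes G :: "'g monoid" and \<chi> :: "'g \<Rightarrow> 'k::{alg_closed_field, field_char_0}"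
    and g :: 'g and n m k l :: nat
    and V :: "nat \<Rightarrow> ('g, 'k) fd_module" and \<tau> :: "nat \<Rightarrow> nat"
    and H :: "('k, nat \<times> 'g) hopf"
    and M :: "nat \<Rightarrow> nat \<Rightarrow> ((nat \<times> 'g, 'k) fd_module set \<Rightarrow>\<^sub>0 int) set"
  assumes datum: "nilpotent_group_datum G \<chi> g n"
    and simples: "complete_simples (group_algebra G) m V"
    and V1: "module_iso (group_algebra G) (V 1) (trivial_module (group_algebra G))"
    and tau: "is_tau G \<chi> m V \<tau>"
    and H: "H = H_hopf G \<chi> g n"
    and M: "\<And>i j. M i j = green_class H (indec_module G \<chi> n (V i) j)"
    and kl: "1 \<le> k" "k \<le> n" "1 \<le> l" "l \<le> n"
  shows "(k + l - 1 \<le> n \<longrightarrow>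
      M 1 k \<otimes>\<^bsub>green_ring H\<^esub> M 1 l =
        (\<Oplus>\<^bsub>green_ring H\<^esub>t\<in>{0..min k l - 1}. M ((\<tau> ^^ t) 1) (k + l - 1 - 2 * t)))
    \<and> (k + l - 1 \<ge> n \<longrightarrow> (let r = k + l - 1 - n in
      M 1 k \<otimes>\<^bsub>green_ring H\<^esub> M 1 l =
        (\<Oplus>\<^bsub>green_ring H\<^esub>t\<in>{0..r}. M ((\<tau> ^^ t) 1) n)
        \<oplus>\<^bsub>green_ring H\<^esub>
        (\<Oplus>\<^bsub>green_ring H\<^esub>t\<in>{r + 1..min k l - 1}. M ((\<tau> ^^ t) 1) (k + l - 1 - 2 * t))))"
proof -
  interpret D: nilpotent_group_datum G \<chi> g n by (rule datum)
  interpret monoidal_modules H unfolding H by (rule D.monoidal_modules_H)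
  interpret R: ring "green_ring H" by (rule ring_green_ring)
  define s where "s = k + l - 1"
  let ?j = "\<lambda>t. if t + n \<le> s then n else s - 2 * t"
  have Mc: "M ((\<tau> ^^ t) 1) j = green_class H (D.chain t j)" for t j
    unfolding M using D.tau_orbit[OF simples V1 tau, of t] D.indec_module_chain[of "V ((\<tau> ^^ t) 1)" t j] by simp
  have M1: "M 1 j = green_class H (D.chain 0 j)" for j
    using Mc[of 0 j] by simp
  have closed: "M ((\<tau> ^^ t) 1) j \<in> carrier (green_ring H)" if "j \<le> n" for t j
    unfolding Mc using D.left_module_chain[OF that] by (intro green_class_closed) (simp add: H)
  have idx: "{..<min k l} = {0..min k l - 1}" using kl by auto
  have prod: "M 1 k \<otimes>\<^bsub>green_ring H\<^esub> M 1 l = (\<Oplus>\<^bsub>green_ring H\<^esub>t\<in>{0..min k l - 1}. M ((\<tau> ^^ t) 1) (?j t))"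
    using D.green_class_chain_mult[OF kl] unfolding M1 Mc idx s_def H by simp
  show ?thesis
  proof (intro conjI impI)
    assume le: "k + l - 1 \<le> n"
    have "?j t = s - 2 * t" for t using le by (auto simp: s_def)
    then show "M 1 k \<otimes>\<^bsub>green_ring H\<^esub> M 1 l =
        (\<Oplus>\<^bsub>green_ring H\<^esub>t\<in>{0..min k l - 1}. M ((\<tau> ^^ t) 1) (k + l - 1 - 2 * t))"
      unfolding prod by (simp only: s_def)
  next
    assume ge: "k + l - 1 \<ge> n"
    define r where "r = k + l - 1 - n"
    have split: "{0..min k l - 1} = {0..r} \<union> {r + 1..min k l - 1}"
      using ge kl by (auto simp: r_def)
    have c: "M ((\<tau> ^^ t) 1) (?j t) \<in> carrier (green_ring H)" for t
      by (rule closed) auto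
    have "M 1 k \<otimes>\<^bsub>green_ring H\<^esub> M 1 l =
        (\<Oplus>\<^bsub>green_ring H\<^esub>t\<in>{0..r}. M ((\<tau> ^^ t) 1) (?j t)) \<oplus>\<^bsub>green_ring H\<^esub>
        (\<Oplus>\<^bsub>green_ring H\<^esub>t\<in>{r + 1..min k l - 1}. M ((\<tau> ^^ t) 1) (?j t))"
      unfolding prod split by (rule R.finsum_Un_disjoint) (use c in auto)
    also have "(\<Oplus>\<^bsub>green_ring H\<^esub>t\<in>{0..r}. M ((\<tau> ^^ t) 1) (?j t)) = (\<Oplus>\<^bsub>green_ring H\<^esub>t\<in>{0..r}. M ((\<tau> ^^ t) 1) n)"
      by (rule R.finsum_cong') (use ge closed in \<open>auto simp: r_def s_def\<close>)
    also have "(\<Oplus>\<^bsub>green_ring H\<^esub>t\<in>{r + 1..min k l - 1}. M ((\<tau> ^^ t) 1) (?j t)) =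
        (\<Oplus>\<^bsub>green_ring H\<^esub>t\<in>{r + 1..min k l - 1}. M ((\<tau> ^^ t) 1) (k + l - 1 - 2 * t))"
      by (rule R.finsum_cong') (use ge closed in \<open>auto simp: r_def s_def\<close>)
    finally show "let r = k + l - 1 - n in M 1 k \<otimes>\<^bsub>green_ring H\<^esub> M 1 l =
        (\<Oplus>\<^bsub>green_ring H\<^esub>t\<in>{0..r}. M ((\<tau> ^^ t) 1) n) \<oplus>\<^bsub>green_ring H\<^esub>
        (\<Oplus>\<^bsub>green_ring H\<^esub>t\<in>{r + 1..min k l - 1}. M ((\<tau> ^^ t) 1) (k + l - 1 - 2 * t))"
      unfolding Let_def r_def .
  qed
qed

end
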